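(* Let $(A,d_A,m_A)$ and $(B,d_B,m_B)$ be dg commutative algebras and $(\sigma,\tau,h)$ a semifull algebra contraction of $(A,d_A,m_A)$ onto $(B,d_B,m_B)$. Suppose maps $\lambda_n:A^{\otimes n}\to A$, $n\ge2$, make $(A,\lambda_1=d_A,\lambda_2,\lambda_3,\dots)$ a degree $k$ derived Poisson algebra. Let $\ell_n:B^{\otimes n}\to B$ ($n\ge2$) and $\tau_\infty=(\tau_1,\tau_2,\dots)$ be the transferred $L_\infty$ structure on $B[-k]$ and the $L_\infty$ quasi-isomorphism $B[-k]\to A[-k]$ given by homotopy transfer along $(\sigma,\tau,h)$, i.e. $\tau_1=\tau$ and recursively $$\tau_{n+1}(x_1,\dots,x_n,y)=\sum\pm\tfrac{1}{(p-1)!}\,h\lambda_p\big(\tau_{i_1}(x_{\sigma(1)},\dots),\dots,\tau_{i_p+1}(\dots,x_{\sigma(n)},y)\big),$$ $$\ell_{n+1}(x_1,\dots,x_n,y)=\sum\pm\tfrac{1}{(p-1)!}\,\sigma\lambda_p\big(\tau_{i_1}(x_{\sigma(1)},\dots),\dots,\tau_{i_p+1}(\dots,x_{\sigma(n)},y)\big),$$ the sums running over $p\ge2$, $i_1,\dots,i_{p-1}\ge1$, $i_p\ge0$ with $i_1+\dots+i_p=n$ and over $(i_1,\dots,i_p)$-shuffles $\sigma$, with the appropriate Koszul signs. Then $(B,\ell_1=d_B,\ell_2,\ell_3,\dots)$ is a degree $k$ derived Poisson algebra (with product $m_B$), and $\tau_\infty$ is a morphism of degree $k$ derived Poisson algebras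 from $B$ to $A$.
   Context: A contraction $(\sigma,\tau,h)$ of a cochain complex $(A,d_A)$ onto $(B,d_B)$ consists of cochain maps $\sigma:A\to B$, $\tau:B\to A$ and a degree $-1$ map $h:A\to A$ with $\sigma\tau=\mathrm{id}_B$, $hd_A+d_Ah=\tau\sigma-\mathrm{id}_A$, $\sigma h=0$, $h\tau=0$, $h^2=0$. For dg commutative algebras it is a semifull algebra contraction if for all $a,b\in A$, $x,y\in B$: $h((-1)^{|a|+1}h(a)b+ah(b))=h(a)h(b)$; $h(a\tau(x))=h(a)\tau(x)$; $\sigma((-1)^{|a|+1}h(a)b+ah(b))=0$; $\sigma(a\tau(x))=\sigma(a)x$; $\tau(xy)=\tau(x)\tau(y)$. A degree $k$ derived Poisson algebra is a graded commutative algebra $\mathcal A$ with multilinear maps $\lambda_n:\mathcal A^{\otimes n}\to\mathcal A$ of degree $k(n-1)+2-n$, graded antisymmetric and forming an $L_\infty$ algebra on $\mathcal A[-k]$, each $a\mapsto\lambda_n(a_1,\dots,a_{n-1},a)$ a graded derivation. A morphism $\mathcal B\to\mathcal A$ of such is a family $f_n:\mathcal B^{\otimes n}\to\mathcal A$ of degree $(k-1)(n-1)$, graded symmetric as degree $0$ maps $\mathcal B[1-k]^{\otimes n}\to\mathcal A[1-k]$, which after décalage is an $L_\infty$ morphism $\mathcal B[-k]\to\mathcal A[-k]$, and satisfies $f_{n+1}(x_1,\dots,x_n,yz)=\sum_{i=0}^n\sum_{\sigma\in\mathrm{Sh}(i,n-i)}(-1)^{\diamond}f_{i+1}(x_{\sigma(1)},\dots,x_{\sigma(i)},y)f_{n-i+1}(x_{\sigma(i+1)},\dots,x_{\sigma(n)},z)$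 with $\diamond=\epsilon(\sigma)+|y|((n-i)(k-1)+|x_{\sigma(i+1)}|+\dots+|x_{\sigma(n)}|)$, $\epsilon(\sigma)$ the Koszul sign with $x_j$ of degree $|x_j|+k-1$. *)

theory Defs
  imports Main "HOL-Library.FuncSet"
begin

definition signed :: "int \<Rightarrow> 'a::ab_group_add \<Rightarrow> 'a" where
  "signed e x = (if even e then x else - x)"

definition homog :: "(int \<Rightarrow> 'a set) \<Rightarrow> 'a \<Rightarrow> bool" where
  "homog G x \<longleftrightarrow> (\<exists>i. x \<in> G i)"

text \<open>Degree of a homogeneous element (for 0 the choice is irrelevant).\<close>
definition deg :: "(int \<Rightarrow> 'a set) \<Rightarrow> 'a \<Rightarrow> int" where
  "deg G x = (SOME i. x \<in> G i)"

definition inversions :: "nat list \<Rightarrow> (nat \<times> nat) set" where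
  "inversions ps = {(a, b). a < b \<and> b < length ps \<and> ps ! a > ps ! b}"

text \<open>Koszul sign exponent of reordering the sequence with degrees ds
  (x_0,...,x_{n-1}) into (x_{ps!0},...,x_{ps!(n-1)}).\<close>
definition koszul_exp :: "int list \<Rightarrow> nat list \<Rightarrow> int" where
  "koszul_exp ds ps = (\<Sum>(a, b)\<in>inversions ps. ds ! (ps ! a) * ds ! (ps ! b))"

definition anti_exp :: "int list \<Rightarrow> nat list \<Rightarrow> int" where
  "anti_exp ds ps = koszul_exp ds ps + int (card (inversions ps))"

definition perms :: "nat \<Rightarrow> nat list set" where
  "perms n = {ps. distinct ps \<and> set ps = {0..<n}}"

definition sdegs :: "(int \<Rightarrow> 'a set) \<Rightarrow> int \<Rightarrow> 'a list \<Rightarrow> int list" where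
  "sdegs G s xs = map (\<lambda>x. deg G x + s) xs"

definition sel :: "'a list \<Rightarrow> nat set \<Rightarrow> 'a list" where
  "sel xs S = map (nth xs) (sorted_list_of_set S)"

definition unsh :: "nat \<Rightarrow> nat set \<Rightarrow> nat list" where
  "unsh n S = sorted_list_of_set S @ sorted_list_of_set ({0..<n} - S)"

text \<open>Ordered partitions of {0..<n} into p nonempty blocks, blocks ordered by
  their minima (each unordered partition counted exactly once).\<close>
definition opart :: "nat \<Rightarrow> nat \<Rightarrow> (nat \<Rightarrow> nat) set" where
  "opart n p = {c \<in> {0..<n} \<rightarrow>\<^sub>E {0..<p}. (\<forall>j<p. \<exists>i<n. c i = j) \<and>
      (\<forall>j. Suc j < p \<longrightarrow> Min {i. i < n \<and> c i = j} < Min {i. i < n \<and> c i = Suc j})}"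

definition blk :: "(nat \<Rightarrow> nat) \<Rightarrow> nat \<Rightarrow> nat \<Rightarrow> nat list" where
  "blk c n j = filter (\<lambda>i. c i = j) [0..<n]"

definition pperm :: "(nat \<Rightarrow> nat) \<Rightarrow> nat \<Rightarrow> nat \<Rightarrow> nat list" where
  "pperm c n p = concat (map (blk c n) [0..<p])"

definition part_sum :: "int \<Rightarrow> (int \<Rightarrow> 'b set) \<Rightarrow> (nat \<Rightarrow> 'a list \<Rightarrow> 'a::ab_group_add)
    \<Rightarrow> (nat \<Rightarrow> 'b list \<Rightarrow> 'a) \<Rightarrow> 'b list \<Rightarrow> nat \<Rightarrow> 'a" where
  "part_sum s G mu f xs p =
     (let n = length xs in
      \<Sum>c\<in>opart n p. signed (koszul_exp (sdegs G s xs) (pperm c n p))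
         (mu p (map (\<lambda>j. f (length (blk c n j)) (map (nth xs) (blk c n j))) [0..<p])))"

definition graded_space :: "('k::field \<Rightarrow> 'a::ab_group_add \<Rightarrow> 'a) \<Rightarrow> (int \<Rightarrow> 'a set) \<Rightarrow> bool" where
  "graded_space sm G \<longleftrightarrow>
     (\<forall>c x y. sm c (x + y) = sm c x + sm c y) \<and> (\<forall>c d x. sm (c + d) x = sm c x + sm d x) \<and>
     (\<forall>c d x. sm (c * d) x = sm c (sm d x)) \<and> (\<forall>x. sm 1 x = x) \<and>
     (\<forall>i. 0 \<in> G i \<and> (\<forall>x\<in>G i. \<forall>y\<in>G i. x + y \<in> G i) \<and> (\<forall>c. \<forall>x\<in>G i. sm c x \<in> G i)) \<and>
     (\<forall>x. \<exists>!g. finite {i. g i \<noteq> 0} \<and> (\<forall>i. g i \<in> G i) \<and> x = (\<Sum>i\<in>{i. g i \<noteq> 0}. g i))"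

definition linear_map :: "('k::field \<Rightarrow> 'a::ab_group_add \<Rightarrow> 'a) \<Rightarrow> ('k \<Rightarrow> 'b::ab_group_add \<Rightarrow> 'b)
    \<Rightarrow> ('a \<Rightarrow> 'b) \<Rightarrow> bool" where
  "linear_map smA smB f \<longleftrightarrow> (\<forall>x y. f (x + y) = f x + f y) \<and> (\<forall>c x. f (smA c x) = smB c (f x))"

definition graded_deg :: "(int \<Rightarrow> 'a set) \<Rightarrow> (int \<Rightarrow> 'b set) \<Rightarrow> int \<Rightarrow> ('a \<Rightarrow> 'b) \<Rightarrow> bool" where
  "graded_deg GA GB e f \<longleftrightarrow> (\<forall>i. \<forall>x\<in>GA i. f x \<in> GB (i + e))"

definition multilinear :: "('k::field \<Rightarrow> 'a::ab_group_add \<Rightarrow> 'a) \<Rightarrow> ('k \<Rightarrow> 'b::ab_group_add \<Rightarrow> 'b)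
    \<Rightarrow> nat \<Rightarrow> ('a list \<Rightarrow> 'b) \<Rightarrow> bool" where
  "multilinear smA smB n f \<longleftrightarrow>
     (\<forall>xs i y z c. length xs = n \<and> i < n \<longrightarrow>
        f (xs[i := y + z]) = f (xs[i := y]) + f (xs[i := z]) \<and>
        f (xs[i := smA c y]) = smB c (f (xs[i := y])))"

definition graded_mult :: "(int \<Rightarrow> 'a set) \<Rightarrow> (int \<Rightarrow> 'b set) \<Rightarrow> nat \<Rightarrow> int \<Rightarrow> ('a list \<Rightarrow> 'b) \<Rightarrow> bool" where
  "graded_mult GA GB n e f \<longleftrightarrow>
     (\<forall>xs ds. length xs = n \<and> length ds = n \<and> (\<forall>i<n. xs ! i \<in> GA (ds ! i)) \<longrightarrow>
        f xs \<in> GB (sum_list ds + e))"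

definition graded_comm_alg :: "('k::field \<Rightarrow> 'a::ab_group_add \<Rightarrow> 'a) \<Rightarrow> (int \<Rightarrow> 'a set)
    \<Rightarrow> ('a \<Rightarrow> 'a \<Rightarrow> 'a) \<Rightarrow> bool" where
  "graded_comm_alg sm G m \<longleftrightarrow> graded_space sm G \<and>
     (\<forall>x y z. m (m x y) z = m x (m y z)) \<and>
     (\<forall>x y z. m (x + y) z = m x z + m y z \<and> m x (y + z) = m x y + m x z) \<and>
     (\<forall>c x y. m (sm c x) y = sm c (m x y) \<and> m x (sm c y) = sm c (m x y)) \<and>
     (\<forall>i j. \<forall>x\<in>G i. \<forall>y\<in>G j. m x y \<in> G (i + j) \<and> m y x = signed (i * j) (m x y))"

definition dgca :: "('k::field \<Rightarrow> 'a::ab_group_add \<Rightarrow> 'a) \<Rightarrow> (int \<Rightarrow> 'a set)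
    \<Rightarrow> ('a \<Rightarrow> 'a \<Rightarrow> 'a) \<Rightarrow> ('a \<Rightarrow> 'a) \<Rightarrow> bool" where
  "dgca sm G m d \<longleftrightarrow> graded_comm_alg sm G m \<and> linear_map sm sm d \<and> graded_deg G G 1 d \<and>
     (\<forall>x. d (d x) = 0) \<and>
     (\<forall>i. \<forall>x\<in>G i. \<forall>y. d (m x y) = m (d x) y + signed i (m x (d y)))"

definition contraction :: "('k::field \<Rightarrow> 'a::ab_group_add \<Rightarrow> 'a) \<Rightarrow> (int \<Rightarrow> 'a set) \<Rightarrow> ('a \<Rightarrow> 'a)
    \<Rightarrow> ('k \<Rightarrow> 'b::ab_group_add \<Rightarrow> 'b) \<Rightarrow> (int \<Rightarrow> 'b set) \<Rightarrow> ('b \<Rightarrow> 'b)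
    \<Rightarrow> ('a \<Rightarrow> 'b) \<Rightarrow> ('b \<Rightarrow> 'a) \<Rightarrow> ('a \<Rightarrow> 'a) \<Rightarrow> bool" where
  "contraction smA GA dA smB GB dB sig tau h \<longleftrightarrow>
     linear_map smA smB sig \<and> linear_map smB smA tau \<and> linear_map smA smA h \<and>
     graded_deg GA GB 0 sig \<and> graded_deg GB GA 0 tau \<and> graded_deg GA GA (-1) h \<and>
     (\<forall>a. sig (dA a) = dB (sig a)) \<and> (\<forall>x. tau (dB x) = dA (tau x)) \<and>
     (\<forall>x. sig (tau x) = x) \<and> (\<forall>a. h (dA a) + dA (h a) = tau (sig a) - a) \<and>
     (\<forall>a. sig (h a) = 0) \<and> (\<forall>x. h (tau x) = 0) \<and> (\<forall>a. h (h a) = 0)"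

definition semifull_alg_contraction where
  "semifull_alg_contraction smA GA mA dA smB GB mB dB sig tau h \<longleftrightarrow>
     contraction smA GA dA smB GB dB sig tau h \<and>
     (\<forall>i. \<forall>a\<in>GA i. \<forall>b. h (signed (i + 1) (mA (h a) b) + mA a (h b)) = mA (h a) (h b)) \<and>
     (\<forall>a x. h (mA a (tau x)) = mA (h a) (tau x)) \<and>
     (\<forall>i. \<forall>a\<in>GA i. \<forall>b. sig (signed (i + 1) (mA (h a) b) + mA a (h b)) = 0) \<and>
     (\<forall>a x. sig (mA a (tau x)) = mB (sig a) x) \<and>
     (\<forall>x y. tau (mB x y) = mA (tau x) (tau y))"

text \<open>Decalage of antisymmetric brackets on A[-k] to symmetric degree 1 brackets on
  A[1-k]: mu_n(s x_1,...,s x_n) = s lambda_n(x_1,...,x_n) with the Koszul sign of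
  moving the desuspensions past the suspended arguments.\<close>
definition dec :: "int \<Rightarrow> (int \<Rightarrow> 'a set) \<Rightarrow> (nat \<Rightarrow> 'a list \<Rightarrow> 'a::ab_group_add)
    \<Rightarrow> nat \<Rightarrow> 'a list \<Rightarrow> 'a" where
  "dec k G lam n xs = signed (\<Sum>i<n. int (n - 1 - i) * (deg G (xs ! i) + k - 1)) (lam n xs)"

definition linf1 :: "(int \<Rightarrow> 'a set) \<Rightarrow> int \<Rightarrow> (nat \<Rightarrow> 'a list \<Rightarrow> 'a::ab_group_add) \<Rightarrow> bool" where
  "linf1 G s mu \<longleftrightarrow>
     (\<forall>n\<ge>1. \<forall>xs. length xs = n \<and> list_all (homog G) xs \<longrightarrow>
        (\<Sum>i=1..n. \<Sum>S\<in>{S. S \<subseteq> {0..<n} \<and> card S = i}.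
           signed (koszul_exp (sdegs G s xs) (unsh n S))
             (mu (n - i + 1) (mu i (sel xs S) # sel xs ({0..<n} - S)))) = 0)"

definition derived_poisson :: "int \<Rightarrow> ('k::field \<Rightarrow> 'a::ab_group_add \<Rightarrow> 'a) \<Rightarrow> (int \<Rightarrow> 'a set)
    \<Rightarrow> ('a \<Rightarrow> 'a \<Rightarrow> 'a) \<Rightarrow> (nat \<Rightarrow> 'a list \<Rightarrow> 'a) \<Rightarrow> bool" where
  "derived_poisson k sm G m lam \<longleftrightarrow>
     graded_comm_alg sm G m \<and>
     (\<forall>n\<ge>1. multilinear sm sm n (lam n) \<and>
        graded_mult G G n (k * (int n - 1) + 2 - int n) (lam n)) \<and>
     (\<forall>n\<ge>1. \<forall>xs ps. length xs = n \<and> list_all (homog G) xs \<and> ps \<in> perms n \<longrightarrow>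
        lam n (map (nth xs) ps) = signed (anti_exp (sdegs G k xs) ps) (lam n xs)) \<and>
     linf1 G (k - 1) (dec k G lam) \<and>
     (\<forall>n\<ge>1. \<forall>as b c. length as = n - 1 \<and> list_all (homog G) as \<and> homog G b \<longrightarrow>
        lam n (as @ [m b c]) = m (lam n (as @ [b])) c +
          signed (deg G b * (k * (int n - 1) + 2 - int n + sum_list (map (deg G) as)))
            (m b (lam n (as @ [c]))))"

definition dp_morphism :: "int \<Rightarrow> ('k::field \<Rightarrow> 'b::ab_group_add \<Rightarrow> 'b) \<Rightarrow> (int \<Rightarrow> 'b set)
    \<Rightarrow> ('b \<Rightarrow> 'b \<Rightarrow> 'b) \<Rightarrow> (nat \<Rightarrow> 'b list \<Rightarrow> 'b)
    \<Rightarrow> ('k \<Rightarrow> 'a::ab_group_add \<Rightarrow> 'a) \<Rightarrow> (int \<Rightarrow> 'a set) \<Rightarrow> ('a \<Rightarrow> 'a \<Rightarrow> 'a) \<Rightarrow> (nat \<Rightarrow> 'a list \<Rightarrow> 'a)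
    \<Rightarrow> (nat \<Rightarrow> 'b list \<Rightarrow> 'a) \<Rightarrow> bool" where
  "dp_morphism k smB GB mB ell smA GA mA lam f \<longleftrightarrow>
     (\<forall>n\<ge>1. multilinear smB smA n (f n) \<and> graded_mult GB GA n ((k - 1) * (int n - 1)) (f n)) \<and>
     (\<forall>n\<ge>1. \<forall>xs ps. length xs = n \<and> list_all (homog GB) xs \<and> ps \<in> perms n \<longrightarrow>
        f n (map (nth xs) ps) = signed (koszul_exp (sdegs GB (k - 1) xs) ps) (f n xs)) \<and>
     (\<forall>n\<ge>1. \<forall>xs. length xs = n \<and> list_all (homog GB) xs \<longrightarrow>
        (\<Sum>i=1..n. \<Sum>S\<in>{S. S \<subseteq> {0..<n} \<and> card S = i}.
           signed (koszul_exp (sdegs GB (k - 1) xs) (unsh n S))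
             (f (n - i + 1) (dec k GB ell i (sel xs S) # sel xs ({0..<n} - S))))
        = (\<Sum>p=1..n. part_sum (k - 1) GB (dec k GA lam) f xs p)) \<and>
     (\<forall>n xs y z. length xs = n \<and> list_all (homog GB) xs \<and> homog GB y \<longrightarrow>
        f (n + 1) (xs @ [mB y z]) =
          (\<Sum>i=0..n. \<Sum>S\<in>{S. S \<subseteq> {0..<n} \<and> card S = i}.
             signed (koszul_exp (sdegs GB (k - 1) xs) (unsh n S) +
                     deg GB y * (int (n - i) * (k - 1) + sum_list (map (deg GB) (sel xs ({0..<n} - S)))))
               (mA (f (i + 1) (sel xs S @ [y])) (f (n - i + 1) (sel xs ({0..<n} - S) @ [z])))))"

end

theory Submission
  imports Defs "HOL-Library.Disjoint_Sets"
begin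

text \<open>Multilinear maps evaluated at homogeneous \<open>x\<^sub>0, \<dots>, x\<^sub>n\<^sub>-\<^sub>1\<close> are treated as functions on subsets of
  \<open>{0..<n}\<close>, as if evaluated at \<open>x = \<Sum> \<epsilon>\<^sub>i x\<^sub>i\<close> with parameters \<open>\<epsilon>\<^sub>i\<close> of square zero. With \<open>T(S) = \<tau>(x\<^sub>S)\<close>, and
  with \<open>F\<^sub>2(T) = \<Sum> \<mu>\<^sub>p(T, \<dots>, T) / p!\<close> over \<open>p \<ge> 2\<close> read as a sum over set partitions (so that nothing is
  divided), the recursions become \<open>T = \<tau> x + h F\<^sub>2(T)\<close> and \<open>\<ell> = \<sigma> F\<^sub>2(T)\<close>. Let \<open>\<delta>\<close> be the derivative of \<open>F\<^sub>2\<close> at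
  \<open>T\<close>; it is an odd derivation because the brackets are. The derivative of \<open>T\<close> in direction \<open>y\<close> is the
  unique solution of \<open>X = \<tau> y + h \<delta> X\<close>.

  If \<open>Y\<close>, \<open>Z\<close> are the solutions for \<open>y\<close>, \<open>z\<close>, the semifull identities say that \<open>YZ\<close> solves the equation for
  \<open>yz\<close>, so \<open>\<tau>\<close> is multiplicative, and that \<open>\<sigma> \<delta>(YZ) = \<sigma>(\<delta>Y) z \<plusminus> y \<sigma>(\<delta>Z)\<close>, so \<open>\<ell>\<close> is a derivation. The relation
  \<open>dF(T) + \<delta> F(T) = 0\<close> with \<open>F = d + F\<^sub>2\<close> gives \<open>F(T) = \<tau> \<ell> + h \<delta> F(T)\<close>, so \<open>F(T)\<close> is the derivative of \<open>T\<close> in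
  direction \<open>\<ell>\<close>: this is the morphism equation, and \<open>\<sigma>\<close> of it yields the relations for \<open>\<ell>\<close>.\<close>

section \<open>Signs\<close>

text \<open>Uniqueness for \<open>X = \<tau> y + h \<delta> X\<close> holds because every term of
  \<open>\<delta>\<close> carries at least one nonempty block of \<open>T\<close>: at
  \<open>S\<close> it reads \<open>X\<close> on proper subsets of \<open>S\<close> only, so
  induction over finite sets applies. Two obstacles shape the statements. \<open>deg\<close> is a
  choice, arbitrary on 0 and on inhomogeneous elements, so a decalage sign means something only for
  nonzero homogeneous arguments. The last slot has decalage weight 0 and is also the slot of the
  Leibniz rule; the direction \<open>y\<close> is therefore kept last, sums are expanded only there,
  and arguments equal to 0 are treated apart by multilinearity. Secondly, the symmetry of
  \<open>tinf\<close> and \<open>ell\<close> is not given: it has to be extracted from a recursion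
  whose blocks come in the order of their minima. It is required already to bring an inner bracket
  from the first slot, where the relations place it, to the last. The parameters
  \<open>\<epsilon>\<close> never occur in the formulas; what remains of them are exponents, and
  each product of parameters becomes a comparison of exponents modulo 2.\<close>

lemma signed_zero [simp]: "signed e 0 = 0"
  by (simp add: signed_def)

lemma signed_0 [simp]: "signed 0 x = x"
  by (simp add: signed_def)

lemma signed_add: "signed e (x + y) = signed e x + signed e y"
  by (simp add: signed_def)

lemma signed_minus: "signed e (- x) = - signed e x"
  by (simp add: signed_def)

lemma signed_signed [simp]: "signed e (signed f x) = signed (e + f) x"
  by (simp add: signed_def)

lemma signed_cong: "even e = even f \<Longrightarrow> signed e x = signed f x"
  by (simp add: signed_def)

lemma signed_sum: "signed e (sum f I) = (\<Sum>i\<in>I. signed e (f i))"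
  by (simp add: signed_def sum_negf)

lemma signed_diff: "signed e (x - y) = signed e x - signed e y"
  by (simp add: signed_def)

lemma signed_twice: "signed e (signed e x) = x"
  by (simp add: signed_def)

lemma signed_cancel: "signed w x = signed w y \<Longrightarrow> x = y"
  by (simp add: signed_def split: if_splits)

text \<open>Scalars enter the argument only as signs, so additivity is all that is carried
  along.\<close>

definition is_additive :: "('a::ab_group_add \<Rightarrow> 'b::ab_group_add) \<Rightarrow> bool" where
  "is_additive f \<longleftrightarrow> (\<forall>x y. f (x + y) = f x + f y)"

lemma is_additiveI: "(\<And>x y. f (x + y) = f x + f y) \<Longrightarrow> is_additive f"
  by (simp add: is_additive_def)

lemma is_additive_add: "is_additive f \<Longrightarrow> f (x + y) = f x + f y"
  by (simp add: is_additive_def)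

lemma is_additive_0: "is_additive f \<Longrightarrow> f 0 = 0"
  by (metis add_cancel_right_right is_additive_def)

lemma is_additive_minus: "is_additive f \<Longrightarrow> f (- x) = - f x"
  by (metis add.inverse_unique add.right_inverse is_additive_0 is_additive_def)

lemma is_additive_signed: "is_additive f \<Longrightarrow> f (signed e x) = signed e (f x)"
  by (simp add: signed_def is_additive_minus)

lemma is_additive_sum: "is_additive f \<Longrightarrow> f (sum g I) = (\<Sum>i\<in>I. f (g i))"
  by (induction I rule: infinite_finite_induct) (simp_all add: is_additive_0 is_additive_add)

lemma is_additive_setsum:
  "(\<And>i. i \<in> I \<Longrightarrow> is_additive (f i)) \<Longrightarrow> is_additive (\<lambda>x. \<Sum>i\<in>I. f i x)"
  by (simp add: is_additive_def sum.distrib)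

text \<open>Koszul sign of \<open>\<epsilon>\<^sub>U \<epsilon>\<^sub>V = \<plusminus> \<epsilon>\<^sub>U\<^sub>\<union>\<^sub>V\<close>. It is biadditive over disjoint unions, which reduces every sign
  comparison to additive bookkeeping modulo 2.\<close>
definition ksg :: "(nat \<Rightarrow> int) \<Rightarrow> nat set \<Rightarrow> nat set \<Rightarrow> int" where
  "ksg e U V = (\<Sum>a\<in>U. \<Sum>b\<in>V. if b < a then e a * e b else 0)"

lemma ksg_empty [simp]: "ksg e {} V = 0" "ksg e U {} = 0"
  by (simp_all add: ksg_def)

lemma ksg_Un_left:
  "finite U \<Longrightarrow> finite U' \<Longrightarrow> U \<inter> U' = {} \<Longrightarrow> ksg e (U \<union> U') V = ksg e U V + ksg e U' V"
  by (simp add: ksg_def sum.union_disjoint)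

lemma ksg_Un_right:
  "finite V \<Longrightarrow> finite V' \<Longrightarrow> V \<inter> V' = {} \<Longrightarrow> ksg e U (V \<union> V') = ksg e U V + ksg e U V'"
  by (simp add: ksg_def sum.union_disjoint sum.distrib)

text \<open>Every pair in \<open>U \<times> V\<close> is inverted in exactly one of the two orders;
  disjointness excludes \<open>a = b\<close>.\<close>

lemma ksg_swap:
  assumes "finite U" "finite V" "U \<inter> V = {}"
  shows "ksg e U V + ksg e V U = sum e U * sum e V"
proof -
  have "ksg e V U = (\<Sum>a\<in>U. \<Sum>b\<in>V. if a < b then e b * e a else 0)"
    unfolding ksg_def by (rule sum.swap)
  then have "ksg e U V + ksg e V U =
      (\<Sum>a\<in>U. \<Sum>b\<in>V. (if b < a then e a * e b else 0) + (if a < b then e b * e a else 0))"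
    by (simp add: ksg_def sum.distrib)
  also have "\<dots> = (\<Sum>a\<in>U. \<Sum>b\<in>V. e a * e b)"
    using assms(3) by (intro sum.cong refl) (auto simp: not_less_iff_gr_or_eq)
  finally show ?thesis by (simp add: sum_product)
qed

lemma ksg_cong:
  "(\<And>i. i \<in> U \<union> V \<Longrightarrow> e i = e' i) \<Longrightarrow> ksg e U V = ksg e' U V"
  unfolding ksg_def by (intro sum.cong refl) auto

text \<open>Exponent of the sign relating the product of the parameters of the blocks, taken in list
  order, to the parameter of their union. Each block is listed increasingly, so only pairs from
  different blocks count.\<close>

fun kl :: "(nat \<Rightarrow> int) \<Rightarrow> nat set list \<Rightarrow> int" where
  "kl e [] = 0"
| "kl e (U # Us) = (\<Sum>V\<leftarrow>Us. ksg e U V) + kl e Us"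

lemma kl_append: "kl e (Us @ Vs) = kl e Us + kl e Vs + (\<Sum>U\<leftarrow>Us. \<Sum>V\<leftarrow>Vs. ksg e U V)"
  by (induction Us) auto

lemma kl_cong: "(\<And>i. i \<in> \<Union>(set Us) \<Longrightarrow> e i = e' i) \<Longrightarrow> kl e Us = kl e' Us"
  by (induction Us) (auto intro!: ksg_cong arg_cong[where f=sum_list] map_cong)

lemma kl_double_sum:
  "kl e Us = (\<Sum>i<length Us. \<Sum>j<length Us. if i < j then ksg e (Us ! i) (Us ! j) else 0)"
proof (induction Us)
  case (Cons U Us)
  have "(\<Sum>V\<leftarrow>Us. ksg e U V) = (\<Sum>j<length Us. ksg e U (Us ! j))"
    by (simp add: sum_list_sum_nth atLeast0LessThan)
  with Cons show ?case
    by (simp add: sum.lessThan_Suc_shift del: sum.lessThan_Suc cong: if_cong)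
qed simp

text \<open>\<open>disjoint\<close> compares only unequal members, so \<open>distinct\<close> has to
  exclude repeated blocks; nonempty finite blocks are what makes their minima meaningful and
  different.\<close>

definition disj_list :: "nat set list \<Rightarrow> bool" where
  "disj_list Us \<longleftrightarrow> distinct Us \<and> disjoint (set Us) \<and> {} \<notin> set Us \<and> (\<forall>U\<in>set Us. finite U)"

lemma disj_list_Cons:
  "disj_list (U # Us) \<Longrightarrow> disj_list Us \<and> U \<inter> \<Union>(set Us) = {} \<and> finite U \<and> finite (\<Union>(set Us))"
  unfolding disj_list_def by (auto simp: disjoint_def)

lemma ksg_Union_right:
  "disj_list Us \<Longrightarrow> ksg e U (\<Union>(set Us)) = (\<Sum>V\<leftarrow>Us. ksg e U V)"
proof (induction Us)
  case (Cons V Us)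
  then show ?case using disj_list_Cons[OF Cons.prems] by (simp add: ksg_Un_right)
qed simp

lemma ksg_Union_left:
  "disj_list Us \<Longrightarrow> ksg e (\<Union>(set Us)) V = (\<Sum>U\<leftarrow>Us. ksg e U V)"
proof (induction Us)
  case (Cons U Us)
  then show ?case using disj_list_Cons[OF Cons.prems] by (simp add: ksg_Un_left)
qed simp

lemma sum_Union_list:
  "disj_list Us \<Longrightarrow> sum e (\<Union>(set Us)) = (\<Sum>U\<leftarrow>Us. sum e U)"
proof (induction Us)
  case (Cons U Us)
  then show ?case using disj_list_Cons[OF Cons.prems] by (simp add: sum.union_disjoint)
qed simp

lemma kl_append_Union:
  assumes "disj_list Us" "disj_list Vs"
  shows "kl e (Us @ Vs) = kl e Us + kl e Vs + ksg e (\<Union>(set Us)) (\<Union>(set Vs))"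
  unfolding kl_append ksg_Union_left[OF assms(1)] by (simp only: ksg_Union_right[OF assms(2)])

text \<open>Both the Koszul sign and the decalage sign are of the form \<open>\<Sum>\<^sub>i\<^sub><\<^sub>j c i j\<close>.\<close>
lemma pair_sum_perm:
  fixes c :: "nat \<Rightarrow> nat \<Rightarrow> int"
  assumes "ps \<in> perms n"
  shows "(\<Sum>a<n. \<Sum>b<n. if a < b then c (ps ! a) (ps ! b) else 0) =
    (\<Sum>i<n. \<Sum>j<n. if i < j then c i j else 0) +
    (\<Sum>(a, b)\<in>inversions ps. c (ps ! a) (ps ! b) - c (ps ! b) (ps ! a))"
proof -
  from assms have d: "distinct ps" and s: "set ps = {0..<n}" by (auto simp: perms_def)
  have l: "length ps = n" using distinct_card[OF d] s by simp
  have bij: "bij_betw ((!) ps) {..<n} {..<n}"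
    using bij_betw_nth[OF d, of "{..<n}" "{0..<n}"] s l by (simp add: atLeast0LessThan)
  have inv: "(\<Sum>(a, b)\<in>inversions ps. f a b) =
     (\<Sum>a<n. \<Sum>b<n. if a < b \<and> ps ! b < ps ! a then f a b else 0)" for f :: "nat \<Rightarrow> nat \<Rightarrow> int"
  proof -
    have "(\<Sum>(a, b)\<in>inversions ps. f a b) =
       (\<Sum>p\<in>{..<n} \<times> {..<n}. if fst p < snd p \<and> ps ! (snd p) < ps ! (fst p) then f (fst p) (snd p) else 0)"
      by (rule sum.mono_neutral_cong_left) (auto simp: inversions_def l)
    then show ?thesis by (simp add: sum.cartesian_product split_def)
  qed
  have "(\<Sum>i<n. \<Sum>j<n. if i < j then c i j else 0) =
     (\<Sum>a<n. \<Sum>j<n. if ps ! a < j then c (ps ! a) j else 0)"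
    by (rule sum.reindex_bij_betw[OF bij, symmetric])
  also have "\<dots> = (\<Sum>a<n. \<Sum>b<n. if ps ! a < ps ! b then c (ps ! a) (ps ! b) else 0)"
    proof (rule sum.cong[OF refl])
    fix a
    show "(\<Sum>j<n. if ps ! a < j then c (ps ! a) j else 0) =
        (\<Sum>b<n. if ps ! a < ps ! b then c (ps ! a) (ps ! b) else 0)"
      using sum.reindex_bij_betw[OF bij, of "\<lambda>j. if ps ! a < j then c (ps ! a) j else 0"] by simp
  qed
  finally have 1: "(\<Sum>i<n. \<Sum>j<n. if i < j then c i j else 0) = \<dots>" .
  have 2: "(\<Sum>a<n. \<Sum>b<n. if a < b \<and> ps ! b < ps ! a then c (ps ! b) (ps ! a) else 0) =
     (\<Sum>a<n. \<Sum>b<n. if b < a \<and> ps ! a < ps ! b then c (ps ! a) (ps ! b) else 0)"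
    by (rule sum.swap)
  have ne: "ps ! a \<noteq> ps ! b" if "a < n" "b < n" "a \<noteq> b" for a b
    using that d l by (simp add: nth_eq_iff_index_eq)
  let ?f = "\<lambda>a b. c (ps ! a) (ps ! b)"
  \<comment> \<open>The sum over pairs ordered by position and the sum over pairs ordered by value
    differ exactly at the inversions, where the pair is counted in opposite orders.\<close>
  have "(\<Sum>a<n. \<Sum>b<n. if a < b then ?f a b else 0) +
      (\<Sum>a<n. \<Sum>b<n. if b < a \<and> ps ! a < ps ! b then ?f a b else 0) =
    (\<Sum>a<n. \<Sum>b<n. if ps ! a < ps ! b then ?f a b else 0) +
      (\<Sum>a<n. \<Sum>b<n. if a < b \<and> ps ! b < ps ! a then ?f a b else 0)"
    unfolding sum.distrib[symmetric]
  proof (intro sum.cong refl)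
    fix a b assume "a \<in> {..<n}" "b \<in> {..<n}"
    then show "(if a < b then ?f a b else 0) + (if b < a \<and> ps ! a < ps ! b then ?f a b else 0) =
      (if ps ! a < ps ! b then ?f a b else 0) + (if a < b \<and> ps ! b < ps ! a then ?f a b else 0)"
      using ne[of a b] by (cases a b rule: linorder_cases; cases "ps ! a" "ps ! b" rule: linorder_cases) auto
  qed
  moreover have "(\<Sum>(a, b)\<in>inversions ps. ?f a b - ?f b a) =
    (\<Sum>(a, b)\<in>inversions ps. ?f a b) - (\<Sum>(a, b)\<in>inversions ps. ?f b a)"
    by (simp add: split_def sum_subtractf)
  ultimately show ?thesis
    unfolding 1 inv[of ?f] inv[of "\<lambda>a b. ?f b a"] 2 by linarith
qed

section \<open>Koszul exponents of index lists in terms of \<open>ksg\<close> and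
  \<open>kl\<close>\<close>

lemma koszul_exp_Cons:
  assumes "distinct (p # ps)"
  shows "koszul_exp ds (p # ps) = ksg ((!) ds) {p} (set ps) + koszul_exp ds ps"
proof -
  let ?A = "(\<lambda>b. (0::nat, Suc b)) ` {b. b < length ps \<and> ps ! b < p}"
  let ?B = "(\<lambda>(a, b). (Suc a, Suc b)) ` inversions ps"
  have fin: "finite (inversions qs)" for qs
    by (rule finite_subset[of _ "{..<length qs} \<times> {..<length qs}"]) (auto simp: inversions_def)
  have eq: "inversions (p # ps) = ?A \<union> ?B"
  proof (intro set_eqI iffI)
    fix x assume "x \<in> inversions (p # ps)"
    then obtain a b where x: "x = (a, b)" "a < b" "b < Suc (length ps)" "(p # ps) ! b < (p # ps) ! a"
      by (auto simp: inversions_def)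
    then obtain b' where b': "b = Suc b'" by (cases b) auto
    show "x \<in> ?A \<union> ?B"
    proof (cases a)
      case 0 with x b' show ?thesis by auto
    next
      case (Suc a')
      with x b' have "(a', b') \<in> inversions ps" by (auto simp: inversions_def)
      with x b' Suc show ?thesis by force
    qed
  qed (auto simp: inversions_def)
  let ?f = "\<lambda>(a, b). ds ! ((p # ps) ! a) * ds ! ((p # ps) ! b)"
  have "koszul_exp ds (p # ps) = sum ?f ?A + sum ?f ?B"
    unfolding koszul_exp_def eq by (rule sum.union_disjoint) (auto simp: fin)
  moreover have "sum ?f ?B = koszul_exp ds ps"
    unfolding koszul_exp_def
    by (subst sum.reindex) (auto simp: inj_on_def split_def intro!: sum.cong)
  moreover have "sum ?f ?A = ksg ((!) ds) {p} (set ps)"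
  proof -
    have "sum ?f ?A = (\<Sum>b\<in>{b. b < length ps \<and> ps ! b < p}. ds ! p * ds ! (ps ! b))"
      by (subst sum.reindex) (auto simp: inj_on_def)
    also have "\<dots> = (\<Sum>b\<in>{..<length ps}. if ps ! b < p then ds ! p * ds ! (ps ! b) else 0)"
      by (rule sum.mono_neutral_cong_left) auto
    also have "\<dots> = (\<Sum>q\<in>set ps. if q < p then ds ! p * ds ! q else 0)"
      using assms sum.reindex_bij_betw[OF bij_betw_nth[of ps "{..<length ps}" "set ps"],
        of "\<lambda>q. if q < p then ds ! p * ds ! q else 0"] by auto
    finally show ?thesis by (simp add: ksg_def)
  qed
  ultimately show ?thesis by simp
qed

lemma koszul_exp_append:
  "distinct (ps @ qs) \<Longrightarrow>
    koszul_exp ds (ps @ qs) = koszul_exp ds ps + koszul_exp ds qs + ksg ((!) ds) (set ps) (set qs)"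
proof (induction ps)
  case Nil
  then show ?case by (simp add: koszul_exp_def inversions_def)
next
  case (Cons p ps)
  have "ksg ((!) ds) {p} (set (ps @ qs)) = ksg ((!) ds) {p} (set ps) + ksg ((!) ds) {p} (set qs)"
    using Cons.prems by (simp add: ksg_Un_right)
  moreover have "ksg ((!) ds) (set (p # ps)) (set qs) =
      ksg ((!) ds) {p} (set qs) + ksg ((!) ds) (set ps) (set qs)"
    using ksg_Un_left[of "{p}" "set ps" "(!) ds" "set qs"] Cons.prems by simp
  moreover have "koszul_exp ds ((p # ps) @ qs) = ksg ((!) ds) {p} (set (ps @ qs)) + koszul_exp ds (ps @ qs)"
    using koszul_exp_Cons[of p "ps @ qs" ds] Cons.prems by simp
  ultimately show ?case
    using Cons koszul_exp_Cons[of p ps ds] by simp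
qed

lemma koszul_exp_sorted: "sorted ps \<Longrightarrow> koszul_exp ds ps = 0"
proof -
  assume "sorted ps"
  then have "inversions ps = {}"
    by (auto simp: inversions_def sorted_iff_nth_mono) (meson leD less_imp_le)
  then show ?thesis by (simp add: koszul_exp_def)
qed

text \<open>A sorted block has no inversions, so only pairs from different blocks remain. This
  converts the sign of a transfer sum into \<open>kl\<close>.\<close>

lemma koszul_exp_concat:
  "distinct (concat Ls) \<Longrightarrow> (\<And>L. L \<in> set Ls \<Longrightarrow> sorted L) \<Longrightarrow>
    koszul_exp ds (concat Ls) = kl ((!) ds) (map set Ls)"
proof (induction Ls)
  case Nil
  then show ?case by (simp add: koszul_exp_def inversions_def)
next
  case (Cons L Ls)
  have *: "ksg ((!) ds) U (set (concat Ls)) = (\<Sum>V\<leftarrow>map set Ls. ksg ((!) ds) U V)"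
    if "distinct (concat Ls)" for U Ls
    using that by (induction Ls) (auto simp: ksg_Un_right)
  show ?case
    using Cons.prems *[of Ls "set L"] koszul_exp_sorted[of L ds] Cons.IH
    by (simp add: koszul_exp_append)
qed

lemma koszul_exp_unsh:
  "S \<subseteq> {0..<n} \<Longrightarrow> koszul_exp ds (unsh n S) = ksg ((!) ds) S ({0..<n} - S)"
proof -
  assume "S \<subseteq> {0..<n}"
  then have "finite S" by (rule finite_subset) simp
  then show ?thesis
    unfolding unsh_def by (subst koszul_exp_append) (auto simp: koszul_exp_sorted)
qed

lemma unsh_perms: "S \<subseteq> {0..<n} \<Longrightarrow> unsh n S \<in> perms n"
proof -
  assume "S \<subseteq> {0..<n}"
  moreover from this have "finite S" by (rule finite_subset) simp
  ultimately show ?thesis by (auto simp: unsh_def perms_def)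
qed

lemma perms_length: "ps \<in> perms n \<Longrightarrow> length ps = n"
  unfolding perms_def using distinct_card by fastforce

lemma perm_of_same_set:
  assumes "distinct xs" "distinct ys" "set xs = set ys"
  shows "\<exists>ps\<in>perms (length xs). ys = map ((!) xs) ps"
proof -
  have len: "length ys = length xs" using assms distinct_card by metis
  define g where "g y = (SOME i. i < length xs \<and> xs ! i = y)" for y
  have g: "g y < length xs \<and> xs ! g y = y" if "y \<in> set ys" for y
  proof -
    have "y \<in> set xs" using that assms(3) by simp
    then have "\<exists>i. i < length xs \<and> xs ! i = y" by (simp add: in_set_conv_nth)
    then show ?thesis unfolding g_def by (rule someI_ex)
  qed
  have inj: "inj_on g (set ys)" by (rule inj_on_inverseI[where g = "(!) xs"]) (use g in auto)
  have "card (g ` set ys) = length xs"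
    using card_image[OF inj] distinct_card[OF assms(2)] len by simp
  then have "g ` set ys = {0..<length xs}"
    using g by (intro card_subset_eq) auto
  then have "map g ys \<in> perms (length xs)"
    using assms(2) inj by (simp add: perms_def distinct_map)
  moreover have "ys = map ((!) xs) (map g ys)"
    by (rule nth_equalityI) (use g in auto)
  ultimately show ?thesis by blast
qed

section \<open>Set partitions\<close>

text \<open>Listing by minima reproduces the block order built into \<open>opart\<close>.\<close>
definition lst :: "nat set set \<Rightarrow> nat set list" where
  "lst P = (SOME Us. distinct Us \<and> set Us = P \<and> sorted (map Min Us))"

lemma lst_props:
  assumes "finite P"
  shows "distinct (lst P) \<and> set (lst P) = P \<and> sorted (map Min (lst P))"
proof -
  obtain Us where "set Us = P" "distinct Us" using finite_distinct_list[OF assms] by blast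
  then have "\<exists>Us. distinct Us \<and> set Us = P \<and> sorted (map Min Us)"
    by (intro exI[of _ "sort_key Min Us"]) simp
  then show ?thesis unfolding lst_def by (rule someI_ex)
qed

lemma distinct_lst [simp]: "finite P \<Longrightarrow> distinct (lst P)"
  and set_lst [simp]: "finite P \<Longrightarrow> set (lst P) = P"
  and length_lst [simp]: "finite P \<Longrightarrow> length (lst P) = card P"
  using lst_props[of P] distinct_card by fastforce+

lemma disj_list_inj_Min: "disj_list Us \<Longrightarrow> inj_on Min (set Us)"
  unfolding disj_list_def disjoint_def inj_on_def
  by (metis Min_in disjoint_iff)

text \<open>Disjoint nonempty blocks have different minima, so sorting by minima determines the list
  and the choice in \<open>lst\<close> is no choice at all.\<close>

lemma lst_unique:
  assumes "disj_list Us" "sorted (map Min Us)"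
  shows "lst (set Us) = Us"
proof -
  note inj = disj_list_inj_Min[OF assms(1)]
  have d: "distinct Us" using assms(1) by (simp add: disj_list_def)
  have L: "distinct (lst (set Us))" "set (lst (set Us)) = set Us" "sorted (map Min (lst (set Us)))"
    using lst_props[of "set Us"] by auto
  have "map Min (lst (set Us)) = map Min Us"
    by (rule sorted_distinct_set_unique) (use L assms(2) d inj in \<open>auto simp: distinct_map\<close>)
  then show ?thesis using inj L(2) by (metis inj_on_map_eq_map sup.idem)
qed

lemma lst_empty [simp]: "lst {} = []"
  by (simp add: length_0_conv[symmetric] del: length_0_conv)

lemma lst_singleton [simp]: "lst {U} = [U]"
proof -
  have "length (lst {U}) = 1" "set (lst {U}) = {U}" by simp_all
  then show ?thesis by (cases "lst {U}") auto
qed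

lemma partition_finite: "finite S \<Longrightarrow> partition_on S P \<Longrightarrow> finite P"
  by (rule finite_elements)

lemma partition_disj_list:
  assumes "finite S" "partition_on S P" "distinct Us" "set Us = P"
  shows "disj_list Us" "\<Union>(set Us) = S"
proof -
  have "U \<subseteq> S" if "U \<in> P" for U using assms(2) that by (auto simp: partition_on_def)
  then show "disj_list Us"
    using assms by (auto simp: disj_list_def partition_on_def intro: finite_subset)
  show "\<Union>(set Us) = S" using assms by (simp add: partition_on_def)
qed

lemma disj_list_lst: "finite S \<Longrightarrow> partition_on S P \<Longrightarrow> disj_list (lst P)"
  by (rule partition_disj_list) (auto dest: partition_finite)

lemma partition_sum_blocks:
  assumes "finite S" "partition_on S P"
  shows "(\<Sum>U\<leftarrow>lst P. sum e U) = sum e S"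
  using sum_Union_list[OF disj_list_lst[OF assms], of e] assms
  by (simp add: partition_finite partition_onD1[symmetric])

lemma finite_partitions [simp]: "finite S \<Longrightarrow> finite {P. partition_on S P \<and> Q P}"
  by (rule finite_subset[OF _ finitely_many_partition_on[of S]]) auto

lemma partition_on_empty_iff: "partition_on {} P \<longleftrightarrow> P = {}"
  by (auto simp: partition_on_def)

lemma partition_block: "partition_on S P \<Longrightarrow> U \<in> P \<Longrightarrow> U \<subseteq> S \<and> U \<noteq> {}"
  by (auto simp: partition_on_def)

text \<open>This is what makes the transfer recursion well founded: \<open>F2\<close> at
  \<open>S\<close> reads its set function on proper subsets of \<open>S\<close> only.\<close>

lemma partition_two_blocks:
  assumes "finite S" "partition_on S P" "2 \<le> card P" "U \<in> P"
  shows "U \<noteq> S"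
proof
  assume "U = S"
  have "P \<subseteq> {S}"
  proof
    fix V assume V: "V \<in> P"
    then have "V \<subseteq> S" "V \<noteq> {}" using partition_block[OF assms(2)] by auto
    moreover have "V = U \<or> V \<inter> U = {}"
      using assms(2,4) V by (auto simp: partition_on_def disjoint_def)
    ultimately show "V \<in> {S}" using \<open>U = S\<close> by auto
  qed
  then have "card P \<le> 1" using card_mono[of "{S}" P] by simp
  then show False using assms(3) by simp
qed

lemma partitions_split_one:
  assumes "finite S" "S \<noteq> {}"
  shows "{P. partition_on S P \<and> P \<noteq> {}} = insert {S} {P. partition_on S P \<and> 2 \<le> card P}"
proof (intro set_eqI iffI)
  fix P assume "P \<in> {P. partition_on S P \<and> P \<noteq> {}}"
  then have P: "partition_on S P" "P \<noteq> {}" by auto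
  then have "card P \<noteq> 0" using partition_finite[OF assms(1)] by simp
  moreover have "P = {S}" if c: "card P = 1"
  proof -
    obtain U where "P = {U}" using c by (rule card_1_singletonE)
    then show ?thesis using P(1) by (auto simp: partition_on_def)
  qed
  ultimately show "P \<in> insert {S} {P. partition_on S P \<and> 2 \<le> card P}" using P by force
qed (use assms in \<open>auto simp: partition_on_def\<close>)

lemma partition_on_Diff_subset:
  assumes P: "partition_on S P" and Q: "Q \<subseteq> P"
  shows "partition_on (S - \<Union>Q) (P - Q)"
proof -
  have "B \<inter> C = {}" if "B \<in> P" "C \<in> P" "B \<noteq> C" for B C
    using P that by (auto simp: partition_on_def disjoint_def)
  then have "\<Union>(P - Q) = \<Union>P - \<Union>Q" using Q by blast
  then show ?thesis using P by (auto simp: partition_on_def disjoint_def)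
qed

lemma partition_on_Un:
  assumes "partition_on V Q" "partition_on W R" "V \<inter> W = {}"
  shows "partition_on (V \<union> W) (Q \<union> R)"
proof -
  have "disjoint (Q \<union> R)"
    by (rule disjoint_union) (use assms in \<open>auto simp: partition_on_def\<close>)
  then show ?thesis using assms by (auto simp: partition_on_def)
qed

text \<open>A partition of \<open>S\<close> with a chosen nonempty subfamily \<open>Q\<close>
  amounts to the set \<open>V\<close> covered by \<open>Q\<close>, a partition of \<open>V\<close>
  and one of the rest. It regroups the quadratic relations: \<open>Q\<close> feeds the inner
  bracket, \<open>R\<close> the outer one.\<close>

lemma sum_partitions_subsets:
  fixes t :: "nat set set \<Rightarrow> nat set set \<Rightarrow> 'b::comm_monoid_add"
  assumes S: "finite S"
  shows "(\<Sum>P\<in>{P. partition_on S P \<and> P \<noteq> {}}. \<Sum>Q\<in>{Q. Q \<subseteq> P \<and> Q \<noteq> {}}. t Q (P - Q)) =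
    (\<Sum>V\<in>{V. V \<subseteq> S \<and> V \<noteq> {}}. \<Sum>Q\<in>{Q. partition_on V Q \<and> Q \<noteq> {}}.
        \<Sum>R\<in>{R. partition_on (S - V) R}. t Q R)"
proof -
  have fP: "finite P" if "partition_on S P" for P using that S by (rule partition_finite[rotated])
  have "(\<Sum>P\<in>{P. partition_on S P \<and> P \<noteq> {}}. \<Sum>Q\<in>{Q. Q \<subseteq> P \<and> Q \<noteq> {}}. t Q (P - Q)) =
     (\<Sum>(P, Q)\<in>Sigma {P. partition_on S P \<and> P \<noteq> {}} (\<lambda>P. {Q. Q \<subseteq> P \<and> Q \<noteq> {}}). t Q (P - Q))"
    using S fP by (intro sum.Sigma) auto
  also have "\<dots> = (\<Sum>(V, Q, R)\<in>Sigma {V. V \<subseteq> S \<and> V \<noteq> {}}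
      (\<lambda>V. {Q. partition_on V Q \<and> Q \<noteq> {}} \<times> {R. partition_on (S - V) R}). t Q R)"
  proof (rule sum.reindex_bij_witness[where
        i = "\<lambda>(V, Q, R). (Q \<union> R, Q)" and j = "\<lambda>(P, Q). (\<Union>Q, Q, P - Q)"], goal_cases)
    case (2 a)
    then obtain P Q where a: "a = (P, Q)" and P: "partition_on S P" and Q: "Q \<subseteq> P" "Q \<noteq> {}" by auto
    from P Q have "partition_on (\<Union>Q) Q" by (auto simp: partition_on_def disjoint_def)
    moreover have "partition_on (S - \<Union>Q) (P - Q)"
      by (rule partition_on_Diff_subset[OF P Q(1)])
    moreover have "\<Union>Q \<subseteq> S" using P Q by (auto simp: partition_on_def)
    moreover have "\<Union>Q \<noteq> {}"
      using Q partition_block[OF P] by fastforce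
    ultimately show ?case using a Q by auto
  next
    case (4 b)
    then obtain V Q R where b: "b = (V, Q, R)" "V \<subseteq> S" "V \<noteq> {}" "partition_on V Q" "Q \<noteq> {}" "partition_on (S - V) R"
      by auto
    have "partition_on (V \<union> (S - V)) (Q \<union> R)"
      by (rule partition_on_Un) (use b in auto)
    then have "partition_on S (Q \<union> R)" using b by (simp add: Un_absorb1)
    then show ?case using b by auto
  next
    case (3 b)
    then obtain V Q R where b: "b = (V, Q, R)" "V \<subseteq> S" "V \<noteq> {}" "partition_on V Q" "Q \<noteq> {}" "partition_on (S - V) R"
      by auto
    have "B \<notin> R" if "B \<in> Q" for B
      using that partition_block[OF b(4), of B] partition_block[OF b(6), of B] by auto
    then have "Q \<inter> R = {}" by auto
    moreover have "\<Union>Q = V" using b by (simp add: partition_on_def)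
    ultimately show ?case using b by auto
  qed auto
  also have "\<dots> = (\<Sum>V\<in>{V. V \<subseteq> S \<and> V \<noteq> {}}. \<Sum>(Q, R)\<in>{Q. partition_on V Q \<and> Q \<noteq> {}} \<times> {R. partition_on (S - V) R}. t Q R)"
    using S finite_subset by (subst sum.Sigma) (auto simp: split_def intro!: finite_cartesian_product finite_partitions finitely_many_partition_on)
  finally show ?thesis by (simp add: sum.cartesian_product)
qed

text \<open>Splits off the block \<open>insert n U\<close> through the new point; having at least
  two blocks means that the remaining family is nonempty. This is the combinatorial form of
  differentiating in the last argument.\<close>

lemma sum_partitions_insert:
  fixes t :: "nat set set \<Rightarrow> 'b::comm_monoid_add"
  assumes S: "finite S" "n \<notin> S"
  shows "(\<Sum>P\<in>{P. partition_on (insert n S) P \<and> 2 \<le> card P}. t P) =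
    (\<Sum>U\<in>Pow S. \<Sum>P\<in>{P. partition_on (S - U) P \<and> P \<noteq> {}}. t (insert (insert n U) P))"
proof -
  have "(\<Sum>U\<in>Pow S. \<Sum>P\<in>{P. partition_on (S - U) P \<and> P \<noteq> {}}. t (insert (insert n U) P)) =
     (\<Sum>(U, P)\<in>Sigma (Pow S) (\<lambda>U. {P. partition_on (S - U) P \<and> P \<noteq> {}}). t (insert (insert n U) P))"
    using S by (intro sum.Sigma) auto
  also have "\<dots> = (\<Sum>P\<in>{P. partition_on (insert n S) P \<and> 2 \<le> card P}. t P)"
  proof (rule sum.reindex_bij_witness[where
        i = "\<lambda>P. (\<Union>{B\<in>P. n \<in> B} - {n}, P - {B\<in>P. n \<in> B})" and
        j = "\<lambda>(U, P). insert (insert n U) P"], goal_cases)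
    case (1 a)
    then obtain U P where a: "a = (U, P)" "U \<subseteq> S" "partition_on (S - U) P" "P \<noteq> {}" by auto
    have "n \<notin> B" if "B \<in> P" for B using a that S(2) by (auto simp: partition_on_def)
    then have "{B \<in> insert (insert n U) P. n \<in> B} = {insert n U}" "insert n U \<notin> P" by auto
    moreover have "n \<notin> U" using a S by auto
    ultimately show ?case using a by simp
  next
    case (2 a)
    then obtain U P where a: "a = (U, P)" "U \<subseteq> S" "partition_on (S - U) P" "P \<noteq> {}" by auto
    have nP: "n \<notin> B" if "B \<in> P" for B using a that S(2) by (auto simp: partition_on_def)
    have "finite P" using a S by (meson finite_Diff partition_finite)
    moreover have "insert n U \<notin> P" using nP by auto
    ultimately have "card (insert (insert n U) P) = Suc (card P)" "card P \<noteq> 0" using a by auto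
    moreover have "partition_on (insert n S) (insert (insert n U) P)"
    proof -
      have "B \<inter> insert n U = {}" if "B \<in> P" for B
        using a(3) that nP[OF that] by (auto simp: partition_on_def)
      moreover have "\<Union>(insert (insert n U) P) = insert n S"
        using a by (auto simp: partition_on_def)
      ultimately show ?thesis using a(3) by (auto simp: partition_on_def disjoint_def)
    qed
    ultimately show ?case using a by auto
  next
    case (3 P)
    then have P: "partition_on (insert n S) P" by auto
    then obtain B where B: "B \<in> P" "n \<in> B" by (auto simp: partition_on_def)
    then have "{B \<in> P. n \<in> B} = {B}" using P by (auto simp: partition_on_def disjoint_def)
    then show ?case using B by (auto simp: insert_absorb)
  next
    case (4 P)
    then have P: "partition_on (insert n S) P" "2 \<le> card P" by auto
    then obtain B where B: "B \<in> P" "n \<in> B" by (auto simp: partition_on_def)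
    then have eq: "{B \<in> P. n \<in> B} = {B}" using P by (auto simp: partition_on_def disjoint_def)
    have "partition_on (S - (B - {n})) (P - {B})"
    proof -
      have "insert n S - \<Union>{B} = S - (B - {n})" using B S(2) by auto
      then show ?thesis using partition_on_Diff_subset[OF P(1), of "{B}"] B by simp
    qed
    moreover have "P - {B} \<noteq> {}"
    proof
      assume "P - {B} = {}"
      then have "P \<subseteq> {B}" by auto
      then have "card P \<le> 1" using card_mono[of "{B}" P] by simp
      then show False using P(2) by simp
    qed
    moreover have "B - {n} \<subseteq> S" using P(1) B by (auto simp: partition_on_def)
    ultimately show ?case using eq by auto
  qed auto
  finally show ?thesis by simp
qed

lemma sum_subset_triples:
  fixes f :: "nat set \<Rightarrow> nat set \<Rightarrow> nat set \<Rightarrow> 'b::comm_monoid_add"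
  assumes S: "finite S"
  shows "(\<Sum>U\<in>Pow S. \<Sum>V\<in>Pow U. f V (U - V) (S - U)) =
    (\<Sum>V\<in>Pow S. \<Sum>W\<in>Pow (S - V). f V W (S - V - W))"
proof -
  have fin: "finite (Pow U)" if "U \<in> Pow S" for U using that S finite_subset by auto
  have "(\<Sum>U\<in>Pow S. \<Sum>V\<in>Pow U. f V (U - V) (S - U)) = (\<Sum>(U, V)\<in>Sigma (Pow S) Pow. f V (U - V) (S - U))"
    using S fin by (intro sum.Sigma) auto
  also have "\<dots> = (\<Sum>(V, W)\<in>Sigma (Pow S) (\<lambda>V. Pow (S - V)). f V W (S - V - W))"
  proof (rule sum.reindex_bij_witness[where i = "\<lambda>(V, W). (V \<union> W, V)" and j = "\<lambda>(U, V). (V, U - V)"], goal_cases)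
    case (5 a)
    then obtain U V where a: "a = (U, V)" "U \<subseteq> S" "V \<subseteq> U" by auto
    then have "S - V - (U - V) = S - U" by auto
    with a show ?case by simp
  qed auto
  also have "\<dots> = (\<Sum>V\<in>Pow S. \<Sum>W\<in>Pow (S - V). f V W (S - V - W))"
    using S by (intro sum.Sigma[symmetric]) auto
  finally show ?thesis .
qed

lemma sum_subset_compl:
  fixes f :: "nat set \<Rightarrow> nat set \<Rightarrow> 'b::comm_monoid_add"
  shows "(\<Sum>U\<in>Pow S. f U (S - U)) = (\<Sum>U\<in>Pow S. f (S - U) U)"
  by (rule sum.reindex_bij_witness[where i = "\<lambda>U. S - U" and j = "\<lambda>U. S - U"]) (auto simp: double_diff)

section \<open>Signs under reordering of blocks and under reindexing of points\<close>

text \<open>An inversion of \<open>ps\<close> replaces \<open>ksg\<close> of two blocks by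
  \<open>ksg\<close> in the opposite order, and by \<open>ksg_swap\<close> this changes the parity
  by the product of the total degrees. Hence \<open>kl\<close> transforms exactly like the Koszul
  sign of a symmetric bracket applied to the blocks.\<close>

lemma kl_perm:
  assumes "disj_list Us" "ps \<in> perms (length Us)"
  shows "even (kl e (map ((!) Us) ps)) = even (kl e Us + koszul_exp (map (sum e) Us) ps)"
proof -
  let ?n = "length Us" and ?c = "\<lambda>i j. ksg e (Us ! i) (Us ! j)"
  have len: "length ps = ?n" using assms(2) by (rule perms_length)
  have lt: "ps ! a < ?n" if "a < ?n" for a
    using assms(2) len nth_mem[of a ps] that by (auto simp: perms_def)
  have ne: "ps ! a \<noteq> ps ! b" if "a < ?n" "b < ?n" "a \<noteq> b" for a b
    using assms(2) len that by (simp add: perms_def nth_eq_iff_index_eq)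
  have "kl e (map ((!) Us) ps) = (\<Sum>a<?n. \<Sum>b<?n. if a < b then ?c (ps ! a) (ps ! b) else 0)"
    unfolding kl_double_sum by (simp add: len cong: if_cong)
  also have "\<dots> = kl e Us + (\<Sum>(a, b)\<in>inversions ps. ?c (ps ! a) (ps ! b) - ?c (ps ! b) (ps ! a))"
    unfolding kl_double_sum by (rule pair_sum_perm[OF assms(2)])
  also have "(\<Sum>(a, b)\<in>inversions ps. ?c (ps ! a) (ps ! b) - ?c (ps ! b) (ps ! a)) =
      koszul_exp (map (sum e) Us) ps - 2 * (\<Sum>(a, b)\<in>inversions ps. ?c (ps ! b) (ps ! a))"
    unfolding koszul_exp_def sum_distrib_left sum_subtractf[symmetric]
  proof (rule sum.cong[OF refl], clarify)
    fix a b assume ab: "(a, b) \<in> inversions ps"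
    then have l: "a < b" "b < ?n" "a < ?n" by (auto simp: inversions_def len)
    let ?U = "Us ! (ps ! a)" and ?V = "Us ! (ps ! b)"
    have "?U \<in> set Us" "?V \<in> set Us" "?U \<noteq> ?V"
      using l lt ne[of a b] assms(1) by (auto simp: disj_list_def nth_eq_iff_index_eq)
    then have "finite ?U" "finite ?V" "?U \<inter> ?V = {}"
      using assms(1) by (auto simp: disj_list_def disjoint_def)
    then show "?c (ps ! a) (ps ! b) - ?c (ps ! b) (ps ! a) =
      map (sum e) Us ! (ps ! a) * map (sum e) Us ! (ps ! b) - 2 * ?c (ps ! b) (ps ! a)"
      using ksg_swap[of ?U ?V e] lt l by simp
  qed
  finally show ?thesis by simp
qed

text \<open>Koszul sign of sorting \<open>\<phi> a\<close>, for \<open>a\<close> running increasingly through \<open>U\<close>.\<close>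
definition iv :: "(nat \<Rightarrow> nat) \<Rightarrow> (nat \<Rightarrow> int) \<Rightarrow> nat set \<Rightarrow> int" where
  "iv \<phi> e U = (\<Sum>a\<in>U. \<Sum>b\<in>U. if a < b \<and> \<phi> b < \<phi> a then e (\<phi> a) * e (\<phi> b) else 0)"

text \<open>For \<open>a\<close> in \<open>U\<close> and \<open>b\<close> in \<open>V\<close> the
  map reverses their order exactly when one of \<open>b < a\<close> and
  \<open>\<phi> b < \<phi> a\<close> holds but not the other; modulo 2 the mixed pairs therefore
  count as the sum of the two \<open>ksg\<close> terms. \<open>?X\<close> collects the pairs where
  both hold.\<close>

lemma iv_Un:
  assumes "finite U" "finite V" "U \<inter> V = {}" "inj_on \<phi> (U \<union> V)"
  shows "even (iv \<phi> e (U \<union> V)) =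
    even (iv \<phi> e U + iv \<phi> e V + ksg (e \<circ> \<phi>) U V + ksg e (\<phi> ` U) (\<phi> ` V))"
proof -
  let ?w = "\<lambda>a b. e (\<phi> a) * e (\<phi> b)"
  let ?X = "\<Sum>a\<in>U. \<Sum>b\<in>V. if b < a \<and> \<phi> b < \<phi> a then ?w a b else 0"
  have swap: "(\<Sum>a\<in>V. \<Sum>b\<in>U. if a < b \<and> \<phi> b < \<phi> a then ?w a b else 0) =
      (\<Sum>a\<in>U. \<Sum>b\<in>V. if b < a \<and> \<phi> a < \<phi> b then ?w a b else 0)"
    by (subst sum.swap) (simp add: mult.commute cong: if_cong)
  have inj: "inj_on \<phi> U" "inj_on \<phi> V" using assms(4) by (auto simp: inj_on_def)
  have k: "ksg e (\<phi> ` U) (\<phi> ` V) = (\<Sum>a\<in>U. \<Sum>b\<in>V. if \<phi> b < \<phi> a then ?w a b else 0)"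
    unfolding ksg_def by (simp add: sum.reindex[OF inj(1)] sum.reindex[OF inj(2)])
  have "iv \<phi> e (U \<union> V) = iv \<phi> e U + iv \<phi> e V +
     ((\<Sum>a\<in>U. \<Sum>b\<in>V. if a < b \<and> \<phi> b < \<phi> a then ?w a b else 0) +
      (\<Sum>a\<in>U. \<Sum>b\<in>V. if b < a \<and> \<phi> a < \<phi> b then ?w a b else 0))"
    unfolding iv_def using assms swap by (simp add: sum.union_disjoint sum.distrib)
  also have "(\<Sum>a\<in>U. \<Sum>b\<in>V. if a < b \<and> \<phi> b < \<phi> a then ?w a b else 0) +
      (\<Sum>a\<in>U. \<Sum>b\<in>V. if b < a \<and> \<phi> a < \<phi> b then ?w a b else 0) =
      ksg (e \<circ> \<phi>) U V + ksg e (\<phi> ` U) (\<phi> ` V) - 2 * ?X"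
    unfolding k unfolding ksg_def sum_distrib_left sum.distrib[symmetric] sum_subtractf[symmetric]
  proof (rule sum.cong[OF refl], rule sum.cong[OF refl])
    fix a b assume ab: "a \<in> U" "b \<in> V"
    then have "a \<noteq> b" "\<phi> a \<noteq> \<phi> b" using assms(3,4) by (auto simp: inj_on_def)
    then show "(if a < b \<and> \<phi> b < \<phi> a then ?w a b else 0) + (if b < a \<and> \<phi> a < \<phi> b then ?w a b else 0) =
      (if b < a then (e \<circ> \<phi>) a * (e \<circ> \<phi>) b else 0) + (if \<phi> b < \<phi> a then ?w a b else 0) -
        2 * (if b < a \<and> \<phi> b < \<phi> a then ?w a b else 0)"
      by (cases a b rule: linorder_cases; cases "\<phi> a" "\<phi> b" rule: linorder_cases) auto
  qed
  finally show ?thesis by simp argo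
qed

lemma disj_list_map_image:
  assumes "disj_list Us" "inj_on \<phi> (\<Union>(set Us))"
  shows "disj_list (map ((`) \<phi>) Us)"
proof -
  have "inj_on ((`) \<phi>) (set Us)"
    by (rule inj_on_subset[OF inj_on_image_Pow[OF assms(2)]]) auto
  moreover have "disjoint ((`) \<phi> ` set Us)"
  proof (rule disjointI)
    fix a b assume "a \<in> (`) \<phi> ` set Us" "b \<in> (`) \<phi> ` set Us" "a \<noteq> b"
    then obtain U V where U: "a = \<phi> ` U" "b = \<phi> ` V" "U \<in> set Us" "V \<in> set Us" "U \<noteq> V" by auto
    then have "U \<inter> V = {}" using assms(1) by (auto simp: disj_list_def disjoint_def)
    moreover have "U \<subseteq> \<Union>(set Us)" "V \<subseteq> \<Union>(set Us)" using U by auto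
    ultimately show "a \<inter> b = {}" using inj_on_image_Int[OF assms(2), of U V] U by auto
  qed
  ultimately show ?thesis using assms(1) by (auto simp: disj_list_def distinct_map)
qed

text \<open>The images can be sorted in two ways: order the blocks into their union by
  \<open>kl\<close> and then apply \<open>iv\<close> to the union, or apply \<open>iv\<close> inside
  each block and then \<open>kl\<close> to the image blocks. The signs agree; the terms are only
  distributed differently over the two sides, which is harmless modulo 2.\<close>

lemma kl_reindex:
  "disj_list Us \<Longrightarrow> inj_on \<phi> (\<Union>(set Us)) \<Longrightarrow>
    even (kl (e \<circ> \<phi>) Us + (\<Sum>U\<leftarrow>Us. iv \<phi> e U)) =
    even (kl e (map ((`) \<phi>) Us) + iv \<phi> e (\<Union>(set Us)))"
proof (induction Us)
  case Nil
  then show ?case by (simp add: iv_def)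
next
  case (Cons U Us)
  let ?W = "\<Union>(set Us)"
  have d: "disj_list Us" "U \<inter> ?W = {}" "finite U" "finite ?W" using disj_list_Cons[OF Cons.prems(1)] by auto
  have inj: "inj_on \<phi> ?W" "inj_on \<phi> (U \<union> ?W)" using Cons.prems(2) by (auto simp: inj_on_def)
  have 1: "even (iv \<phi> e (U \<union> ?W)) = even (iv \<phi> e U + iv \<phi> e ?W + ksg (e \<circ> \<phi>) U ?W + ksg e (\<phi> ` U) (\<phi> ` ?W))"
    by (rule iv_Un) (use d inj in auto)
  have 2: "(\<Sum>V\<leftarrow>Us. ksg (e \<circ> \<phi>) U V) = ksg (e \<circ> \<phi>) U ?W"
    by (simp add: ksg_Union_right[OF d(1)])
  have 3: "(\<Sum>V\<leftarrow>map ((`) \<phi>) Us. ksg e (\<phi> ` U) V) = ksg e (\<phi> ` U) (\<phi> ` ?W)"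
    using ksg_Union_right[OF disj_list_map_image[OF d(1) inj(1)], of e "\<phi> ` U"]
    by (simp add: image_Union)
  show ?case using Cons.IH[OF d(1) inj(1)] 1 unfolding kl.simps list.map sum_list.Cons 2 3
    by (simp only: list.set Union_insert even_add) argo
qed

section \<open>Symmetric brackets of degree one\<close>

locale graded_group =
  fixes G :: "int \<Rightarrow> 'a::ab_group_add set"
  assumes G_0: "0 \<in> G i"
    and G_add: "x \<in> G i \<Longrightarrow> y \<in> G i \<Longrightarrow> x + y \<in> G i"
    and G_minus: "x \<in> G i \<Longrightarrow> - x \<in> G i"
begin

lemma G_signed: "x \<in> G i \<Longrightarrow> signed e x \<in> G i"
  by (simp add: signed_def G_minus)

lemma G_sum: "(\<And>j. j \<in> J \<Longrightarrow> f j \<in> G i) \<Longrightarrow> sum f J \<in> G i"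
  by (induction J rule: infinite_finite_induct) (auto intro: G_0 G_add)

end

text \<open>The shifted degree of \<open>a \<in> G (d - s)\<close> is \<open>d\<close>. Additivity is only required in the last slot, the one on which
  the decalage sign does not depend: the degree of an inhomogeneous element is a junk value.\<close>
locale sym_brackets = graded_group G for G :: "int \<Rightarrow> 'a::ab_group_add set" +
  fixes s :: int and mu :: "nat \<Rightarrow> 'a list \<Rightarrow> 'a"
  assumes mu_add_last: "length as = n \<Longrightarrow> mu (Suc n) (as @ [y + z]) = mu (Suc n) (as @ [y]) + mu (Suc n) (as @ [z])"
    and mu_minus: "list_all (homog G) (as @ x # bs) \<Longrightarrow> n = Suc (length as + length bs) \<Longrightarrow>
          mu n (as @ - x # bs) = - mu n (as @ x # bs)"
    and mu_deg: "list_all2 (\<lambda>a d. a \<in> G (d - s)) as ds \<Longrightarrow> as \<noteq> [] \<Longrightarrow> n = length as \<Longrightarrow>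
          mu n as \<in> G (sum_list ds + 1 - s)"
    and mu_sym: "list_all2 (\<lambda>a d. a \<in> G (d - s)) as ds \<Longrightarrow> as \<noteq> [] \<Longrightarrow> n = length as \<Longrightarrow> ps \<in> perms n \<Longrightarrow>
          mu n (map ((!) as) ps) = signed (koszul_exp ds ps) (mu n as)"
    and mu_linf: "list_all2 (\<lambda>a d. a \<in> G (d - s)) as ds \<Longrightarrow> as \<noteq> [] \<Longrightarrow> n = length as \<Longrightarrow>
          (\<Sum>i=1..n. \<Sum>S\<in>{S. S \<subseteq> {0..<n} \<and> card S = i}.
             signed (koszul_exp ds (unsh n S)) (mu (n - i + 1) (mu i (sel as S) # sel as ({0..<n} - S)))) = 0"
begin

definition mup :: "(nat \<Rightarrow> int) \<Rightarrow> (nat set \<Rightarrow> 'a) \<Rightarrow> nat set list \<Rightarrow> 'a" where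
  "mup e T Us = signed (kl e Us) (mu (length Us) (map T Us))"

definition F2 :: "(nat \<Rightarrow> int) \<Rightarrow> (nat set \<Rightarrow> 'a) \<Rightarrow> nat set \<Rightarrow> 'a" where
  "F2 e T S = (\<Sum>P\<in>{P. partition_on S P \<and> 2 \<le> card P}. mup e T (lst P))"

definition F :: "(nat \<Rightarrow> int) \<Rightarrow> (nat set \<Rightarrow> 'a) \<Rightarrow> nat set \<Rightarrow> 'a" where
  "F e T S = (\<Sum>P\<in>{P. partition_on S P \<and> P \<noteq> {}}. mup e T (lst P))"

text \<open>Component at \<open>W\<close> of the derivative of the bracket series at
  \<open>T\<close>, applied to a constant \<open>y\<close>. The condition
  \<open>P \<noteq> {}\<close> removes the linear bracket, so the operator vanishes for
  \<open>W = {}\<close>.\<close>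

definition lop :: "(nat \<Rightarrow> int) \<Rightarrow> (nat set \<Rightarrow> 'a) \<Rightarrow> nat set \<Rightarrow> 'a \<Rightarrow> 'a" where
  "lop e T W y = (\<Sum>P\<in>{P. partition_on W P \<and> P \<noteq> {}}.
     signed (kl e (lst P)) (mu (card P + 1) (map T (lst P) @ [y])))"

definition hom :: "(nat \<Rightarrow> int) \<Rightarrow> (nat set \<Rightarrow> 'a) \<Rightarrow> nat set \<Rightarrow> bool" where
  "hom e T S \<longleftrightarrow> finite S \<and> (\<forall>U\<subseteq>S. U \<noteq> {} \<longrightarrow> T U \<in> G (sum e U - s))"

lemma hom_subset: "hom e T S \<Longrightarrow> S' \<subseteq> S \<Longrightarrow> hom e T S'"
  by (auto simp: hom_def intro: finite_subset)

lemma list_all2_blocks: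
  "(\<And>U. U \<in> set Us \<Longrightarrow> T U \<in> G (sum e U - s)) \<Longrightarrow>
    list_all2 (\<lambda>a d. a \<in> G (d - s)) (map T Us) (map (sum e) Us)"
  by (simp add: list_all2_conv_all_nth)

text \<open>The sign \<open>kl\<close> and the graded symmetry of \<open>mu\<close> compensate each
  other by \<open>kl_perm\<close>. A distinguished block may thus be moved to the last slot at no
  cost.\<close>

lemma mup_perm:
  assumes "disj_list Us" "distinct Vs" "set Vs = set Us" "Us \<noteq> []"
    and T: "\<And>U. U \<in> set Us \<Longrightarrow> T U \<in> G (sum e U - s)"
  shows "mup e T Vs = mup e T Us"
proof -
  obtain ps where ps: "ps \<in> perms (length Us)" "Vs = map ((!) Us) ps"
    using perm_of_same_set[of Us Vs] assms by (auto simp: disj_list_def)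
  have len: "length ps = length Us" using ps(1) by (rule perms_length)
  have lt: "i < length Us" if "i \<in> set ps" for i using ps(1) that by (auto simp: perms_def)
  have eq: "map T Vs = map ((!) (map T Us)) ps" using ps(2) lt by auto
  have "length Vs = length Us" using ps(2) len by simp
  then have "mu (length Vs) (map T Vs) = signed (koszul_exp (map (sum e) Us) ps) (mu (length Us) (map T Us))"
    unfolding eq using mu_sym[OF list_all2_blocks[OF T], of Us "length Us" ps] assms(4) ps(1)
    by (simp del: map_map)
  then show ?thesis
    unfolding mup_def using kl_perm[OF assms(1) ps(1), of e] ps(2)
    by (simp add: even_add) (rule signed_cong, auto)
qed

lemma mu_signed_map:
  assumes "\<And>U. U \<in> set Us \<Longrightarrow> homog G (t U)"
  shows "mu (length Us) (map (\<lambda>U. signed (c U) (t U)) Us) =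
    signed (\<Sum>U\<leftarrow>Us. c U) (mu (length Us) (map t Us))"
proof -
  \<comment> \<open>The prefix is generalised because \<open>mu_minus\<close> pulls a sign out of
    one slot at a time and asks for the whole list to be homogeneous.\<close>
  have "list_all (homog G) pre \<Longrightarrow> (\<And>U. U \<in> set Us \<Longrightarrow> homog G (t U)) \<Longrightarrow>
     mu (length pre + length Us) (pre @ map (\<lambda>U. signed (c U) (t U)) Us) =
       signed (\<Sum>U\<leftarrow>Us. c U) (mu (length pre + length Us) (pre @ map t Us))" for pre
  proof (induction Us arbitrary: pre)
    case (Cons U Us)
    have h: "homog G (signed (c U) (t U))" using Cons.prems(2)[of U] G_signed by (auto simp: homog_def)
    have "mu (length pre + length (U # Us)) (pre @ map (\<lambda>U. signed (c U) (t U)) (U # Us)) =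
       signed (\<Sum>U\<leftarrow>Us. c U) (mu (length pre + length (U # Us)) (pre @ signed (c U) (t U) # map t Us))"
      using Cons.IH[of "pre @ [signed (c U) (t U)]"] Cons.prems h by simp
    also have "mu (length pre + length (U # Us)) (pre @ signed (c U) (t U) # map t Us) =
       signed (c U) (mu (length pre + length (U # Us)) (pre @ t U # map t Us))"
    proof -
      have "list_all (homog G) (pre @ t U # map t Us)" using Cons.prems by (auto simp: list_all_iff)
      then show ?thesis by (simp add: signed_def mu_minus)
    qed
    finally show ?case by (simp add: add.commute)
  qed simp
  from this[of "[]"] assms show ?thesis by simp
qed

text \<open>The quadratic relations put the inner bracket into the first slot, whereas
  \<open>lop\<close> takes its argument in the last.\<close>

lemma mu_move_first:
  assumes "a \<in> G (d - s)" "list_all2 (\<lambda>a d. a \<in> G (d - s)) as ds" "n = Suc (length as)"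
  shows "mu n (a # as) = signed (d * sum_list ds) (mu n (as @ [a]))"
proof -
  have len: "length ds = length as" using assms(2) by (simp add: list_all2_lengthD)
  let ?m = "length as"
  have l2: "list_all2 (\<lambda>a d. a \<in> G (d - s)) (as @ [a]) (ds @ [d])"
    using assms(1,2) by (simp add: list_all2_appendI)
  have ps: "?m # [0..<?m] \<in> perms n" using assms(3) by (auto simp: perms_def)
  have "map ((!) (as @ [a])) [0..<?m] = as"
    by (rule nth_equalityI) (auto simp: nth_append)
  then have "map ((!) (as @ [a])) (?m # [0..<?m]) = a # as" by simp
  moreover have "koszul_exp (ds @ [d]) (?m # [0..<?m]) = d * sum_list ds"
  proof -
    have "koszul_exp (ds @ [d]) (?m # [0..<?m]) = ksg ((!) (ds @ [d])) {?m} {0..<?m}"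
      by (subst koszul_exp_Cons) (auto simp: koszul_exp_sorted)
    also have "\<dots> = (\<Sum>b\<in>{0..<?m}. d * ds ! b)"
      by (simp add: ksg_def len[symmetric] nth_append)
    finally show ?thesis by (simp add: sum_distrib_left[symmetric] sum_list_sum_nth len)
  qed
  ultimately show ?thesis
    using mu_sym[OF l2 _ _ ps] assms(3) by simp
qed

lemma lop_additive:
  assumes "finite W"
  shows "is_additive (lop e T W)"
  unfolding lop_def
proof (intro is_additive_setsum is_additiveI)
  fix P y z assume "P \<in> {P. partition_on W P \<and> P \<noteq> {}}"
  then have "finite P" using partition_finite[OF assms] by simp
  then show "signed (kl e (lst P)) (mu (card P + 1) (map T (lst P) @ [y + z])) =
     signed (kl e (lst P)) (mu (card P + 1) (map T (lst P) @ [y])) +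
     signed (kl e (lst P)) (mu (card P + 1) (map T (lst P) @ [z]))"
    by (simp add: mu_add_last signed_add)
qed

lemma lop_empty [simp]: "lop e T {} y = 0"
  unfolding lop_def by (simp add: partition_on_empty_iff)

lemma lop_cong:
  assumes "finite W" "\<And>U. U \<subseteq> W \<Longrightarrow> U \<noteq> {} \<Longrightarrow> T U = T' U" "\<And>i. i \<in> W \<Longrightarrow> e i = e' i"
  shows "lop e T W y = lop e' T' W y"
  unfolding lop_def
proof (rule sum.cong[OF refl], clarify)
  fix P assume P: "partition_on W P"
  have fP: "finite P" using assms(1) P by (rule partition_finite)
  have "map T (lst P) = map T' (lst P)"
    using assms(2) partition_block[OF P] fP by simp
  moreover have "kl e (lst P) = kl e' (lst P)"
    by (rule kl_cong) (use assms(3) partition_block[OF P] fP in auto)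
  ultimately show "signed (kl e (lst P)) (mu (card P + 1) (map T (lst P) @ [y])) =
     signed (kl e' (lst P)) (mu (card P + 1) (map T' (lst P) @ [y]))" by (simp only:)
qed

lemma lop_deg:
  assumes "hom e T W" "y \<in> G r" "q = r + sum e W + 1"
  shows "lop e T W y \<in> G q"
  unfolding lop_def assms(3)
proof (rule G_sum, clarify)
  fix P assume P: "partition_on W P"
  have fW: "finite W" using assms(1) by (simp add: hom_def)
  have fP: "finite P" using fW P by (rule partition_finite)
  have "list_all2 (\<lambda>a d. a \<in> G (d - s)) (map T (lst P) @ [y]) (map (sum e) (lst P) @ [r + s])"
    using assms(1,2) partition_block[OF P] fP
    by (intro list_all2_appendI list_all2_blocks) (auto simp: hom_def)
  from mu_deg[OF this, of "card P + 1"] fP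
  have "mu (card P + 1) (map T (lst P) @ [y]) \<in> G (r + sum e W + 1)"
    by (simp add: partition_sum_blocks[OF fW P] algebra_simps)
  then show "signed (kl e (lst P)) (mu (card P + 1) (map T (lst P) @ [y])) \<in> G (r + sum e W + 1)"
    by (rule G_signed)
qed

lemma mup_deg:
  assumes "finite S" "partition_on S P" "P \<noteq> {}" "\<And>U. U \<in> P \<Longrightarrow> T U \<in> G (sum e U - s)"
  shows "mup e T (lst P) \<in> G (sum e S + 1 - s)"
proof -
  have fP: "finite P" using assms(1,2) by (rule partition_finite)
  have "lst P \<noteq> []" using fP assms(3) by (metis set_empty set_lst)
  then have "mu (length (lst P)) (map T (lst P)) \<in> G (sum e S + 1 - s)"
    using mu_deg[OF list_all2_blocks[of "lst P" T e]] assms(4) fP partition_sum_blocks[OF assms(1,2), of e]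
    by auto
  then show ?thesis unfolding mup_def by (rule G_signed)
qed

lemma F2_deg:
  assumes "finite S" "\<And>U. U \<subseteq> S \<Longrightarrow> U \<noteq> {} \<Longrightarrow> U \<noteq> S \<Longrightarrow> T U \<in> G (sum e U - s)"
  shows "F2 e T S \<in> G (sum e S + 1 - s)"
  unfolding F2_def
proof (rule G_sum, clarify)
  fix P assume P: "partition_on S P" "2 \<le> card P"
  show "mup e T (lst P) \<in> G (sum e S + 1 - s)"
    by (rule mup_deg[OF assms(1) P(1)])
      (use P assms partition_block[OF P(1)] partition_two_blocks[OF assms(1) P] in auto)
qed

lemma F_eq: "finite S \<Longrightarrow> S \<noteq> {} \<Longrightarrow> F e T S = mu 1 [T S] + F2 e T S"
  unfolding F_def F2_def by (subst partitions_split_one) (auto simp: mup_def)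

text \<open>Serves two purposes. For increasing \<open>\<phi>\<close> every \<open>iv\<close>
  vanishes, and \<open>F2\<close> of a sublist becomes \<open>F2\<close> at a subset; for a general
  injection it is the induction step for graded symmetry. That induction is possible because only
  proper subsets of \<open>S\<close> occur in the hypotheses on \<open>T\<close> and
  \<open>T'\<close>.\<close>

lemma F2_reindex:
  assumes S: "finite S" and inj: "inj_on \<phi> S" and e: "\<And>i. i \<in> S \<Longrightarrow> e' i = e (\<phi> i)"
    and T': "\<And>U. U \<subseteq> S \<Longrightarrow> U \<noteq> {} \<Longrightarrow> U \<noteq> S \<Longrightarrow> T' U = signed (iv \<phi> e U) (T (\<phi> ` U))"
    and T: "\<And>U. U \<subseteq> S \<Longrightarrow> U \<noteq> {} \<Longrightarrow> U \<noteq> S \<Longrightarrow> T (\<phi> ` U) \<in> G (sum e (\<phi> ` U) - s)"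
  shows "F2 e' T' S = signed (iv \<phi> e S) (F2 e T (\<phi> ` S))"
proof -
  let ?\<psi> = "inv_into S \<phi>"
  have "F2 e' T' S = (\<Sum>P\<in>{P. partition_on S P \<and> 2 \<le> card P}. signed (iv \<phi> e S) (mup e T (lst ((`) \<phi> ` P))))"
    unfolding F2_def
  proof (rule sum.cong[OF refl], clarify)
    fix P assume P: "partition_on S P" "2 \<le> card P"
    let ?Us = "lst P"
    have fP: "finite P" using S P(1) by (rule partition_finite)
    have d: "disj_list ?Us" "\<Union>(set ?Us) = S" "set ?Us = P"
      using partition_disj_list[OF S P(1), of "lst P"] fP by auto
    have ne: "?Us \<noteq> []" using P(2) length_lst[OF fP] by (metis list.size(3) not_numeral_le_zero)
    have blk: "U \<subseteq> S" "U \<noteq> {}" "U \<noteq> S" if "U \<in> P" for U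
      using that partition_block[OF P(1)] partition_two_blocks[OF S P] by auto
    have dm: "disj_list (map ((`) \<phi>) ?Us)" by (rule disj_list_map_image) (use d inj in auto)
    have "map T' ?Us = map (\<lambda>U. signed (iv \<phi> e U) ((T \<circ> (`) \<phi>) U)) ?Us"
      using T' blk d(3) by simp
    moreover have "mu (length ?Us) (map (\<lambda>U. signed (iv \<phi> e U) ((T \<circ> (`) \<phi>) U)) ?Us) =
        signed (\<Sum>U\<leftarrow>?Us. iv \<phi> e U) (mu (length ?Us) (map (T \<circ> (`) \<phi>) ?Us))"
    proof (rule mu_signed_map)
      fix U assume "U \<in> set ?Us"
      then have "T (\<phi> ` U) \<in> G (sum e (\<phi> ` U) - s)" using T blk d(3) by simp
      then show "homog G ((T \<circ> (`) \<phi>) U)" by (auto simp: homog_def)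
    qed
    ultimately have "mup e' T' ?Us = signed (kl e' ?Us + (\<Sum>U\<leftarrow>?Us. iv \<phi> e U)) (mu (length ?Us) (map T (map ((`) \<phi>) ?Us)))"
      unfolding mup_def by (simp only: signed_signed map_map)
    also have "kl e' ?Us = kl (e \<circ> \<phi>) ?Us" by (rule kl_cong) (use e d in auto)
    also have "signed (kl (e \<circ> \<phi>) ?Us + (\<Sum>U\<leftarrow>?Us. iv \<phi> e U)) (mu (length ?Us) (map T (map ((`) \<phi>) ?Us))) =
       signed (iv \<phi> e S) (mup e T (map ((`) \<phi>) ?Us))"
    proof -
      have "even (kl (e \<circ> \<phi>) ?Us + (\<Sum>U\<leftarrow>?Us. iv \<phi> e U)) =
          even (iv \<phi> e S + kl e (map ((`) \<phi>) ?Us))"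
        using kl_reindex[OF d(1), of \<phi> e] inj unfolding d(2) by (simp only: add.commute)
      then show ?thesis unfolding mup_def signed_signed length_map by (rule signed_cong)
    qed
    \<comment> \<open>\<open>\<phi>\<close> need not respect the order of the minima, so the image
      blocks are brought back into the order of \<open>lst\<close>.\<close>
    also have "mup e T (map ((`) \<phi>) ?Us) = mup e T (lst ((`) \<phi> ` P))"
      by (rule mup_perm[symmetric, OF dm]) (use fP d ne T blk in auto)
    finally show "mup e' T' (lst P) = signed (iv \<phi> e S) (mup e T (lst ((`) \<phi> ` P)))" .
  qed
  also have "\<dots> = signed (iv \<phi> e S) (F2 e T (\<phi> ` S))"
    unfolding F2_def signed_sum
  proof (rule sum.reindex_bij_betw)
    show "bij_betw ((`) ((`) \<phi>)) {P. partition_on S P \<and> 2 \<le> card P} {P. partition_on (\<phi> ` S) P \<and> 2 \<le> card P}"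
    proof (rule bij_betw_byWitness[where f' = "(`) ((`) ?\<psi>)"])
      have im: "partition_on (f ` A) ((`) f ` P) \<and> card ((`) f ` P) = card P"
        if P: "partition_on A P" and f: "inj_on f A" for f and A :: "nat set" and P
      proof -
        have "{} \<notin> (`) f ` P" using P by (auto simp: partition_on_def)
        moreover have "inj_on ((`) f) P"
          by (rule inj_on_subset[OF inj_on_image_Pow[OF f]]) (use P in \<open>auto simp: partition_on_def\<close>)
        ultimately show ?thesis using partition_on_inj_image[OF P f] by (simp add: card_image)
      qed
      have inv: "?\<psi> ` \<phi> ` U = U" if "U \<subseteq> S" for U
        using inj that by (rule inv_into_image_cancel)
      have inv': "\<phi> ` ?\<psi> ` U = U" if "U \<subseteq> \<phi> ` S" for U
        using that by (simp add: image_inv_into_cancel)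
      show "\<forall>P\<in>{P. partition_on S P \<and> 2 \<le> card P}. (`) ?\<psi> ` (`) \<phi> ` P = P"
      proof clarify
        fix P assume P: "partition_on S P"
        have "(`) ?\<psi> ` (`) \<phi> ` P = (\<lambda>U. ?\<psi> ` \<phi> ` U) ` P" by (rule image_image)
        also have "\<dots> = (\<lambda>U. U) ` P"
          by (intro image_cong refl inv) (use partition_block[OF P] in simp)
        finally show "(`) ?\<psi> ` (`) \<phi> ` P = P" by simp
      qed
      show "\<forall>P\<in>{P. partition_on (\<phi> ` S) P \<and> 2 \<le> card P}. (`) \<phi> ` (`) ?\<psi> ` P = P"
      proof clarify
        fix P assume P: "partition_on (\<phi> ` S) P"
        have "(`) \<phi> ` (`) ?\<psi> ` P = (\<lambda>U. \<phi> ` ?\<psi> ` U) ` P" by (rule image_image)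
        also have "\<dots> = (\<lambda>U. U) ` P"
          by (intro image_cong refl inv') (use partition_block[OF P] in simp)
        finally show "(`) \<phi> ` (`) ?\<psi> ` P = P" by simp
      qed
      show "(`) ((`) \<phi>) ` {P. partition_on S P \<and> 2 \<le> card P} \<subseteq> {P. partition_on (\<phi> ` S) P \<and> 2 \<le> card P}"
        using im[OF _ inj] by auto
      show "(`) ((`) ?\<psi>) ` {P. partition_on (\<phi> ` S) P \<and> 2 \<le> card P} \<subseteq> {P. partition_on S P \<and> 2 \<le> card P}"
        using im[of "\<phi> ` S" _ ?\<psi>] inv[of S] by (auto simp: inj_on_inv_into)
    qed
  qed
  finally show ?thesis .
qed

end

section \<open>Subset sums by cardinality and over triples of disjoint parts\<close>

lemma sum_by_card:
  fixes f :: "nat set \<Rightarrow> 'b::comm_monoid_add"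
  shows "(\<Sum>i=1..n. \<Sum>S\<in>{S. S \<subseteq> {0..<n} \<and> card S = i}. f S) = (\<Sum>S\<in>{S. S \<subseteq> {0..<n} \<and> S \<noteq> {}}. f S)"
    and "(\<Sum>i=0..n. \<Sum>S\<in>{S. S \<subseteq> {0..<n} \<and> card S = i}. f S) = (\<Sum>S\<in>Pow {0..<n}. f S)"
proof -
  have fin: "finite S" if "S \<subseteq> {0..<n}" for S :: "nat set" using that finite_subset by blast
  have le: "card S \<le> n" if "S \<subseteq> {0..<n}" for S using card_mono[OF _ that] by simp
  have "(\<Sum>i=1..n. \<Sum>S\<in>{S. S \<subseteq> {0..<n} \<and> card S = i}. f S) =
      (\<Sum>i=1..n. \<Sum>S\<in>{S \<in> {S. S \<subseteq> {0..<n} \<and> S \<noteq> {}}. card S = i}. f S)"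
    by (intro sum.cong refl) auto
  also have "\<dots> = (\<Sum>S\<in>{S. S \<subseteq> {0..<n} \<and> S \<noteq> {}}. f S)"
    by (rule sum.group) (use fin le in \<open>auto simp: Suc_le_eq card_gt_0_iff\<close>)
  finally show "(\<Sum>i=1..n. \<Sum>S\<in>{S. S \<subseteq> {0..<n} \<and> card S = i}. f S) = \<dots>" .
  have "(\<Sum>i=0..n. \<Sum>S\<in>{S. S \<subseteq> {0..<n} \<and> card S = i}. f S) =
      (\<Sum>i=0..n. \<Sum>S\<in>{S \<in> Pow {0..<n}. card S = i}. f S)"
    by (intro sum.cong refl) auto
  also have "\<dots> = (\<Sum>S\<in>Pow {0..<n}. f S)"
    by (rule sum.group) (use le in auto)
  finally show "(\<Sum>i=0..n. \<Sum>S\<in>{S. S \<subseteq> {0..<n} \<and> card S = i}. f S) = (\<Sum>S\<in>Pow {0..<n}. f S)" .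
qed

text \<open>Normal form for nested subset sums: ordered decompositions of \<open>S\<close> into
  three possibly empty parts. Two nested sums agree once their terms agree for each
  decomposition.\<close>

definition tri :: "(nat set \<Rightarrow> nat set \<Rightarrow> nat set \<Rightarrow> 'b::comm_monoid_add) \<Rightarrow> nat set \<Rightarrow> 'b" where
  "tri f S = (\<Sum>V\<in>Pow S. \<Sum>W\<in>Pow (S - V). f V W (S - V - W))"

lemma tri_cong:
  assumes "\<And>U V W. U \<union> V \<union> W = S \<Longrightarrow> U \<inter> V = {} \<Longrightarrow> U \<inter> W = {} \<Longrightarrow> V \<inter> W = {} \<Longrightarrow> f U V W = g U V W"
  shows "tri f S = tri g S"
  unfolding tri_def by (intro sum.cong refl assms) auto

lemma tri_eq:
  "finite S \<Longrightarrow> (\<Sum>U\<in>Pow S. \<Sum>V\<in>Pow U. f V (U - V) (S - U)) = tri f S"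
  unfolding tri_def by (rule sum_subset_triples)

lemma tri_swap: "tri (\<lambda>U V W. f U W V) S = tri f S"
  unfolding tri_def
proof (rule sum.cong[OF refl])
  fix V
  show "(\<Sum>W\<in>Pow (S - V). f V (S - V - W) W) = (\<Sum>W\<in>Pow (S - V). f V W (S - V - W))"
    using sum_subset_compl[of "f V" "S - V"] by simp
qed

lemma disj_list_subset:
  "disj_list Us \<Longrightarrow> distinct Vs \<Longrightarrow> set Vs \<subseteq> set Us \<Longrightarrow> disj_list Vs"
  unfolding disj_list_def disjoint_def by blast

text \<open>Increasing positions in a list sorted by minima give a list sorted by minima, and
  \<open>lst_unique\<close> applies. It matches the argument sublists of a relation with subfamilies
  of a partition.\<close>

lemma sel_lst:
  assumes "I \<subseteq> {0..<length Us}" "disj_list Us" "sorted (map Min Us)"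
  shows "sel Us I = lst ((!) Us ` I)"
proof -
  have fI: "finite I" using assms(1) by (rule finite_subset) simp
  have set: "set (sel Us I) = (!) Us ` I" using fI by (simp add: sel_def)
  have sub: "(!) Us ` I \<subseteq> set Us" using assms(1) by auto
  have "inj_on ((!) Us) I"
    using assms(1,2) by (auto simp: disj_list_def inj_on_def nth_eq_iff_index_eq subset_iff)
  then have "distinct (sel Us I)" using fI by (simp add: sel_def distinct_map)
  then have d: "disj_list (sel Us I)" by (rule disj_list_subset[OF assms(2)]) (use sub set in simp)
  have "sorted (map Min (sel Us I))"
  proof -
    have "sorted_wrt (\<lambda>i j. Min (Us ! i) \<le> Min (Us ! j)) (sorted_list_of_set I)"
    proof (rule sorted_wrt_mono_rel[of _ "(\<le>)"])
      fix i j assume "i \<in> set (sorted_list_of_set I)" "j \<in> set (sorted_list_of_set I)" "i \<le> j"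
      moreover from this have "j < length Us" using assms(1) fI by auto
      ultimately show "Min (Us ! i) \<le> Min (Us ! j)"
        using sorted_nth_mono[OF assms(3), of i j] by simp
    qed simp
    then show ?thesis by (simp add: sel_def sorted_map)
  qed
  from lst_unique[OF d this] show ?thesis by (simp add: set)
qed

context sym_brackets
begin

text \<open>The derivative of \<open>F2\<close> at \<open>T\<close> in direction \<open>Y\<close>. The block carrying \<open>Y\<close> is moved to the last slot, where
  the brackets are derivations.\<close>
definition d0 :: "(nat \<Rightarrow> int) \<Rightarrow> (nat set \<Rightarrow> 'a) \<Rightarrow> (nat set \<Rightarrow> 'a) \<Rightarrow> nat set \<Rightarrow> 'a" where
  "d0 e T Y S = (\<Sum>U\<in>Pow S. signed (ksg e (S - U) U) (lop e T (S - U) (Y U)))"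

text \<open>The block through \<open>n\<close> is moved to the end by \<open>mup_perm\<close>. As
  \<open>n\<close> exceeds every element of \<open>S\<close>, it causes no inversion there, and only
  the sign of \<open>U\<close> against the other blocks is left.\<close>

lemma F2_insert:
  assumes S: "finite S" "\<And>i. i \<in> S \<Longrightarrow> i < n" and T: "hom e T (insert n S)"
  shows "F2 e T (insert n S) = d0 e T (\<lambda>U. T (insert n U)) S"
proof -
  have n: "n \<notin> S" using S(2) by blast
  show ?thesis
    unfolding F2_def d0_def lop_def signed_sum sum_partitions_insert[OF S(1) n]
  proof (rule sum.cong[OF refl], rule sum.cong[OF refl], clarify)
    fix U P assume U: "U \<subseteq> S" and P: "partition_on (S - U) P"
    let ?B = "insert n U" and ?Us = "lst P"
    have fin: "finite (S - U)" "finite U" using S(1) U finite_subset by auto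
    have fP: "finite P" using fin(1) P by (rule partition_finite)
    have d: "disj_list ?Us" using fin(1) P by (rule disj_list_lst)
    have B: "V \<inter> ?B = {}" "V \<subseteq> S" if "V \<in> P" for V using partition_block[OF P that] n by auto
    have nB: "?B \<notin> P" using B(1) by blast
    have dB: "disj_list (?Us @ [?B])"
      using d B fP fin nB by (auto simp: disj_list_def disjoint_def Int_commute)
    have "mup e T (lst (insert ?B P)) = mup e T (?Us @ [?B])"
    proof (rule mup_perm[OF dB])
      fix V assume "V \<in> set (?Us @ [?B])"
      then consider "V \<in> P" | "V = ?B" using fP by auto
      then have "V \<subseteq> insert n S" "V \<noteq> {}"
        using U B(2) partition_block[OF P, of V] by (cases; auto)+
      then show "T V \<in> G (sum e V - s)" using T by (auto simp: hom_def)
    qed (use fP in auto)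
    moreover have "kl e (?Us @ [?B]) = kl e ?Us + ksg e (S - U) U"
    proof -
      have "(\<Sum>V\<leftarrow>?Us. ksg e V ?B) = ksg e (\<Union>P) ?B" using ksg_Union_left[OF d, of e ?B] fP by simp
      also have "\<Union>P = S - U" using P by (simp add: partition_on_def)
      also have "ksg e (S - U) ?B = ksg e (S - U) U + ksg e (S - U) {n}"
        using ksg_Un_right[of U "{n}"] fin U n by auto
      also have "ksg e (S - U) {n} = 0" 
      proof -
        have "\<not> n < a" if "a \<in> S" for a using S(2)[OF that] by simp
        then show ?thesis unfolding ksg_def by (auto intro!: sum.neutral)
      qed
      finally show ?thesis by (simp add: kl_append)
    qed
    ultimately show "mup e T (lst (insert ?B P)) =
       signed (ksg e (S - U) U) (signed (kl e ?Us) (mu (card P + 1) (map T ?Us @ [T ?B])))"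
      unfolding mup_def using fP by (simp add: add.commute)
  qed
qed

text \<open>The term \<open>U = S\<close> has no block left for \<open>T\<close> and vanishes with
  \<open>lop\<close> at \<open>{}\<close>. Every uniqueness argument rests on this.\<close>

lemma d0_cong:
  assumes "finite S" "\<And>U. U \<subset> S \<Longrightarrow> Y U = Z U"
  shows "d0 e T Y S = d0 e T Z S"
  unfolding d0_def
proof (rule sum.cong[OF refl])
  fix U assume "U \<in> Pow S"
  then show "signed (ksg e (S - U) U) (lop e T (S - U) (Y U)) = signed (ksg e (S - U) U) (lop e T (S - U) (Z U))"
    using assms(2)[of U] by (cases "U = S") auto
qed

lemma d0_cong_base:
  assumes "finite S" "\<And>U. U \<subseteq> S \<Longrightarrow> U \<noteq> {} \<Longrightarrow> T U = T' U" "\<And>i. i \<in> S \<Longrightarrow> e i = e' i"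
  shows "d0 e T Y S = d0 e' T' Y S"
  unfolding d0_def
proof (rule sum.cong[OF refl])
  fix U assume "U \<in> Pow S"
  moreover have "ksg e (S - U) U = ksg e' (S - U) U"
    by (rule ksg_cong) (use assms(3) \<open>U \<in> Pow S\<close> in auto)
  moreover have "lop e T (S - U) (Y U) = lop e' T' (S - U) (Y U)"
    by (rule lop_cong) (use assms in auto)
  ultimately show "signed (ksg e (S - U) U) (lop e T (S - U) (Y U)) = signed (ksg e' (S - U) U) (lop e' T' (S - U) (Y U))"
    by simp
qed

lemma d0_deg:
  assumes T: "hom e T S" and Y: "\<And>U. U \<subseteq> S \<Longrightarrow> U \<noteq> S \<Longrightarrow> Y U \<in> G (r + sum e U)"
  shows "d0 e T Y S \<in> G (r + sum e S + 1)"
  unfolding d0_def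
proof (intro G_sum G_signed)
  fix U assume "U \<in> Pow S"
  then have U: "U \<subseteq> S" by simp
  show "lop e T (S - U) (Y U) \<in> G (r + sum e S + 1)"
  proof (cases "U = S")
    case False
    have "sum e S = sum e U + sum e (S - U)"
      using T U by (subst sum.subset_diff[of U S]) (auto simp: hom_def)
    then show ?thesis
      using lop_deg[OF hom_subset[OF T, of "S - U"] Y[OF U False], of "r + sum e S + 1"] by simp
  qed (simp add: G_0)
qed

lemma fixed_point_unique:
  assumes N: "finite N" and h: "is_additive h"
    and X: "\<And>S. S \<subseteq> N \<Longrightarrow> X S = c S + h (d0 e T X S)"
    and Y: "\<And>S. S \<subseteq> N \<Longrightarrow> Y S = c S + h (d0 e T Y S)"
    and S: "S \<subseteq> N"
  shows "X S = Y S"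
proof -
  have "finite S" using S N by (rule finite_subset)
  then show ?thesis using S
  proof (induction S rule: finite_psubset_induct)
    case (psubset A)
    have "d0 e T X A = d0 e T Y A" by (rule d0_cong) (use psubset in auto)
    then show ?case using X[OF psubset.prems] Y[OF psubset.prems] by simp
  qed
qed

text \<open>The derivative is linear over the parameters, so a direction that itself varies with a
  subset \<open>V\<close> can be summed after differentiating. Both exponents expand to
  \<open>ksg\<close> of \<open>X\<close> past \<open>V\<close>, \<open>X\<close> past
  \<open>W\<close> and \<open>W\<close> past \<open>V\<close>, together with
  \<open>sum e V\<close>.\<close>

lemma d0_twist:
  assumes S: "finite S"
  shows "d0 e T (\<lambda>S. \<Sum>V\<in>Pow S. signed (ksg e (S - V) V + sum e V) (D V (S - V))) S =
    (\<Sum>V\<in>Pow S. signed (ksg e (S - V) V + sum e V) (d0 e T (D V) (S - V)))"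
proof -
  let ?f = "\<lambda>V W X. signed (ksg e X (V \<union> W) + ksg e W V + sum e V) (lop e T X (D V W))"
  let ?g = "\<lambda>V W X. signed (ksg e (W \<union> X) V + sum e V + ksg e X W) (lop e T X (D V W))"
  have "d0 e T (\<lambda>S. \<Sum>V\<in>Pow S. signed (ksg e (S - V) V + sum e V) (D V (S - V))) S =
     (\<Sum>U\<in>Pow S. \<Sum>V\<in>Pow U. ?f V (U - V) (S - U))"
    unfolding d0_def
  proof (rule sum.cong[OF refl])
    fix U assume U: "U \<in> Pow S"
    have A: "is_additive (lop e T (S - U))" using S by (simp add: lop_additive)
    show "signed (ksg e (S - U) U) (lop e T (S - U) (\<Sum>V\<in>Pow U. signed (ksg e (U - V) V + sum e V) (D V (U - V)))) =
       (\<Sum>V\<in>Pow U. ?f V (U - V) (S - U))"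
      unfolding is_additive_sum[OF A] signed_sum is_additive_signed[OF A]
      by (intro sum.cong refl) (auto simp: Un_absorb1 add.assoc)
  qed
  also have "\<dots> = tri ?f S" by (rule tri_eq[OF S])
  also have "\<dots> = tri ?g S"
  proof (rule tri_cong)
    fix V W X assume a: "V \<union> W \<union> X = S" "V \<inter> W = {}" "V \<inter> X = {}" "W \<inter> X = {}"
    then have fin: "finite V" "finite W" "finite X" using S by (auto intro: finite_subset)
    show "?f V W X = ?g V W X"
      by (rule arg_cong[where f = "\<lambda>t. signed t _"]) (simp add: ksg_Un_left ksg_Un_right fin a)
  qed
  also have "\<dots> = (\<Sum>V\<in>Pow S. signed (ksg e (S - V) V + sum e V) (d0 e T (D V) (S - V)))"
    unfolding tri_def d0_def signed_sum signed_signed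
    by (intro sum.cong refl) (auto simp: Un_absorb1)
  finally show ?thesis .
qed

lemma mu_1_additive: "is_additive (\<lambda>y. mu 1 [y])"
  using mu_add_last[of "[]" 0] by (intro is_additiveI) simp

lemma hom_block:
  "hom e T S \<Longrightarrow> partition_on W P \<Longrightarrow> W \<subseteq> S \<Longrightarrow> U \<in> P \<Longrightarrow> T U \<in> G (sum e U - s)"
  using partition_block[of W P U] by (auto simp: hom_def)

text \<open>This is \<open>mu_linf\<close> evaluated on the blocks of one partition. The unshuffle
  of positions lists the blocks of \<open>Q\<close> before the others, so by \<open>kl_perm\<close>
  its Koszul sign turns the constant exponent \<open>kl\<close> of all blocks into that of the split
  list.\<close>

lemma sum_F_subsets_zero:
  assumes S: "finite S" and P: "partition_on S P" "P \<noteq> {}" and T: "hom e T S"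
  shows "(\<Sum>Q\<in>{Q. Q \<subseteq> P \<and> Q \<noteq> {}}.
      signed (kl e (lst Q) + kl e (lst (P - Q)) + ksg e (\<Union>Q) (\<Union>(P - Q)))
        (mu (card (P - Q) + 1) (mu (card Q) (map T (lst Q)) # map T (lst (P - Q))))) = 0"
    (is "sum ?t _ = 0")
proof -
  let ?Us = "lst P" and ?p = "card P"
  let ?as = "map T ?Us" and ?ds = "map (sum e) ?Us"
  have fP: "finite P" using S P(1) by (rule partition_finite)
  have d: "disj_list ?Us" using S P(1) by (rule disj_list_lst)
  have len: "length ?Us = ?p" using fP by simp
  have l2: "list_all2 (\<lambda>a d. a \<in> G (d - s)) ?as ?ds"
    by (rule list_all2_blocks) (use T fP partition_block[OF P(1)] in \<open>auto simp: hom_def\<close>)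
  have bij: "bij_betw ((!) ?Us) {0..<?p} P"
    using fP by (intro bij_betw_nth) auto
  have bij': "bij_betw ((`) ((!) ?Us)) {I. I \<subseteq> {0..<?p} \<and> I \<noteq> {}} {Q. Q \<subseteq> P \<and> Q \<noteq> {}}"
    unfolding bij_betw_def
  proof
    have "inj_on ((!) ?Us) {0..<?p}" using bij by (simp add: bij_betw_def)
    from inj_on_image_Pow[OF this]
    show "inj_on ((`) ((!) ?Us)) {I. I \<subseteq> {0..<?p} \<and> I \<noteq> {}}" by (rule inj_on_subset) auto
    have im: "(!) ?Us ` {0..<?p} = P" using bij by (simp add: bij_betw_def)
    show "(`) ((!) ?Us) ` {I. I \<subseteq> {0..<?p} \<and> I \<noteq> {}} = {Q. Q \<subseteq> P \<and> Q \<noteq> {}}"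
    proof (intro set_eqI iffI)
      fix Q assume "Q \<in> {Q. Q \<subseteq> P \<and> Q \<noteq> {}}"
      then have "Q \<subseteq> (!) ?Us ` {0..<?p}" "Q \<noteq> {}" unfolding im by auto
      then obtain I where "I \<subseteq> {0..<?p}" "Q = (!) ?Us ` I" by (auto simp only: subset_image_iff)
      then show "Q \<in> (`) ((!) ?Us) ` {I. I \<subseteq> {0..<?p} \<and> I \<noteq> {}}" using \<open>Q \<noteq> {}\<close> by auto
    next
      fix Q assume "Q \<in> (`) ((!) ?Us) ` {I. I \<subseteq> {0..<?p} \<and> I \<noteq> {}}"
      then show "Q \<in> {Q. Q \<subseteq> P \<and> Q \<noteq> {}}" using im by blast
    qed
  qed
  let ?g = "\<lambda>I. signed (kl e ?Us) (signed (koszul_exp ?ds (unsh ?p I))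
      (mu (?p - card I + 1) (mu (card I) (sel ?as I) # sel ?as ({0..<?p} - I))))"
  have "sum ?t {Q. Q \<subseteq> P \<and> Q \<noteq> {}} = (\<Sum>I\<in>{I. I \<subseteq> {0..<?p} \<and> I \<noteq> {}}. ?t ((!) ?Us ` I))"
    by (rule sum.reindex_bij_betw[OF bij', symmetric])
  also have "\<dots> = (\<Sum>I\<in>{I. I \<subseteq> {0..<?p} \<and> I \<noteq> {}}. ?g I)"
  proof (rule sum.cong[OF refl], clarify)
    fix I :: "nat set" assume I: "I \<subseteq> {0..<?p}" "I \<noteq> {}"
    let ?Q = "(!) ?Us ` I" and ?J = "{0..<?p} - I"
    have inj: "inj_on ((!) ?Us) {0..<?p}" and im: "(!) ?Us ` {0..<?p} = P" using bij by (auto simp: bij_betw_def)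
    have fI: "finite I" using I(1) by (rule finite_subset) simp
    have srt: "sorted (map Min ?Us)" using lst_props[OF fP] by simp
    have J: "(!) ?Us ` ?J = P - ?Q" using inj_on_image_set_diff[OF inj, of "{0..<?p}" I] I im by auto
    have selI: "sel ?Us I = lst ?Q" by (rule sel_lst) (use I d srt len in auto)
    have selJ: "sel ?Us ?J = lst (P - ?Q)" using sel_lst[of ?J ?Us] d srt len J by auto
    have asI: "sel ?as I = map T (lst ?Q)"
      unfolding selI[symmetric] using I fI len by (auto simp: sel_def)
    have asJ: "sel ?as ?J = map T (lst (P - ?Q))"
      unfolding selJ[symmetric] using len by (auto simp: sel_def)
    have cI: "card ?Q = card I" by (rule card_image) (rule inj_on_subset[OF inj I(1)])
    have cJ: "card (P - ?Q) = ?p - card I"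
      using I im cI fP by (subst card_Diff_subset) (auto simp: fI)
    have QP: "?Q \<subseteq> P" using I im by auto
    have dQ: "disj_list (lst ?Q)" "disj_list (lst (P - ?Q))"
      using disj_list_subset[OF d, of "lst ?Q"] disj_list_subset[OF d, of "lst (P - ?Q)"] fP QP
      by (simp_all add: finite_subset)
    have "map ((!) ?Us) (unsh ?p I) = lst ?Q @ lst (P - ?Q)"
      unfolding selI[symmetric] selJ[symmetric] by (simp add: unsh_def sel_def)
    then have "even (kl e (lst ?Q @ lst (P - ?Q))) = even (kl e ?Us + koszul_exp ?ds (unsh ?p I))"
      using kl_perm[OF d, of "unsh ?p I" e] unsh_perms[OF I(1)] len by simp
    moreover have "kl e (lst ?Q @ lst (P - ?Q)) = kl e (lst ?Q) + kl e (lst (P - ?Q)) + ksg e (\<Union>?Q) (\<Union>(P - ?Q))"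
      using kl_append_Union[OF dQ] fP QP by (simp add: fI)
    ultimately show "?t ?Q = ?g I"
      unfolding asI asJ cI cJ signed_signed by (intro signed_cong) (simp only:)
  qed
  also have "\<dots> = (\<Sum>i=1..?p. \<Sum>I\<in>{I. I \<subseteq> {0..<?p} \<and> card I = i}. ?g I)"
    by (rule sum_by_card(1)[symmetric])
  also have "\<dots> = signed (kl e ?Us) (\<Sum>i=1..?p. \<Sum>I\<in>{I. I \<subseteq> {0..<?p} \<and> card I = i}.
      signed (koszul_exp ?ds (unsh ?p I)) (mu (?p - i + 1) (mu i (sel ?as I) # sel ?as ({0..<?p} - I))))"
    unfolding signed_sum by (intro sum.cong refl) auto
  also have "\<dots> = 0"
  proof -
    have "?as \<noteq> []" using P(2) fP by (metis map_is_Nil_conv set_empty set_lst)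
    then show ?thesis using mu_linf[OF l2, of ?p] len by simp
  qed
  finally show ?thesis .
qed

text \<open>Summing the relation over all partitions and regrouping by the set \<open>V\<close>
  under the inner bracket yields \<open>dF(T) + \<delta> F(T) = 0\<close>. The inner value has
  shifted degree \<open>sum e V + 1\<close>; moving it from the first slot to the last costs
  \<open>(sum e V + 1) * sum e (S - V)\<close>, and \<open>ksg_swap\<close> reduces the total to the
  exponent shown.\<close>

lemma F_linf:
  assumes S: "finite S" "S \<noteq> {}" and T: "hom e T S"
  shows "mu 1 [F e T S] + (\<Sum>V\<in>{V. V \<subseteq> S \<and> V \<noteq> {}}.
     signed (ksg e (S - V) V + sum e (S - V)) (lop e T (S - V) (F e T V))) = 0"
proof -
  define mQ where "mQ Q = mu (card Q) (map T (lst Q))" for Q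
  define t where "t Q R = signed (kl e (lst Q) + kl e (lst R) + ksg e (\<Union>Q) (\<Union>R))
        (mu (card R + 1) (mQ Q # map T (lst R)))" for Q R
  have fin: "finite V" if "V \<subseteq> S" for V using that S(1) by (rule finite_subset)
  have F: "F e T V = (\<Sum>Q\<in>{Q. partition_on V Q \<and> Q \<noteq> {}}. signed (kl e (lst Q)) (mQ Q))" if "V \<subseteq> S" for V
    unfolding F_def mup_def mQ_def
    using partition_finite[OF fin[OF that]] by (intro sum.cong refl) auto
  have main: "(\<Sum>Q\<in>{Q. partition_on V Q \<and> Q \<noteq> {}}. \<Sum>R\<in>{R. partition_on (S - V) R}. t Q R) =
      signed (ksg e (S - V) V + sum e (S - V)) (lop e T (S - V) (F e T V))"
    if V: "V \<subseteq> S" "V \<noteq> {}" "V \<noteq> S" for V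
  proof -
    let ?W = "S - V"
    have W: "?W \<noteq> {}" "finite ?W" using V S by auto
    have A: "is_additive (lop e T ?W)" by (rule lop_additive[OF W(2)])
    have "signed (ksg e ?W V + sum e ?W) (lop e T ?W (F e T V)) =
       (\<Sum>Q\<in>{Q. partition_on V Q \<and> Q \<noteq> {}}. signed (ksg e ?W V + sum e ?W) (signed (kl e (lst Q)) (lop e T ?W (mQ Q))))"
      unfolding F[OF V(1)] is_additive_sum[OF A] is_additive_signed[OF A] signed_sum ..
    also have "\<dots> = (\<Sum>Q\<in>{Q. partition_on V Q \<and> Q \<noteq> {}}. \<Sum>R\<in>{R. partition_on ?W R}. t Q R)"
    proof (rule sum.cong[OF refl], clarify)
      fix Q assume Q: "partition_on V Q" "Q \<noteq> {}"
      have fQ: "finite Q" using fin[OF V(1)] Q(1) by (rule partition_finite)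
      have uQ: "\<Union>Q = V" using Q by (simp add: partition_on_def)
      have mQ: "mQ Q \<in> G (sum e V + 1 - s)"
      proof -
        have "mup e T (lst Q) \<in> G (sum e V + 1 - s)"
          by (rule mup_deg[OF fin[OF V(1)] Q]) (rule hom_block[OF T Q(1) V(1)])
        then have "signed (kl e (lst Q)) (mup e T (lst Q)) \<in> G (sum e V + 1 - s)" by (rule G_signed)
        moreover have "signed (kl e (lst Q)) (mup e T (lst Q)) = mQ Q"
          unfolding mup_def mQ_def using fQ by (simp add: signed_def)
        ultimately show ?thesis by simp
      qed
      have eq: "{R. partition_on ?W R} = {R. partition_on ?W R \<and> R \<noteq> {}}"
        using W by (auto simp: partition_on_def)
      show "signed (ksg e ?W V + sum e ?W) (signed (kl e (lst Q)) (lop e T ?W (mQ Q))) =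
         (\<Sum>R\<in>{R. partition_on ?W R}. t Q R)"
        unfolding lop_def signed_sum eq
      proof (rule sum.cong[OF refl], clarify)
        fix R assume R: "partition_on ?W R" "R \<noteq> {}"
        have fR: "finite R" using W(2) R(1) by (rule partition_finite)
        have uR: "\<Union>R = ?W" using R by (simp add: partition_on_def)
        have "list_all2 (\<lambda>a d. a \<in> G (d - s)) (map T (lst R)) (map (sum e) (lst R))"
          by (rule list_all2_blocks) (use fR hom_block[OF T R(1)] in auto)
        then have "mu (card R + 1) (mQ Q # map T (lst R)) =
          signed ((sum e V + 1) * sum e ?W) (mu (card R + 1) (map T (lst R) @ [mQ Q]))"
          using mu_move_first[OF mQ, of "map T (lst R)" _ "card R + 1"] fR
          by (simp add: partition_sum_blocks[OF W(2) R(1), of e])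
        then have t: "t Q R = signed (kl e (lst Q) + kl e (lst R) + ksg e V ?W + (sum e V + 1) * sum e ?W)
            (mu (card R + 1) (map T (lst R) @ [mQ Q]))"
          unfolding t_def uQ uR by simp
        have k: "ksg e V ?W + ksg e ?W V = sum e V * sum e ?W"
          by (rule ksg_swap) (use V W fin in auto)
        have "(sum e V + 1) * sum e ?W = ksg e V ?W + ksg e ?W V + sum e ?W"
          unfolding k by (simp add: algebra_simps)
        then show "signed (ksg e ?W V + sum e ?W) (signed (kl e (lst Q)) (signed (kl e (lst R))
            (mu (card R + 1) (map T (lst R) @ [mQ Q])))) = t Q R"
          unfolding t signed_signed by (intro signed_cong) auto
      qed
    qed
    finally show ?thesis by simp
  qed
  have "(\<Sum>V\<in>{V. V \<subseteq> S \<and> V \<noteq> {}}. \<Sum>Q\<in>{Q. partition_on V Q \<and> Q \<noteq> {}}. \<Sum>R\<in>{R. partition_on (S - V) R}. t Q R) =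
     (\<Sum>P\<in>{P. partition_on S P \<and> P \<noteq> {}}. \<Sum>Q\<in>{Q. Q \<subseteq> P \<and> Q \<noteq> {}}. t Q (P - Q))"
    by (rule sum_partitions_subsets[OF S(1), symmetric])
  also have "\<dots> = 0"
    using sum_F_subsets_zero[OF S(1) _ _ T] unfolding t_def mQ_def by (intro sum.neutral) auto
  finally have zero: "(\<Sum>V\<in>{V. V \<subseteq> S \<and> V \<noteq> {}}. \<Sum>Q\<in>{Q. partition_on V Q \<and> Q \<noteq> {}}. \<Sum>R\<in>{R. partition_on (S - V) R}. t Q R) = 0" .
  \<comment> \<open>For \<open>V = S\<close> there is no outer block: this summand is the linear
    bracket, which \<open>lop\<close> leaves out.\<close>
  have full: "(\<Sum>Q\<in>{Q. partition_on S Q \<and> Q \<noteq> {}}. \<Sum>R\<in>{R. partition_on (S - S) R}. t Q R) = mu 1 [F e T S]"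
    unfolding F[OF subset_refl] is_additive_sum[OF mu_1_additive]
    by (simp add: partition_on_empty_iff t_def is_additive_signed[OF mu_1_additive, simplified])
  have fS: "finite {V. V \<subseteq> S \<and> V \<noteq> {}}" using S(1) by simp
  have mem: "S \<in> {V. V \<subseteq> S \<and> V \<noteq> {}}" using S by simp
  have rest: "(\<Sum>V\<in>{V. V \<subseteq> S \<and> V \<noteq> {}} - {S}. \<Sum>Q\<in>{Q. partition_on V Q \<and> Q \<noteq> {}}. \<Sum>R\<in>{R. partition_on (S - V) R}. t Q R) =
      (\<Sum>V\<in>{V. V \<subseteq> S \<and> V \<noteq> {}} - {S}. signed (ksg e (S - V) V + sum e (S - V)) (lop e T (S - V) (F e T V)))"
    by (rule sum.cong[OF refl], rule main) auto
  show ?thesis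
    using zero unfolding sum.remove[OF fS mem] full rest by simp
qed

end

text \<open>In \<open>mu_der\<close> the product lives on the unshifted space, so \<open>b\<close>
  counts with its unshifted degree \<open>r\<close>; \<open>1 + sum_list ds\<close> is the degree of
  the operator that inserts into the last slot, all brackets having degree 1 after the
  shift.\<close>

locale poisson_brackets = sym_brackets +
  fixes m :: "'a \<Rightarrow> 'a \<Rightarrow> 'a"
  assumes m_add_left: "m (x + y) z = m x z + m y z"
    and m_add_right: "m x (y + z) = m x y + m x z"
    and m_deg: "x \<in> G i \<Longrightarrow> y \<in> G j \<Longrightarrow> m x y \<in> G (i + j)"
    and mu_der: "list_all2 (\<lambda>a d. a \<in> G (d - s)) as ds \<Longrightarrow> length as = n \<Longrightarrow> b \<in> G r \<Longrightarrow>
        mu (Suc n) (as @ [m b c]) = m (mu (Suc n) (as @ [b])) c +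
          signed (r * (1 + sum_list ds)) (m b (mu (Suc n) (as @ [c])))"
begin

lemma m_additive: "is_additive (\<lambda>x. m x z)" "is_additive (m x)"
  by (simp_all add: is_additive_def m_add_left m_add_right)

lemma lop_der:
  assumes T: "hom e T W" and b: "b \<in> G r"
  shows "lop e T W (m b c) = m (lop e T W b) c + signed (r * (1 + sum e W)) (m b (lop e T W c))"
  unfolding lop_def is_additive_sum[OF m_additive(1)] is_additive_sum[OF m_additive(2)]
    signed_sum sum.distrib[symmetric]
proof (rule sum.cong[OF refl], clarify)
  fix P assume P: "partition_on W P"
  have W: "finite W" using T by (simp add: hom_def)
  have fP: "finite P" using W P by (rule partition_finite)
  have "list_all2 (\<lambda>a d. a \<in> G (d - s)) (map T (lst P)) (map (sum e) (lst P))"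
    by (rule list_all2_blocks) (use T fP partition_block[OF P] in \<open>auto simp: hom_def\<close>)
  from mu_der[OF this _ b, of "card P" c] fP
  show "signed (kl e (lst P)) (mu (card P + 1) (map T (lst P) @ [m b c])) =
     m (signed (kl e (lst P)) (mu (card P + 1) (map T (lst P) @ [b]))) c +
     signed (r * (1 + sum e W)) (m b (signed (kl e (lst P)) (mu (card P + 1) (map T (lst P) @ [c]))))"
    by (simp add: partition_sum_blocks[OF W P] signed_add add.commute
        is_additive_signed[OF m_additive(1)] is_additive_signed[OF m_additive(2)])
qed

text \<open>Product of set functions, where \<open>Y U\<close> has degree \<open>r + sum e U\<close>.\<close>
definition conv :: "(nat \<Rightarrow> int) \<Rightarrow> int \<Rightarrow> (nat set \<Rightarrow> 'a) \<Rightarrow> (nat set \<Rightarrow> 'a) \<Rightarrow> nat set \<Rightarrow> 'a" where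
  "conv e r Y Z S = (\<Sum>U\<in>Pow S. signed (ksg e U (S - U) + r * sum e (S - U)) (m (Y U) (Z (S - U))))"

text \<open>The Leibniz rule in the last slot, summed over decompositions into parts
  \<open>V\<close> for \<open>Y\<close>, \<open>W\<close> for \<open>Z\<close> and \<open>X\<close>
  for the brackets. In the first half \<open>X\<close> is regrouped with \<open>V\<close>. In the
  second the brackets pass \<open>Y V\<close>; the cost \<open>sum e V * sum e X\<close> is traded
  by \<open>ksg_swap\<close> for the order of \<open>V\<close> and \<open>X\<close>, and
  \<open>r + sum e U\<close> is left, the degree of \<open>Y U\<close> passed by an odd
  operator.\<close>

lemma d0_conv:
  assumes T: "hom e T S" and Y: "\<And>U. U \<subseteq> S \<Longrightarrow> Y U \<in> G (r + sum e U)"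
  shows "d0 e T (conv e r Y Z) S =
    (\<Sum>U\<in>Pow S. signed (ksg e U (S - U) + r * sum e (S - U))
       (m (d0 e T Y U) (Z (S - U)) + signed (r + sum e U) (m (Y U) (d0 e T Z (S - U)))))"
proof -
  have S: "finite S" using T by (simp add: hom_def)
  let ?a = "\<lambda>V W X. signed (ksg e X (V \<union> W) + (ksg e V W + r * sum e W)) (m (lop e T X (Y V)) (Z W))"
  let ?a' = "\<lambda>V X W. signed (ksg e (V \<union> X) W + r * sum e W + ksg e X V) (m (lop e T X (Y V)) (Z W))"
  let ?b = "\<lambda>V W X. signed (ksg e X (V \<union> W) + (ksg e V W + r * sum e W) + (r + sum e V) * (1 + sum e X))
     (m (Y V) (lop e T X (Z W)))"
  let ?b' = "\<lambda>V W X. signed (ksg e V (W \<union> X) + r * sum e (W \<union> X) + (r + sum e V) + ksg e X W)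
     (m (Y V) (lop e T X (Z W)))"
  have "d0 e T (conv e r Y Z) S = (\<Sum>U\<in>Pow S. \<Sum>V\<in>Pow U. ?a V (U - V) (S - U) + ?b V (U - V) (S - U))"
    unfolding d0_def
  proof (rule sum.cong[OF refl])
    fix U assume U: "U \<in> Pow S"
    have A: "is_additive (lop e T (S - U))" using S by (simp add: lop_additive)
    show "signed (ksg e (S - U) U) (lop e T (S - U) (conv e r Y Z U)) =
       (\<Sum>V\<in>Pow U. ?a V (U - V) (S - U) + ?b V (U - V) (S - U))"
      unfolding conv_def is_additive_sum[OF A] signed_sum is_additive_signed[OF A]
    proof (rule sum.cong[OF refl])
      fix V assume V: "V \<in> Pow U"
      have "Y V \<in> G (r + sum e V)" using Y U V by auto
      from lop_der[OF hom_subset[OF T, of "S - U"] this, of "Z (U - V)"]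
      show "signed (ksg e (S - U) U) (signed (ksg e V (U - V) + r * sum e (U - V)) (lop e T (S - U) (m (Y V) (Z (U - V))))) =
         ?a V (U - V) (S - U) + ?b V (U - V) (S - U)"
        using V by (simp add: signed_add Un_absorb1 add.assoc)
    qed
  qed
  also have "\<dots> = tri ?a S + tri ?b S"
    by (simp only: sum.distrib tri_eq[OF S, of ?a] tri_eq[OF S, of ?b])
  also have "tri ?a S = tri ?a' S"
  proof -
    have "tri ?a S = tri (\<lambda>V X W. ?a V W X) S" by (rule tri_swap[symmetric])
    also have "\<dots> = tri ?a' S"
    proof (rule tri_cong)
      fix V X W assume a: "V \<union> X \<union> W = S" "V \<inter> X = {}" "V \<inter> W = {}" "X \<inter> W = {}"
      then have fin: "finite V" "finite W" "finite X" using S by (auto intro: finite_subset)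
      have "W \<inter> X = {}" "W \<inter> V = {}" "X \<inter> V = {}" using a by auto
      then show "?a V W X = ?a' V X W"
        using a by (intro signed_cong) (simp add: ksg_Un_left ksg_Un_right fin, argo)
    qed
    finally show ?thesis .
  qed
  also have "tri ?b S = tri ?b' S"
  proof (rule tri_cong)
    fix V W X assume a: "V \<union> W \<union> X = S" "V \<inter> W = {}" "V \<inter> X = {}" "W \<inter> X = {}"
    then have fin: "finite V" "finite W" "finite X" using S by (auto intro: finite_subset)
    have k: "ksg e V X + ksg e X V = sum e V * sum e X" by (rule ksg_swap) (use fin a in auto)
    have "even (ksg e V X + ksg e X V) = (even (sum e V) \<or> even (sum e X))" unfolding k by simp
    then show "?b V W X = ?b' V W X"
      using a by (intro signed_cong) (simp add: ksg_Un_left ksg_Un_right sum.union_disjoint fin, argo)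
  qed
  also have "tri ?a' S = (\<Sum>U\<in>Pow S. signed (ksg e U (S - U) + r * sum e (S - U)) (m (d0 e T Y U) (Z (S - U))))"
    unfolding tri_eq[OF S, symmetric] d0_def is_additive_sum[OF m_additive(1)]
      is_additive_signed[OF m_additive(1)] signed_sum signed_signed
    by (intro sum.cong refl) (auto simp: Un_absorb1)
  also have "tri ?b' S = (\<Sum>U\<in>Pow S. signed (ksg e U (S - U) + r * sum e (S - U))
       (signed (r + sum e U) (m (Y U) (d0 e T Z (S - U)))))"
    unfolding tri_def d0_def is_additive_sum[OF m_additive(2)]
      is_additive_signed[OF m_additive(2)] signed_sum signed_signed
    by (intro sum.cong refl) (auto simp: Un_absorb1 add.assoc)
  finally show ?thesis by (simp add: signed_add sum.distrib)
qed

end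

section \<open>Decalage\<close>

lemma graded_space_0: "graded_space sm G \<Longrightarrow> 0 \<in> G i"
  and graded_space_add: "graded_space sm G \<Longrightarrow> x \<in> G i \<Longrightarrow> y \<in> G i \<Longrightarrow> x + y \<in> G i"
  by (simp_all add: graded_space_def)

lemma graded_space_minus:
  assumes "graded_space sm G" "x \<in> G i"
  shows "- x \<in> G i"
proof -
  have add: "sm (c + d) x = sm c x + sm d x" and one: "sm 1 x = x" for c d
    using assms(1) by (simp_all add: graded_space_def)
  have "sm 0 x = 0" using add[of 0 0] by simp
  then have "sm (- 1) x = - x" using add[of "- 1" 1] one by (simp add: eq_neg_iff_add_eq_0)
  moreover have "sm (- 1) x \<in> G i" using assms by (simp add: graded_space_def)
  ultimately show ?thesis by simp
qed

lemma graded_space_graded_group: "graded_space sm G \<Longrightarrow> graded_group G"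
  by unfold_locales (auto intro: graded_space_0 graded_space_add graded_space_minus)

lemma graded_space_degree_unique:
  assumes G: "graded_space sm G" and x: "x \<in> G i" "x \<in> G j" "x \<noteq> 0"
  shows "i = j"
proof -
  define Q where "Q g \<longleftrightarrow> finite {i. g i \<noteq> 0} \<and> (\<forall>i. g i \<in> G i) \<and> x = (\<Sum>i\<in>{i. g i \<noteq> 0}. g i)" for g
  have Q: "Q (\<lambda>l. if l = a then x else 0)" if "x \<in> G a" for a
  proof -
    have "{l. (if l = a then x else 0) \<noteq> 0} = {a}" using x(3) by auto
    then show ?thesis using that graded_space_0[OF G] by (simp add: Q_def)
  qed
  have "\<exists>!g. Q g" using G by (simp only: graded_space_def Q_def)
  then have "(\<lambda>l. if l = i then x else 0) = (\<lambda>l. if l = j then x else 0)"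
    using Q[OF x(1)] Q[OF x(2)] by blast
  from fun_cong[OF this, of i] show ?thesis using x(3) by (simp split: if_splits)
qed

lemma graded_space_induct [consumes 1, case_names homogeneous add]:
  assumes "graded_space sm G" "\<And>i x. x \<in> G i \<Longrightarrow> P x" "\<And>x y. P x \<Longrightarrow> P y \<Longrightarrow> P (x + y)"
  shows "P x"
proof -
  obtain g where g: "\<And>i. g i \<in> G i" "x = (\<Sum>i\<in>{i. g i \<noteq> 0}. g i)"
  proof -
    have "\<exists>!g. finite {i. g i \<noteq> 0} \<and> (\<forall>i. g i \<in> G i) \<and> x = (\<Sum>i\<in>{i. g i \<noteq> 0}. g i)"
      using assms(1) by (simp only: graded_space_def)
    then obtain g where "finite {i. g i \<noteq> 0} \<and> (\<forall>i. g i \<in> G i) \<and> x = (\<Sum>i\<in>{i. g i \<noteq> 0}. g i)"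
      by (rule ex1E)
    then show ?thesis by (intro that[of g]) (elim conjE; blast)+
  qed
  have "P (\<Sum>i\<in>I. g i)" for I
    by (induction I rule: infinite_finite_induct)
      (auto intro: assms(2,3) g(1) assms(2)[OF graded_space_0[OF assms(1)]])
  then show ?thesis using g(2) by simp
qed

lemma graded_comm_algD:
  assumes "graded_comm_alg sm G m"
  shows "graded_space sm G" "m (x + y) z = m x z + m y z" "m x (y + z) = m x y + m x z"
    "x \<in> G i \<Longrightarrow> y \<in> G j \<Longrightarrow> m x y \<in> G (i + j)"
    "x \<in> G i \<Longrightarrow> y \<in> G j \<Longrightarrow> m y x = signed (i * j) (m x y)"
proof -
  note D = assms[unfolded graded_comm_alg_def]
  show "graded_space sm G" using D by (rule conjunct1)
  note add = D[THEN conjunct2, THEN conjunct2, THEN conjunct1, rule_format]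
  show "m (x + y) z = m x z + m y z" using add by (rule conjunct1)
  show "m x (y + z) = m x y + m x z" using add by (rule conjunct2)
  note deg = D[THEN conjunct2, THEN conjunct2, THEN conjunct2, THEN conjunct2, rule_format]
  show "m x y \<in> G (i + j)" if "x \<in> G i" "y \<in> G j" using deg[OF that] by (rule conjunct1)
  show "m y x = signed (i * j) (m x y)" if "x \<in> G i" "y \<in> G j" using deg[OF that] by (rule conjunct2)
qed

lemma deg_eq: "graded_space sm G \<Longrightarrow> x \<in> G i \<Longrightarrow> x \<noteq> 0 \<Longrightarrow> deg G x = i"
  unfolding deg_def by (rule some_equality) (auto intro: graded_space_degree_unique)

lemma in_deg: "homog G x \<Longrightarrow> x \<in> G (deg G x)"
  unfolding deg_def homog_def by (rule someI_ex)

lemma multilinear_additive: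
  assumes "multilinear smA smB n f" "n = Suc (length as + length bs)"
  shows "is_additive (\<lambda>y. f (as @ y # bs))"
proof (rule is_additiveI)
  fix y z
  have "(as @ y # bs)[length as := w] = as @ w # bs" for w by simp
  then show "f (as @ (y + z) # bs) = f (as @ y # bs) + f (as @ z # bs)"
    using assms unfolding multilinear_def
    by (metis add_Suc_right length_Cons length_append less_add_Suc1)
qed

lemma multilinear_zero:
  assumes "multilinear smA smB n f" "length xs = n" "0 \<in> set xs"
  shows "f xs = 0"
proof -
  obtain as bs where xs: "xs = as @ 0 # bs" using assms(3) by (meson split_list)
  then show ?thesis using is_additive_0[OF multilinear_additive[OF assms(1), of as bs]] assms(2) by simp
qed

text \<open>Position \<open>i\<close> precedes \<open>n - 1 - i\<close> others. The decalage weight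
  thus becomes a sum over ordered pairs, to which \<open>pair_sum_perm\<close> applies.\<close>

lemma pair_sum_weights:
  fixes E :: "nat \<Rightarrow> int"
  shows "(\<Sum>i<n. \<Sum>j<n. if i < j then E i else 0) = (\<Sum>i<n. int (n - 1 - i) * E i)"
proof (rule sum.cong[OF refl])
  fix i assume "i \<in> {..<n}"
  have "(\<Sum>j<n. if i < j then E i else 0) = (\<Sum>j\<in>{Suc i..<n}. E i)"
    by (rule sum.mono_neutral_cong_right) auto
  then show "(\<Sum>j<n. if i < j then E i else 0) = int (n - 1 - i) * E i" by simp
qed

text \<open>An inversion changes the decalage exponent by the difference of the degrees
  \<open>x\<close> and \<open>y\<close> involved and contributes
  \<open>(x + 1) * (y + 1) + 1\<close> to the antisymmetric one; together this is
  \<open>x * y\<close> modulo 2.\<close>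

lemma dec_sign:
  fixes E :: "int list"
  assumes ps: "ps \<in> perms n" and E: "length E = n"
  shows "even ((\<Sum>i<n. int (n - 1 - i) * E ! (ps ! i)) + anti_exp (map (\<lambda>x. x + 1) E) ps + (\<Sum>i<n. int (n - 1 - i) * E ! i)) =
    even (koszul_exp E ps)"
proof -
  let ?W = "\<Sum>i<n. int (n - 1 - i) * E ! i"
  let ?I = "inversions ps"
  have len: "length ps = n" using ps by (rule perms_length)
  have lt: "ps ! a < n" if "a < n" for a
    using ps len nth_mem[of a ps] that by (auto simp: perms_def)
  have fI: "finite ?I"
    by (rule finite_subset[of _ "{..<n} \<times> {..<n}"]) (auto simp: inversions_def len)
  have 1: "(\<Sum>i<n. int (n - 1 - i) * E ! (ps ! i)) = ?W + (\<Sum>(a, b)\<in>?I. E ! (ps ! a) - E ! (ps ! b))"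
    using pair_sum_perm[OF ps, of "\<lambda>i j. E ! i"] unfolding pair_sum_weights[of _ n] .
  have "anti_exp (map (\<lambda>x. x + 1) E) ps = (\<Sum>(a, b)\<in>?I. (E ! (ps ! a) + 1) * (E ! (ps ! b) + 1) + 1)"
    unfolding anti_exp_def koszul_exp_def split_def sum.distrib
    by (simp, intro sum.cong refl) (auto simp: inversions_def len E lt)
  then have "(\<Sum>i<n. int (n - 1 - i) * E ! (ps ! i)) + anti_exp (map (\<lambda>x. x + 1) E) ps + ?W =
     2 * ?W + (\<Sum>(a, b)\<in>?I. (E ! (ps ! a) - E ! (ps ! b)) + ((E ! (ps ! a) + 1) * (E ! (ps ! b) + 1) + 1))"
    unfolding 1 by (simp add: split_def sum.distrib)
  also have "(\<Sum>(a, b)\<in>?I. (E ! (ps ! a) - E ! (ps ! b)) + ((E ! (ps ! a) + 1) * (E ! (ps ! b) + 1) + 1)) =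
      (\<Sum>(a, b)\<in>?I. E ! (ps ! a) * E ! (ps ! b) + 2 * (E ! (ps ! a) + 1))"
    by (intro sum.cong refl) (auto simp: algebra_simps)
  also have "\<dots> = koszul_exp E ps + 2 * (\<Sum>(a, b)\<in>?I. E ! (ps ! a) + 1)"
    unfolding koszul_exp_def split_def sum_distrib_left by (rule sum.distrib)
  finally show ?thesis by simp
qed

lemma sdegs_nth [simp]: "i < length xs \<Longrightarrow> sdegs G s xs ! i = deg G (xs ! i) + s"
  by (simp add: sdegs_def)

lemma length_sdegs [simp]: "length (sdegs G s xs) = length xs"
  by (simp add: sdegs_def)

lemma dec_perm_sign:
  assumes ps: "ps \<in> perms n" and xs: "length xs = n"
  shows "even ((\<Sum>i<n. int (n - 1 - i) * (deg G (map ((!) xs) ps ! i) + k - 1)) +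
      anti_exp (sdegs G k xs) ps + (\<Sum>i<n. int (n - 1 - i) * (deg G (xs ! i) + k - 1))) =
    even (koszul_exp (sdegs G (k - 1) xs) ps)"
proof -
  have len: "length ps = n" using ps by (rule perms_length)
  have lt: "ps ! a < n" if "a < n" for a
    using ps len nth_mem[of a ps] that by (auto simp: perms_def)
  have "map (\<lambda>x. x + 1) (sdegs G (k - 1) xs) = sdegs G k xs" by (simp add: sdegs_def)
  then show ?thesis using dec_sign[OF ps, of "sdegs G (k - 1) xs"] xs len lt
    by (simp add: add_diff_eq cong: sum.cong_simp)
qed

lemma dec_zero:
  "multilinear sm sm n (lam n) \<Longrightarrow> length xs = n \<Longrightarrow> 0 \<in> set xs \<Longrightarrow> dec k G lam n xs = 0"
  by (simp add: dec_def multilinear_zero)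

text \<open>The last slot has weight 0, so the sign does not see the degree of \<open>y\<close>;
  this gives additivity in that slot even across degrees.\<close>

lemma dec_snoc:
  "length as = n \<Longrightarrow> dec k G lam (Suc n) (as @ [y]) =
    signed (\<Sum>i<n. int (n - i) * (deg G (as ! i) + k - 1)) (lam (Suc n) (as @ [y]))"
  by (simp add: dec_def nth_append)

lemma homogeneous_degrees:
  assumes "graded_space sm G" "list_all2 (\<lambda>a d. a \<in> G (d - s)) as ds" "0 \<notin> set as"
  shows "map (deg G) as = map (\<lambda>d. d - s) ds"
proof (rule nth_equalityI)
  show "length (map (deg G) as) = length (map (\<lambda>d. d - s) ds)"
    using list_all2_lengthD[OF assms(2)] by simp
  fix i assume "i < length (map (deg G) as)"
  moreover from this have "as ! i \<noteq> 0" using assms(3) by (metis length_map nth_mem)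
  ultimately show "map (deg G) as ! i = map (\<lambda>d. d - s) ds ! i"
    using assms by (auto simp: list_all2_conv_all_nth intro!: deg_eq)
qed

lemma homogeneous_sdegs:
  assumes "graded_space sm G" "list_all2 (\<lambda>a d. a \<in> G (d - s)) as ds" "0 \<notin> set as"
  shows "ds = sdegs G s as"
proof -
  have "map (\<lambda>d. d + s) (map (deg G) as) = map (\<lambda>d. d + s) (map (\<lambda>d. d - s) ds)"
    by (simp only: homogeneous_degrees[OF assms])
  then show ?thesis by (simp add: sdegs_def o_def)
qed

lemma sum_list_shift: "(\<Sum>d\<leftarrow>ds. d - c) = sum_list ds - int (length ds) * c"
  by (induction ds) (simp_all add: algebra_simps)

lemma list_all2_homog: "list_all2 (\<lambda>a d. a \<in> G (d - s)) as ds \<Longrightarrow> list_all (homog G) as"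
  by (auto simp: list_all2_conv_all_nth list_all_length homog_def)

text \<open>Away from 0 the given degrees are those returned by \<open>deg\<close>, and each
  property is a translation of signs. A list containing 0 may be assigned arbitrary degrees; there
  both sides vanish by multilinearity, whence the recurring case distinction.\<close>

lemma dec_poisson_brackets:
  fixes sm :: "'k::field \<Rightarrow> 'a::ab_group_add \<Rightarrow> 'a"
  assumes dp: "derived_poisson k sm G m lam"
  shows "poisson_brackets G (k - 1) (dec k G lam) m"
proof -
  note D = dp[unfolded derived_poisson_def]
  note alg = D[THEN conjunct1]
    and lam_multilinear = D[THEN conjunct2, THEN conjunct1, rule_format]
    and lam_perm = D[THEN conjunct2, THEN conjunct2, THEN conjunct1, rule_format]
    and lam_linf = D[THEN conjunct2, THEN conjunct2, THEN conjunct2, THEN conjunct1]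
    and lam_der = D[THEN conjunct2, THEN conjunct2, THEN conjunct2, THEN conjunct2, rule_format]
  have gs: "graded_space sm G"
    using alg by (rule graded_comm_algD)
  interpret graded_group G using gs by (rule graded_space_graded_group)
  have ml: "multilinear sm sm n (lam n)" if "n \<ge> 1" for n
    using lam_multilinear[OF that] by (rule conjunct1)
  have madd: "m (x + y) z = m x z + m y z" "m x (y + z) = m x y + m x z" for x y z
    using graded_comm_algD[OF alg] by blast+
  have m0: "m 0 z = 0" "m z 0 = 0" for z
    using madd(1)[of 0 0 z] madd(2)[of z 0 0] by simp_all
  show ?thesis
  proof
    fix as :: "'a list" and y z and n :: nat assume n: "length as = n"
    have "is_additive (\<lambda>y. lam (Suc n) (as @ [y]))"
      by (rule multilinear_additive[OF ml]) (use n in auto)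
    from is_additive_add[OF this] show "dec k G lam (Suc n) (as @ [y + z]) = dec k G lam (Suc n) (as @ [y]) + dec k G lam (Suc n) (as @ [z])"
      by (simp only: dec_snoc[OF n] signed_add)
  next
    fix as :: "'a list" and x bs and n :: nat assume h: "list_all (homog G) (as @ x # bs)" and n: "n = Suc (length as + length bs)"
    have "homog G x" using h by simp
    then have "deg G (- x) = deg G x"
      using deg_eq[OF gs G_minus[OF in_deg]] by (cases "x = 0") simp_all
    then have "deg G ((as @ - x # bs) ! i) = deg G ((as @ x # bs) ! i)" for i
      by (simp add: nth_append nth_Cons split: nat.split)
    moreover have "lam n (as @ - x # bs) = - lam n (as @ x # bs)"
      by (rule is_additive_minus[OF multilinear_additive[OF ml]]) (use n in auto)
    ultimately show "dec k G lam n (as @ - x # bs) = - dec k G lam n (as @ x # bs)"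
      by (simp add: dec_def signed_minus)
  next
    fix as :: "'a list" and ds and n :: nat
    assume l2: "list_all2 (\<lambda>a d. a \<in> G (d - (k - 1))) as ds" and ne: "as \<noteq> []" and n: "n = length as"
    have len: "length ds = n" using list_all2_lengthD[OF l2] n by simp
    have n1: "n \<ge> 1" using ne n by (simp add: Suc_le_eq)
    have "graded_mult G G n (k * (int n - 1) + 2 - int n) (lam n)"
      using lam_multilinear[OF n1] by (rule conjunct2)
    then have "lam n as \<in> G (sum_list (map (\<lambda>d. d - (k - 1)) ds) + (k * (int n - 1) + 2 - int n))"
      unfolding graded_mult_def using l2 len n by (auto simp: list_all2_conv_all_nth)
    moreover have "sum_list (map (\<lambda>d. d - (k - 1)) ds) = sum_list ds - int n * (k - 1)"
      using len by (simp add: sum_list_shift)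
    ultimately have "lam n as \<in> G (sum_list ds + 1 - (k - 1))" by (simp add: algebra_simps)
    then show "dec k G lam n as \<in> G (sum_list ds + 1 - (k - 1))"
      unfolding dec_def by (rule G_signed)
  next
    fix as :: "'a list" and ds ps and n :: nat
    assume l2: "list_all2 (\<lambda>a d. a \<in> G (d - (k - 1))) as ds" and ne: "as \<noteq> []" and n: "n = length as"
      and ps: "ps \<in> perms n"
    have n1: "n \<ge> 1" using ne n by (simp add: Suc_le_eq)
    have len: "length ps = n" using ps by (rule perms_length)
    show "dec k G lam n (map ((!) as) ps) = signed (koszul_exp ds ps) (dec k G lam n as)"
    proof (cases "0 \<in> set as")
      case True
      have "set (map ((!) as) ps) = set as"
        using ps n by (auto simp: perms_def in_set_conv_nth)
      then show ?thesis using True dec_zero[of sm n lam, OF ml[OF n1]] n len by simp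
    next
      case False
      have ds: "ds = sdegs G (k - 1) as"
        by (rule homogeneous_sdegs[OF gs l2 False])
      have "lam n (map ((!) as) ps) = signed (anti_exp (sdegs G k as) ps) (lam n as)"
        by (rule lam_perm[OF n1]) (use ps n list_all2_homog[OF l2] in auto)
      moreover have "even ((\<Sum>i<n. int (n - 1 - i) * (deg G (map ((!) as) ps ! i) + k - 1)) + anti_exp (sdegs G k as) ps) =
          even (koszul_exp ds ps + (\<Sum>i<n. int (n - 1 - i) * (deg G (as ! i) + k - 1)))"
        using dec_perm_sign[OF ps n[symmetric], of G k] unfolding ds even_add by argo
      ultimately show ?thesis unfolding dec_def by (simp only: signed_signed) (rule signed_cong)
    qed
  next
    fix as :: "'a list" and ds and n :: nat
    assume l2: "list_all2 (\<lambda>a d. a \<in> G (d - (k - 1))) as ds" and ne: "as \<noteq> []" and n: "n = length as"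
    have n1: "n \<ge> 1" using ne n by (simp add: Suc_le_eq)
    show "(\<Sum>i=1..n. \<Sum>S\<in>{S. S \<subseteq> {0..<n} \<and> card S = i}. signed (koszul_exp ds (unsh n S))
         (dec k G lam (n - i + 1) (dec k G lam i (sel as S) # sel as ({0..<n} - S)))) = 0"
    proof (cases "0 \<in> set as")
      case True
      then obtain j where j: "j < n" "as ! j = 0" using n by (auto simp: in_set_conv_nth)
      show ?thesis
      proof (intro sum.neutral ballI)
        fix i S assume i: "i \<in> {1..n}" and "S \<in> {S. S \<subseteq> {0..<n} \<and> card S = i}"
        then have S: "S \<subseteq> {0..<n}" "card S = i" by auto
        have fS: "finite S" using S(1) by (rule finite_subset) simp
        have l: "length (sel as S) = i" "length (sel as ({0..<n} - S)) = n - i"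
          using S fS by (simp_all add: sel_def card_Diff_subset)
        have "0 \<in> set (dec k G lam i (sel as S) # sel as ({0..<n} - S))"
        proof (cases "j \<in> S")
          case True
          then have "0 \<in> set (sel as S)" using fS j by (force simp: sel_def)
          then show ?thesis using dec_zero[of sm i lam "sel as S"] ml[of i] i l by simp
        next
          case False
          then have "0 \<in> set (sel as ({0..<n} - S))" using j by (force simp: sel_def)
          then show ?thesis by simp
        qed
        then show "signed (koszul_exp ds (unsh n S))
            (dec k G lam (n - i + 1) (dec k G lam i (sel as S) # sel as ({0..<n} - S))) = 0"
          using dec_zero[of sm "n - i + 1" lam, OF ml] l by simp
      qed
    next
      case False
      have ds: "ds = sdegs G (k - 1) as"
        by (rule homogeneous_sdegs[OF gs l2 False])
      show ?thesis unfolding ds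
        by (rule lam_linf[unfolded linf1_def, rule_format, OF n1]) (use n list_all2_homog[OF l2] in auto)
    qed
  next
    show "m (x + y) z = m x z + m y z" "m x (y + z) = m x y + m x z" for x y z by (rule madd)+
    show "x \<in> G i \<Longrightarrow> y \<in> G j \<Longrightarrow> m x y \<in> G (i + j)" for x y i j
      by (rule graded_comm_algD(4)[OF alg])
  next
    fix as :: "'a list" and ds b c r and n :: nat
    assume l2: "list_all2 (\<lambda>a d. a \<in> G (d - (k - 1))) as ds" and n: "length as = n" and b: "b \<in> G r"
    let ?l = "lam (Suc n)"
    have "?l (as @ [m b c]) = m (?l (as @ [b])) c + signed (r * (1 + sum_list ds)) (m b (?l (as @ [c])))"
    proof (cases "0 \<in> set as \<or> b = 0")
      case True
      then have "?l (as @ [b]) = 0" "?l (as @ [m b c]) = 0" "b = 0 \<or> ?l (as @ [c]) = 0"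
        using n by (auto intro!: multilinear_zero[OF ml] simp: m0)
      then show ?thesis by (auto simp: m0)
    next
      case False
      have "sum_list (map (deg G) as) = sum_list ds - int n * (k - 1)"
        using homogeneous_degrees[OF gs l2] False n list_all2_lengthD[OF l2]
        by (simp add: sum_list_shift)
      \<comment> \<open>The degree of the bracket with its first \<open>n\<close> slots filled,
        rewritten in shifted degrees: all multiples of \<open>k\<close> cancel.\<close>
      then have eq: "k * (int (Suc n) - 1) + 2 - int (Suc n) + sum_list (map (deg G) as) = 1 + sum_list ds"
        by (simp add: algebra_simps)
      have db: "deg G b = r" using deg_eq[OF gs b] False by simp
      have hb: "homog G b" using b by (auto simp: homog_def)
      have "?l (as @ [m b c]) = m (?l (as @ [b])) c +
          signed (deg G b * (k * (int (Suc n) - 1) + 2 - int (Suc n) + sum_list (map (deg G) as))) (m b (?l (as @ [c])))"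
        by (rule lam_der) (use n list_all2_homog[OF l2] hb in auto)
      then show ?thesis unfolding eq db .
    qed
    moreover have "m (signed d x) c = signed d (m x c)" "m b (signed d x) = signed d (m b x)" for d x
      by (rule is_additive_signed, simp add: is_additive_def madd)+
    ultimately show "dec k G lam (Suc n) (as @ [m b c]) = m (dec k G lam (Suc n) (as @ [b])) c +
        signed (r * (1 + sum_list ds)) (m b (dec k G lam (Suc n) (as @ [c])))"
      using n by (simp add: dec_snoc signed_add add.commute)
  qed
qed

section \<open>The transfer sums over set partitions\<close>

definition fibre :: "(nat \<Rightarrow> nat) \<Rightarrow> nat \<Rightarrow> nat \<Rightarrow> nat set" where
  "fibre c n j = {i. i < n \<and> c i = j}"

lemma blk_eq: "blk c n j = sorted_list_of_set (fibre c n j)"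
proof -
  have "sorted_list_of_set (set (blk c n j)) = blk c n j"
    unfolding blk_def by (rule sorted_list_of_set.idem_if_sorted_distinct) (auto intro: sorted_wrt_filter)
  moreover have "set (blk c n j) = fibre c n j" by (auto simp: blk_def fibre_def)
  ultimately show ?thesis by simp
qed

lemma finite_fibre [simp]: "finite (fibre c n j)"
  by (simp add: fibre_def)

lemma opart_fibres:
  assumes c: "c \<in> opart n p"
  defines "Us \<equiv> map (fibre c n) [0..<p]"
  shows "disj_list Us" "sorted (map Min Us)" "\<Union>(set Us) = {0..<n}" "partition_on {0..<n} (set Us)"
    "card (set Us) = p"
proof -
  have ne: "fibre c n j \<noteq> {}" if "j < p" for j
    using c that by (auto simp: opart_def fibre_def)
  have disj: "fibre c n i \<inter> fibre c n j = {}" if "i \<noteq> j" for i j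
    using that by (auto simp: fibre_def)
  have inj: "inj_on (fibre c n) {0..<p}"
    using ne disj by (intro inj_onI) (metis Int_absorb atLeastLessThan_iff)
  then have d: "distinct Us" by (simp add: Us_def distinct_map)
  show "disj_list Us"
    unfolding disj_list_def
  proof (intro conjI ballI disjointI)
    show "{} \<notin> set Us"
    proof
      assume "{} \<in> set Us"
      then obtain j where "j < p" "fibre c n j = {}" unfolding Us_def by force
      then show False using ne by blast
    qed
    fix U V assume UV: "U \<in> set Us" "V \<in> set Us" "U \<noteq> V"
    then obtain i j where "U = fibre c n i" "V = fibre c n j" by (auto simp: Us_def)
    then show "U \<inter> V = {}" using disj[of i j] UV by blast
  qed (use d in \<open>auto simp: Us_def\<close>)
  show u: "\<Union>(set Us) = {0..<n}"
    using c by (auto simp: Us_def opart_def fibre_def)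
  show "sorted (map Min Us)"
    unfolding sorted_iff_nth_Suc
  proof (intro allI impI)
    fix i assume "Suc i < length (map Min Us)"
    then have "Suc i < p" by (simp add: Us_def)
    moreover have "\<forall>j. Suc j < p \<longrightarrow> Min (fibre c n j) < Min (fibre c n (Suc j))"
      using c unfolding opart_def mem_Collect_eq fibre_def by (elim conjE)
    ultimately have "Min (fibre c n i) < Min (fibre c n (Suc i))" by blast
    then show "map Min Us ! i \<le> map Min Us ! Suc i" using \<open>Suc i < p\<close> by (simp add: Us_def del: Min_less_iff Min_gr_iff)
  qed
  show "partition_on {0..<n} (set Us)"
    using \<open>disj_list Us\<close> u by (auto simp: disj_list_def partition_on_def)
  show "card (set Us) = p" using distinct_card[OF d] by (simp add: Us_def)
qed

text \<open>Ordering blocks by increasing minima picks one enumeration of each set partition, namely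
  \<open>lst\<close>. Counting every partition once is what the factorials in the transfer formulas
  amount to for symmetric brackets.\<close>

lemma opart_bij:
  "bij_betw (\<lambda>c. set (map (fibre c n) [0..<p])) (opart n p) {P. partition_on {0..<n} P \<and> card P = p}"
  unfolding bij_betw_def
proof
  show "inj_on (\<lambda>c. set (map (fibre c n) [0..<p])) (opart n p)"
  proof (rule inj_onI)
    fix c c' assume c: "c \<in> opart n p" "c' \<in> opart n p"
      and eq: "set (map (fibre c n) [0..<p]) = set (map (fibre c' n) [0..<p])"
    have "map (fibre c n) [0..<p] = map (fibre c' n) [0..<p]"
      using lst_unique[OF opart_fibres(1,2)[OF c(1)]] lst_unique[OF opart_fibres(1,2)[OF c(2)]] eq by metis
    then have f: "fibre c n j = fibre c' n j" if "j < p" for j using that by simp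
    show "c = c'"
    proof (rule extensionalityI[of _ "{0..<n}"])
      fix i assume i: "i \<in> {0..<n}"
      then have "c i < p" using c(1) by (auto simp: opart_def)
      moreover have "i \<in> fibre c n (c i)" using i by (simp add: fibre_def)
      ultimately have "i \<in> fibre c' n (c i)" by (simp only: f)
      then show "c i = c' i" by (simp add: fibre_def)
    qed (use c in \<open>auto simp: opart_def PiE_def\<close>)
  qed
  show "(\<lambda>c. set (map (fibre c n) [0..<p])) ` opart n p = {P. partition_on {0..<n} P \<and> card P = p}"
  proof (intro set_eqI iffI)
    fix P assume "P \<in> (\<lambda>c. set (map (fibre c n) [0..<p])) ` opart n p"
    then obtain c where c: "c \<in> opart n p" and P: "P = set (map (fibre c n) [0..<p])" by (rule imageE)
    show "P \<in> {P. partition_on {0..<n} P \<and> card P = p}"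
      unfolding P using opart_fibres(4,5)[OF c] by (intro CollectI conjI)
  next
    fix P assume "P \<in> {P. partition_on {0..<n} P \<and> card P = p}"
    then have P: "partition_on {0..<n} P" "card P = p" by auto
    have fP: "finite P" using P(1) by (rule partition_finite[rotated]) simp
    let ?Us = "lst P"
    have d: "disj_list ?Us" using P(1) by (rule disj_list_lst[rotated]) simp
    have len: "length ?Us = p" using fP P(2) by simp
    have ex: "\<exists>j. j < p \<and> i \<in> ?Us ! j" if "i < n" for i
    proof -
      have "i \<in> \<Union>P" using P(1) that by (auto simp: partition_on_def)
      then obtain U where "U \<in> set ?Us" "i \<in> U" using fP by auto
      then show ?thesis using len by (auto simp: in_set_conv_nth)
    qed
    have uniq: "j = j'" if "j < p" "j' < p" "i \<in> ?Us ! j" "i \<in> ?Us ! j'" for i j j'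
    proof (rule ccontr)
      assume "j \<noteq> j'"
      then have "?Us ! j \<noteq> ?Us ! j'" using d that len by (auto simp: disj_list_def nth_eq_iff_index_eq)
      moreover have "?Us ! j \<in> set ?Us" "?Us ! j' \<in> set ?Us" using that len by simp_all
      ultimately have "?Us ! j \<inter> ?Us ! j' = {}" using d by (simp add: disj_list_def disjoint_def)
      then show False using that by auto
    qed
    define c where "c = restrict (\<lambda>i. SOME j. j < p \<and> i \<in> ?Us ! j) {0..<n}"
    have c: "c i < p \<and> i \<in> ?Us ! c i" if "i < n" for i
      using someI_ex[OF ex[OF that]] that by (simp add: c_def)
    have fib: "fibre c n j = ?Us ! j" if "j < p" for j
    proof (intro set_eqI iffI)
      fix i assume "i \<in> fibre c n j"
      then show "i \<in> ?Us ! j" using c[of i] by (auto simp: fibre_def)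
    next
      fix i assume i: "i \<in> ?Us ! j"
      have "?Us ! j \<in> P" using fP that len nth_mem[of j ?Us] by simp
      then have "?Us ! j \<subseteq> {0..<n}" using partition_block[OF P(1)] by simp
      then have "i < n" using i by auto
      then show "i \<in> fibre c n j" using c[of i] uniq[of "c i" j i] that i by (simp add: fibre_def)
    qed
    have eq: "map (fibre c n) [0..<p] = ?Us" by (rule nth_equalityI) (use fib len in auto)
    have "c \<in> opart n p"
      unfolding opart_def
    proof (intro CollectI conjI allI impI)
      show "c \<in> {0..<n} \<rightarrow>\<^sub>E {0..<p}" using c by (auto simp: c_def)
      fix j assume "j < p"
      then have "?Us ! j \<in> set ?Us" using len by simp
      then have "fibre c n j \<noteq> {}" using fib[OF \<open>j < p\<close>] d unfolding disj_list_def by metis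
      then show "\<exists>i<n. c i = j" by (auto simp: fibre_def)
    next
      fix j assume j: "Suc j < p"
      have "sorted (map Min ?Us)" using lst_props[OF fP] by simp
      then have "Min (?Us ! j) \<le> Min (?Us ! Suc j)" using j len by (simp add: sorted_iff_nth_Suc)
      moreover have "Min (?Us ! j) \<noteq> Min (?Us ! Suc j)"
      proof
        assume "Min (?Us ! j) = Min (?Us ! Suc j)"
        then have "?Us ! j = ?Us ! Suc j"
          using disj_list_inj_Min[OF d] j len nth_mem[of j ?Us] nth_mem[of "Suc j" ?Us] by (auto dest: inj_onD)
        then show False using d j len by (simp add: disj_list_def nth_eq_iff_index_eq)
      qed
      ultimately have "Min (fibre c n j) < Min (fibre c n (Suc j))" using fib j by simp
      then show "Min {i. i < n \<and> c i = j} < Min {i. i < n \<and> c i = Suc j}" by (simp add: fibre_def)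
    qed
    then show "P \<in> (\<lambda>c. set (map (fibre c n) [0..<p])) ` opart n p"
      using eq fP by (intro image_eqI[of _ _ c]) simp_all
  qed
qed

lemma partition_card_le:
  assumes "finite (S :: nat set)" "partition_on S P"
  shows "card P \<le> card S"
proof -
  have fP: "finite P" using assms by (rule partition_finite)
  have inj: "inj_on Min P" using disj_list_inj_Min[OF disj_list_lst[OF assms]] fP by simp
  have "Min ` P \<subseteq> S"
  proof
    fix x assume "x \<in> Min ` P"
    then obtain U where U: "U \<in> P" "x = Min U" by auto
    then have "U \<subseteq> S" "U \<noteq> {}" "finite U" using partition_block[OF assms(2)] assms(1) finite_subset by blast+
    then show "x \<in> S" using U Min_in by blast
  qed
  then show ?thesis using card_inj_on_le[OF inj] assms(1) by blast
qed

abbreviation sdg :: "(int \<Rightarrow> 'b set) \<Rightarrow> int \<Rightarrow> 'b list \<Rightarrow> nat \<Rightarrow> int" where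
  "sdg G s xs \<equiv> \<lambda>i. deg G (xs ! i) + s"

definition subf :: "(nat \<Rightarrow> 'b list \<Rightarrow> 'a) \<Rightarrow> 'b list \<Rightarrow> nat set \<Rightarrow> 'a" where
  "subf f xs U = f (card U) (sel xs U)"

lemma length_sel: "length (sel xs U) = card U"
  by (simp add: sel_def)

context sym_brackets
begin

text \<open>The fibres of a colouring in \<open>opart\<close> already come sorted by minima, so
  \<open>lst\<close> returns them unchanged and the two signs coincide by
  \<open>koszul_exp_concat\<close>.\<close>

lemma part_sum_eq:
  assumes n: "length xs = n"
  shows "part_sum s H mu f xs p =
    (\<Sum>P\<in>{P. partition_on {0..<n} P \<and> card P = p}. mup (sdg H s xs) (subf f xs) (lst P))"
proof -
  have "part_sum s H mu f xs p = (\<Sum>c\<in>opart n p.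
      mup (sdg H s xs) (subf f xs) (lst (set (map (fibre c n) [0..<p]))))"
    unfolding part_sum_def Let_def n
  proof (rule sum.cong[OF refl])
    fix c assume c: "c \<in> opart n p"
    let ?Us = "map (fibre c n) [0..<p]" and ?Ls = "map (blk c n) [0..<p]"
    note op = opart_fibres[OF c]
    have set: "map set ?Ls = ?Us" by (simp add: blk_eq)
    have dist: "distinct (concat ?Ls)"
    proof (rule distinct_concat)
      have "distinct (map set ?Ls)" unfolding set using op(1) by (simp add: disj_list_def)
      then show "distinct ?Ls" unfolding distinct_map by (rule conjunct1)
      show "distinct L" if "L \<in> set ?Ls" for L using that by (auto simp: blk_eq)
      show "set L \<inter> set L' = {}" if "L \<in> set ?Ls" "L' \<in> set ?Ls" "L \<noteq> L'" for L L'
        using that by (auto simp: blk_eq fibre_def)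
    qed
    have "koszul_exp (sdegs H s xs) (pperm c n p) = kl ((!) (sdegs H s xs)) ?Us"
      unfolding pperm_def set[symmetric] by (rule koszul_exp_concat[OF dist]) (auto simp: blk_eq)
    also have "\<dots> = kl (sdg H s xs) ?Us"
    proof (rule kl_cong)
      fix i assume "i \<in> \<Union>(set ?Us)"
      then have "i < length xs" unfolding op(3) n by simp
      then show "sdegs H s xs ! i = sdg H s xs i" by simp
    qed
    finally have 1: "koszul_exp (sdegs H s xs) (pperm c n p) = kl (sdg H s xs) ?Us" .
    have 2: "map (\<lambda>j. f (length (blk c n j)) (map ((!) xs) (blk c n j))) [0..<p] = map (subf f xs) ?Us"
      by (simp add: blk_eq subf_def sel_def)
    show "signed (koszul_exp (sdegs H s xs) (pperm c n p))
        (mu p (map (\<lambda>j. f (length (blk c n j)) (map ((!) xs) (blk c n j))) [0..<p])) =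
      mup (sdg H s xs) (subf f xs) (lst (set ?Us))"
      unfolding lst_unique[OF op(1,2)] mup_def 1 2 by simp
  qed
  also have "\<dots> = (\<Sum>P\<in>{P. partition_on {0..<n} P \<and> card P = p}. mup (sdg H s xs) (subf f xs) (lst P))"
    by (rule sum.reindex_bij_betw[OF opart_bij])
  finally show ?thesis .
qed

lemma part_sum_F:
  assumes n: "length xs = n"
  shows "(\<Sum>p=2..n. part_sum s H mu f xs p) = F2 (sdg H s xs) (subf f xs) {0..<n}"
    and "(\<Sum>p=1..n. part_sum s H mu f xs p) = F (sdg H s xs) (subf f xs) {0..<n}"
proof -
  have *: "(\<Sum>p=l..n. part_sum s H mu f xs p) =
    (\<Sum>P\<in>{P. partition_on {0..<n} P \<and> l \<le> card P}. mup (sdg H s xs) (subf f xs) (lst P))" for l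
  proof -
    have "(\<Sum>p=l..n. part_sum s H mu f xs p) = (\<Sum>p=l..n.
        \<Sum>P\<in>{P \<in> {P. partition_on {0..<n} P \<and> l \<le> card P}. card P = p}. mup (sdg H s xs) (subf f xs) (lst P))"
      unfolding part_sum_eq[OF n] by (intro sum.cong refl) auto
    also have "\<dots> = (\<Sum>P\<in>{P. partition_on {0..<n} P \<and> l \<le> card P}. mup (sdg H s xs) (subf f xs) (lst P))"
      by (rule sum.group) (use partition_card_le[of "{0..<n}"] in auto)
    finally show ?thesis .
  qed
  show "(\<Sum>p=2..n. part_sum s H mu f xs p) = F2 (sdg H s xs) (subf f xs) {0..<n}"
    unfolding F2_def by (rule *)
  have "{P. partition_on {0..<n} P \<and> 1 \<le> card P} = {P. partition_on {0..<n} P \<and> P \<noteq> {}}"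
    using partition_finite[of "{0..<n}"] by (auto simp: Suc_le_eq card_gt_0_iff)
  then show "(\<Sum>p=1..n. part_sum s H mu f xs p) = F (sdg H s xs) (subf f xs) {0..<n}"
    unfolding F_def using *[of 1] by simp
qed

end

section \<open>Sublists selected by sets of positions\<close>

lemma iv_mono: "strict_mono_on U \<phi> \<Longrightarrow> iv \<phi> e U = 0"
  unfolding iv_def by (intro sum.neutral ballI) (auto dest: strict_mono_onD less_asym)

lemma koszul_exp_iv:
  "koszul_exp ds ps = iv ((!) ps) ((!) ds) {0..<length ps}"
proof -
  have "koszul_exp ds ps = (\<Sum>p\<in>{0..<length ps} \<times> {0..<length ps}.
      if fst p < snd p \<and> ps ! snd p < ps ! fst p then ds ! (ps ! fst p) * ds ! (ps ! snd p) else 0)"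
    unfolding koszul_exp_def by (rule sum.mono_neutral_cong_left) (auto simp: inversions_def)
  then show ?thesis by (simp add: iv_def sum.cartesian_product split_def)
qed

lemma sorted_list_of_set_image:
  assumes "finite U" "strict_mono_on U \<phi>"
  shows "sorted_list_of_set (\<phi> ` U) = map \<phi> (sorted_list_of_set (U :: nat set))"
proof -
  have "sorted_wrt (<) (map \<phi> (sorted_list_of_set U))"
    unfolding sorted_wrt_map
    by (rule sorted_wrt_mono_rel[OF _ strict_sorted_list_of_set])
      (use assms in \<open>auto simp: strict_mono_on_def\<close>)
  moreover have "set (map \<phi> (sorted_list_of_set U)) = \<phi> ` U" using assms(1) by simp
  ultimately show ?thesis
    using sorted_list_of_set.idem_if_sorted_distinct strict_sorted_iff by metis
qed

lemma sorted_nth_bij: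
  assumes "finite (S :: nat set)"
  shows "strict_mono_on {0..<card S} ((!) (sorted_list_of_set S))"
    and "(!) (sorted_list_of_set S) ` {0..<card S} = S"
proof -
  show "strict_mono_on {0..<card S} ((!) (sorted_list_of_set S))"
    using strict_sorted_list_of_set[of S] by (auto simp: strict_mono_on_def sorted_wrt_iff_nth_less)
  have "set (sorted_list_of_set S) = S" using assms by simp
  then show "(!) (sorted_list_of_set S) ` {0..<card S} = S"
    by (metis atLeast0LessThan length_sorted_list_of_set nth_image order_refl take_all)
qed

lemma sel_sel:
  assumes "finite S" "U \<subseteq> {0..<card S}"
  shows "sel (sel xs S) U = sel xs ((!) (sorted_list_of_set S) ` U)"
proof -
  have "finite U" using assms(2) by (rule finite_subset) simp
  moreover have "strict_mono_on U ((!) (sorted_list_of_set S))"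
    by (rule monotone_on_subset[OF sorted_nth_bij(1)[OF assms(1)] assms(2)])
  ultimately show ?thesis using assms(2)
    by (auto simp: sel_def sorted_list_of_set_image)
qed

lemma sel_nth: "i < card S \<Longrightarrow> sel xs S ! i = xs ! (sorted_list_of_set S ! i)"
  by (simp add: sel_def)

lemma sel_homog:
  assumes "list_all Q xs" "U \<subseteq> {0..<length xs}"
  shows "list_all Q (sel xs U)"
proof -
  have "finite U" using assms(2) by (rule finite_subset) simp
  then show ?thesis using assms by (auto simp: sel_def list_all_iff subset_iff)
qed

lemma sel_full: "sel xs {0..<length xs} = xs"
  by (simp add: sel_def map_nth)

lemma sel_append: "U \<subseteq> {0..<length xs} \<Longrightarrow> sel (xs @ ys) U = sel xs U"
  using finite_subset[of U] by (auto simp: sel_def nth_append)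

lemma sel_append_insert:
  assumes "U \<subseteq> {0..<length xs}"
  shows "sel (xs @ [y]) (insert (length xs) U) = sel xs U @ [y]"
proof -
  have fU: "finite U" using assms by (rule finite_subset) simp
  have "sorted_list_of_set (insert (length xs) U) = sorted_list_of_set U @ [length xs]"
  proof -
    have "sorted_wrt (<) (sorted_list_of_set U @ [length xs])"
      using assms fU by (auto simp: sorted_wrt_append)
    moreover have "set (sorted_list_of_set U @ [length xs]) = insert (length xs) U" using fU by simp
    ultimately show ?thesis using sorted_list_of_set.idem_if_sorted_distinct strict_sorted_iff by metis
  qed
  then show ?thesis using assms fU by (auto simp: sel_def nth_append)
qed

section \<open>Homotopy transfer\<close>

lemma sum_sel:
  assumes "finite U"
  shows "(\<Sum>i\<in>{0..<card U}. f (sel xs U ! i)) = (\<Sum>i\<in>U. f (xs ! i))"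
proof -
  note b = sorted_nth_bij[OF assms]
  have "(\<Sum>i\<in>U. f (xs ! i)) = (\<Sum>i\<in>{0..<card U}. f (xs ! (sorted_list_of_set U ! i)))"
    using sum.reindex[OF strict_mono_on_imp_inj_on[OF b(1)], of "\<lambda>i. f (xs ! i)"] b(2) by simp
  then show ?thesis by (simp add: sel_nth)
qed

locale transfer =
  fixes smA :: "'k::field \<Rightarrow> 'a::ab_group_add \<Rightarrow> 'a" and GA :: "int \<Rightarrow> 'a set"
    and mA :: "'a \<Rightarrow> 'a \<Rightarrow> 'a" and dA :: "'a \<Rightarrow> 'a"
    and smB :: "'k \<Rightarrow> 'b::ab_group_add \<Rightarrow> 'b" and GB :: "int \<Rightarrow> 'b set"
    and mB :: "'b \<Rightarrow> 'b \<Rightarrow> 'b" and dB :: "'b \<Rightarrow> 'b"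
    and sig :: "'a \<Rightarrow> 'b" and tau :: "'b \<Rightarrow> 'a" and h :: "'a \<Rightarrow> 'a"
    and k :: int
    and lam :: "nat \<Rightarrow> 'a list \<Rightarrow> 'a"
    and ell :: "nat \<Rightarrow> 'b list \<Rightarrow> 'b"
    and tinf :: "nat \<Rightarrow> 'b list \<Rightarrow> 'a"
  assumes dgA: "dgca smA GA mA dA"
    and dgB: "dgca smB GB mB dB"
    and semifull: "semifull_alg_contraction smA GA mA dA smB GB mB dB sig tau h"
    and dp: "derived_poisson k smA GA mA lam"
    and lam_1: "\<forall>a. lam 1 [a] = dA a"
    and ell_1: "\<forall>x. ell 1 [x] = dB x"
    and ell_multilinear: "\<forall>n\<ge>2. multilinear smB smB n (ell n)"
    and tinf_1: "\<forall>x. tinf 1 [x] = tau x"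
    and tinf_multilinear: "\<forall>n\<ge>2. multilinear smB smA n (tinf n)"
    and tinf_rec: "\<forall>n\<ge>2. \<forall>xs. length xs = n \<and> list_all (homog GB) xs \<longrightarrow>
           tinf n xs = h (\<Sum>p=2..n. part_sum (k - 1) GB (dec k GA lam) tinf xs p)"
    and ell_rec: "\<forall>n\<ge>2. \<forall>xs. length xs = n \<and> list_all (homog GB) xs \<longrightarrow>
           dec k GB ell n xs = sig (\<Sum>p=2..n. part_sum (k - 1) GB (dec k GA lam) tinf xs p)"
begin

sublocale A: poisson_brackets GA "k - 1" "dec k GA lam" mA
  by (rule dec_poisson_brackets[OF dp])

lemma algA: "graded_comm_alg smA GA mA" and algB: "graded_comm_alg smB GB mB"
  using dgA dgB unfolding dgca_def by blast+

lemmas gsB = graded_comm_algD(1)[OF algB]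

sublocale B: graded_group GB
  by (rule graded_space_graded_group[OF gsB])

lemma contr: "contraction smA GA dA smB GB dB sig tau h"
  using semifull unfolding semifull_alg_contraction_def by blast

lemma additive_maps: "is_additive h" "is_additive sig" "is_additive tau" "is_additive dA" "is_additive dB"
proof -
  have "linear_map smA smA h" "linear_map smA smB sig" "linear_map smB smA tau"
    "linear_map smA smA dA" "linear_map smB smB dB"
    using contr dgA dgB unfolding contraction_def dgca_def by blast+
  then show "is_additive h" "is_additive sig" "is_additive tau" "is_additive dA" "is_additive dB"
    by (simp_all add: linear_map_def is_additive_def)
qed

lemmas h_simps = is_additive_0[OF additive_maps(1)] is_additive_add[OF additive_maps(1)]
  is_additive_signed[OF additive_maps(1)] is_additive_sum[OF additive_maps(1)]
lemmas sig_simps = is_additive_0[OF additive_maps(2)] is_additive_add[OF additive_maps(2)]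
  is_additive_signed[OF additive_maps(2)] is_additive_sum[OF additive_maps(2)]
lemmas tau_simps = is_additive_0[OF additive_maps(3)] is_additive_signed[OF additive_maps(3)]

lemma mB_additive: "is_additive (\<lambda>x. mB x y)" "is_additive (mB x)"
  by (simp_all add: is_additive_def graded_comm_algD(2,3)[OF algB])

lemmas mA_0 = is_additive_0[OF A.m_additive(1)] is_additive_0[OF A.m_additive(2)]
lemmas mB_0 = is_additive_0[OF mB_additive(1)] is_additive_0[OF mB_additive(2)]

lemma degrees:
  "x \<in> GA i \<Longrightarrow> h x \<in> GA (i - 1)" "x \<in> GA i \<Longrightarrow> sig x \<in> GB i" "y \<in> GB i \<Longrightarrow> tau y \<in> GA i"
  "y \<in> GB i \<Longrightarrow> dB y \<in> GB (i + 1)"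
proof -
  have "graded_deg GA GA (- 1) h" "graded_deg GA GB 0 sig" "graded_deg GB GA 0 tau" "graded_deg GB GB 1 dB"
    using contr dgB unfolding contraction_def dgca_def by blast+
  then show "x \<in> GA i \<Longrightarrow> h x \<in> GA (i - 1)" "x \<in> GA i \<Longrightarrow> sig x \<in> GB i" "y \<in> GB i \<Longrightarrow> tau y \<in> GA i"
    "y \<in> GB i \<Longrightarrow> dB y \<in> GB (i + 1)"
    unfolding graded_deg_def by force+
qed

lemma contraction_simps:
  "sig (dA a) = dB (sig a)" "tau (dB x) = dA (tau x)" "sig (tau x) = x" "h (dA a) + dA (h a) = tau (sig a) - a"
  using contr unfolding contraction_def by blast+

lemma d_squared: "dA (dA a) = 0" "dB (dB x) = 0"
  using dgA dgB unfolding dgca_def by blast+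

lemma semifull_simps:
  "a \<in> GA i \<Longrightarrow> h (signed (i + 1) (mA (h a) b) + mA a (h b)) = mA (h a) (h b)"
  "h (mA a (tau x)) = mA (h a) (tau x)"
  "a \<in> GA i \<Longrightarrow> sig (signed (i + 1) (mA (h a) b) + mA a (h b)) = 0"
  "sig (mA a (tau x)) = mB (sig a) x"
  "tau (mB x y) = mA (tau x) (tau y)"
  using semifull unfolding semifull_alg_contraction_def by blast+

lemma mu_1: "dec k GA lam 1 [a] = dA a" and dec_ell_1: "dec k GB ell 1 [x] = dB x"
  using lam_1 ell_1 by (simp_all add: dec_def)

lemma tinf_ml: "n \<ge> 1 \<Longrightarrow> multilinear smB smA n (tinf n)"
  and ell_ml: "n \<ge> 1 \<Longrightarrow> multilinear smB smB n (ell n)"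
proof -
  assume n: "n \<ge> 1"
  have lin: "linear_map smB smA tau" "linear_map smB smB dB"
    using contr dgB unfolding contraction_def dgca_def by blast+
  have one: "xs[i := y] = [y]" if "length xs = 1 \<and> i < (1::nat)" for xs :: "'b list" and i y
    using that by (cases xs) auto
  have "multilinear smB smA 1 (tinf 1)" "multilinear smB smB 1 (ell 1)"
    unfolding multilinear_def using lin tinf_1 ell_1 one by (simp_all add: linear_map_def)
  then show "multilinear smB smA n (tinf n)" "multilinear smB smB n (ell n)"
    using n tinf_multilinear ell_multilinear by (cases "n = 1"; force)+
qed

section \<open>The transfer recursions as identities of set functions\<close>

abbreviation e :: "'b list \<Rightarrow> nat \<Rightarrow> int" where "e \<equiv> sdg GB (k - 1)"
abbreviation T :: "'b list \<Rightarrow> nat set \<Rightarrow> 'a" where "T \<equiv> subf tinf"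
abbreviation L :: "'b list \<Rightarrow> nat set \<Rightarrow> 'b" where "L \<equiv> subf (dec k GB ell)"

lemma tinf_eq: "list_all (homog GB) xs \<Longrightarrow> 2 \<le> length xs \<Longrightarrow>
    tinf (length xs) xs = h (A.F2 (e xs) (T xs) {0..<length xs})"
  and ell_eq: "list_all (homog GB) xs \<Longrightarrow> 2 \<le> length xs \<Longrightarrow>
    dec k GB ell (length xs) xs = sig (A.F2 (e xs) (T xs) {0..<length xs})"
  unfolding A.part_sum_F(1)[OF refl, symmetric] using tinf_rec ell_rec by blast+

text \<open>Induction on the length: \<open>F2\<close> reads \<open>tinf\<close> on proper sublists
  only and raises the shifted degree by 1, and \<open>h\<close> lowers it again.\<close>

lemma tinf_deg:
  "list_all (homog GB) xs \<Longrightarrow> xs \<noteq> [] \<Longrightarrow>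
    tinf (length xs) xs \<in> GA (sum (e xs) {0..<length xs} - (k - 1))"
proof (induction xs rule: measure_induct_rule[of length])
  case (less xs)
  show ?case
  proof (cases "length xs = 1")
    case True
    then obtain x where x: "xs = [x]" by (cases xs) auto
    then have "tau x \<in> GA (deg GB x)" using less.prems by (intro degrees(3) in_deg) simp
    then show ?thesis using x tinf_1 by simp
  next
    case False
    moreover have "length xs \<noteq> 0" using less.prems(2) by simp
    ultimately have n2: "2 \<le> length xs" by linarith
    have "A.F2 (e xs) (T xs) {0..<length xs} \<in> GA (sum (e xs) {0..<length xs} + 1 - (k - 1))"
    proof (rule A.F2_deg)
      fix U assume U: "U \<subseteq> {0..<length xs}" "U \<noteq> {}" "U \<noteq> {0..<length xs}"
      have fU: "finite U" using U(1) by (rule finite_subset) simp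
      have "card U < length xs" using psubset_card_mono[of "{0..<length xs}" U] U by auto
      moreover have "sel xs U \<noteq> []" using U(2) fU length_sel[of xs U] by (metis card_eq_0_iff list.size(3))
      ultimately have "tinf (card U) (sel xs U) \<in> GA (sum (e (sel xs U)) {0..<card U} - (k - 1))"
        using less.IH[of "sel xs U"] sel_homog[OF less.prems(1) U(1)] by (simp add: length_sel)
      then show "T xs U \<in> GA (sum (e xs) U - (k - 1))"
        unfolding subf_def sum_sel[OF fU, of "\<lambda>x. deg GB x + (k - 1)" xs] .
    qed simp
    from degrees(1)[OF this] show ?thesis
      unfolding tinf_eq[OF less.prems(1) n2] by (simp add: algebra_simps)
  qed
qed

lemma hom_T: "list_all (homog GB) xs \<Longrightarrow> A.hom (e xs) (T xs) {0..<length xs}"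
  unfolding A.hom_def
proof (intro conjI allI impI)
  fix U assume xs: "list_all (homog GB) xs" and U: "U \<subseteq> {0..<length xs}" "U \<noteq> {}"
  have fU: "finite U" using U(1) by (rule finite_subset) simp
  have "sel xs U \<noteq> []" using U(2) fU length_sel[of xs U] by (metis card_eq_0_iff list.size(3))
  from tinf_deg[OF sel_homog[OF xs U(1)] this]
  show "T xs U \<in> GA (sum (e xs) U - (k - 1))"
    unfolding subf_def length_sel sum_sel[OF fU, of "\<lambda>x. deg GB x + (k - 1)" xs] .
qed simp

text \<open>The enumeration of \<open>S\<close> is increasing, so reindexing along it produces no
  sign. The recursion, stated for whole lists, thereby holds at every subset of one fixed
  list.\<close>

lemma F2_sel:
  assumes xs: "list_all (homog GB) xs" and S: "S \<subseteq> {0..<length xs}"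
  shows "A.F2 (e (sel xs S)) (T (sel xs S)) {0..<card S} = A.F2 (e xs) (T xs) S"
proof -
  have fS: "finite S" using S by (rule finite_subset) simp
  let ?\<phi> = "(!) (sorted_list_of_set S)"
  note b = sorted_nth_bij[OF fS]
  have iv0: "iv ?\<phi> (e xs) U = 0" if "U \<subseteq> {0..<card S}" for U
    by (rule iv_mono) (rule monotone_on_subset[OF b(1) that])
  have sub: "?\<phi> ` U \<subseteq> S" if "U \<subseteq> {0..<card S}" for U
    using image_mono[OF that, of ?\<phi>] unfolding b(2) .
  have inj: "inj_on ?\<phi> {0..<card S}" by (rule strict_mono_on_imp_inj_on[OF b(1)])
  have "A.F2 (e (sel xs S)) (T (sel xs S)) {0..<card S} =
      signed (iv ?\<phi> (e xs) {0..<card S}) (A.F2 (e xs) (T xs) (?\<phi> ` {0..<card S}))"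
  proof (rule A.F2_reindex[OF _ inj])
    fix U assume U: "U \<subseteq> {0..<card S}" "U \<noteq> {}"
    show "T (sel xs S) U = signed (iv ?\<phi> (e xs) U) (T xs (?\<phi> ` U))"
      unfolding iv0[OF U(1)] subf_def sel_sel[OF fS U(1)] card_image[OF inj_on_subset[OF inj U(1)]] by simp
    show "T xs (?\<phi> ` U) \<in> GA (sum (e xs) (?\<phi> ` U) - (k - 1))"
      using hom_T[OF xs] sub[OF U(1)] S U(2) unfolding A.hom_def by blast
  qed (simp_all add: sel_nth)
  then show ?thesis unfolding b(2) iv0[OF subset_refl] by simp
qed

lemma T_eq: "list_all (homog GB) xs \<Longrightarrow> S \<subseteq> {0..<length xs} \<Longrightarrow> 2 \<le> card S \<Longrightarrow>
    T xs S = h (A.F2 (e xs) (T xs) S)"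
  and L_eq: "list_all (homog GB) xs \<Longrightarrow> S \<subseteq> {0..<length xs} \<Longrightarrow> 2 \<le> card S \<Longrightarrow>
    L xs S = sig (A.F2 (e xs) (T xs) S)"
  using tinf_eq[OF sel_homog, of xs S] ell_eq[OF sel_homog, of xs S] F2_sel[of xs S]
  unfolding subf_def length_sel by simp_all

lemma L_singleton: "L xs {i} = dB (xs ! i)" and T_singleton: "T xs {i} = tau (xs ! i)"
  using dec_ell_1 tinf_1 by (simp_all add: subf_def sel_def)

lemma card_cases:
  assumes "finite U"
  obtains "U = {}" | i where "U = {i}" | "2 \<le> card U"
proof -
  consider "card U = 0" | "card U = 1" | "2 \<le> card U" by linarith
  then show thesis
  proof cases
    case 1
    then show thesis using that(1) assms by simp
  next
    case 2
    then show thesis using that(2) by (rule card_1_singletonE)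
  qed (rule that(3))
qed

lemma L_deg:
  assumes xs: "list_all (homog GB) xs" and U: "U \<subseteq> {0..<length xs}" "U \<noteq> {}"
  shows "L xs U \<in> GB (sum (e xs) U + 1 - (k - 1))"
proof -
  have "finite U" using U(1) by (rule finite_subset) simp
  then show ?thesis
  proof (cases U rule: card_cases)
    case (2 i)
    then have "xs ! i \<in> GB (deg GB (xs ! i))" using xs U(1) by (intro in_deg) (simp add: list_all_length)
    from degrees(4)[OF this] show ?thesis unfolding 2 L_singleton by simp
  next
    case 3
    have "A.F2 (e xs) (T xs) U \<in> GA (sum (e xs) U + 1 - (k - 1))"
      by (rule A.F2_deg) (use \<open>finite U\<close> hom_T[OF xs] U in \<open>auto simp: A.hom_def\<close>)
    then show ?thesis unfolding L_eq[OF xs U(1) 3] by (rule degrees(2))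
  qed (use U in simp)
qed

section \<open>Graded symmetry of the transferred maps\<close>

context
  fixes xs ps
  assumes xs: "list_all (homog GB) xs" and ps: "distinct ps" "set ps \<subseteq> {0..<length xs}"
begin

private abbreviation "ys \<equiv> map ((!) xs) ps"

lemma inj_ps: "inj_on ((!) ps) {0..<length ps}"
  using ps(1) by (simp add: inj_on_nth)

lemma ys_homog: "list_all (homog GB) ys"
  using xs ps(2) by (auto simp: list_all_iff subset_iff)

lemma image_ps: "U \<subseteq> {0..<length ps} \<Longrightarrow> (!) ps ` U \<subseteq> {0..<length xs}"
  using ps(2) by (force simp: subset_iff)

lemma F2_perm:
  assumes S: "S \<subseteq> {0..<length ps}"
    and T: "\<And>U. U \<subseteq> S \<Longrightarrow> U \<noteq> {} \<Longrightarrow> U \<noteq> S \<Longrightarrow> T ys U = signed (iv ((!) ps) (e xs) U) (T xs ((!) ps ` U))"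
  shows "A.F2 (e ys) (T ys) S = signed (iv ((!) ps) (e xs) S) (A.F2 (e xs) (T xs) ((!) ps ` S))"
proof (rule A.F2_reindex)
  show "finite S" using S by (rule finite_subset) simp
  show "inj_on ((!) ps) S" by (rule inj_on_subset[OF inj_ps S])
  show "e ys i = e xs (ps ! i)" if "i \<in> S" for i using that S by (auto simp: subset_iff)
  fix U assume U: "U \<subseteq> S" "U \<noteq> {}" "U \<noteq> S"
  show "T ys U = signed (iv ((!) ps) (e xs) U) (T xs ((!) ps ` U))" by (rule T[OF U])
  show "T xs ((!) ps ` U) \<in> GA (sum (e xs) ((!) ps ` U) - (k - 1))"
    using hom_T[OF xs] image_ps[of U] U S unfolding A.hom_def by blast
qed

text \<open>Induction over \<open>U\<close>, since \<open>F2\<close> at \<open>U\<close> reads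
  \<open>T\<close> on proper subsets and \<open>h\<close> commutes with signs. \<open>ps\<close> may
  omit positions: moving one argument past a sublist later uses only some of them.\<close>

lemma T_perm:
  assumes "U \<subseteq> {0..<length ps}"
  shows "T ys U = signed (iv ((!) ps) (e xs) U) (T xs ((!) ps ` U))"
proof -
  have "finite U" using assms by (rule finite_subset) simp
  then show ?thesis using assms
  proof (induction U rule: finite_psubset_induct)
    case (psubset U)
    have c: "card ((!) ps ` U) = card U" by (rule card_image) (rule inj_on_subset[OF inj_ps psubset.prems])
    show ?case using psubset.hyps
    proof (cases U rule: card_cases)
      case 1
      then show ?thesis by (simp add: subf_def sel_def iv_def)
    next
      case (2 i)
      then show ?thesis using psubset.prems by (simp add: T_singleton iv_def)
    next
      case 3
      have "A.F2 (e ys) (T ys) U = signed (iv ((!) ps) (e xs) U) (A.F2 (e xs) (T xs) ((!) ps ` U))"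
        by (rule F2_perm[OF psubset.prems]) (use psubset in blast)
      then show ?thesis
        using T_eq[OF ys_homog, of U] T_eq[OF xs image_ps[OF psubset.prems]] psubset.prems 3 c
        by (simp add: h_simps)
    qed
  qed
qed

lemma koszul_ps: "koszul_exp (sdegs GB (k - 1) xs) ps = iv ((!) ps) (e xs) {0..<length ps}"
proof -
  have "sdegs GB (k - 1) xs ! (ps ! a) = e xs (ps ! a)" if "a \<in> {0..<length ps}" for a
  proof (rule sdegs_nth)
    have "ps ! a \<in> set ps" using that by simp
    then show "ps ! a < length xs" using ps(2) by auto
  qed
  then show ?thesis unfolding koszul_exp_iv iv_def by (intro sum.cong refl) auto
qed

lemma image_ps_full: "(!) ps ` {0..<length ps} = set ps"
  by (metis atLeast0LessThan nth_image order_refl take_all)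

lemma tinf_perm: "tinf (length ps) ys = signed (koszul_exp (sdegs GB (k - 1) xs) ps) (T xs (set ps))"
  using T_perm[OF subset_refl] sel_full[of ys] unfolding koszul_ps image_ps_full subf_def[of _ ys] by simp

lemma dec_ell_perm:
  assumes "ps \<noteq> []"
  shows "dec k GB ell (length ps) ys = signed (koszul_exp (sdegs GB (k - 1) xs) ps) (L xs (set ps))"
proof (cases "2 \<le> length ps")
  case True
  have "A.F2 (e ys) (T ys) {0..<length ps} =
      signed (iv ((!) ps) (e xs) {0..<length ps}) (A.F2 (e xs) (T xs) ((!) ps ` {0..<length ps}))"
    by (rule F2_perm[OF subset_refl]) (rule T_perm)
  moreover have "card (set ps) = length ps" using ps(1) by (rule distinct_card)
  ultimately show ?thesis
    using ell_eq[OF ys_homog] L_eq[OF xs ps(2)] True unfolding koszul_ps image_ps_full by (simp add: sig_simps)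
next
  case False
  then obtain i where "ps = [i]" using assms by (cases ps) (auto simp: Suc_le_eq)
  then show ?thesis using dec_ell_1 by (simp add: L_singleton koszul_exp_sorted)
qed

end

section \<open>Derivatives of \<open>T\<close> and \<open>L\<close> in the direction of an appended
  argument\<close>

definition DT :: "'b list \<Rightarrow> 'b \<Rightarrow> nat set \<Rightarrow> 'a" where
  "DT xs y U = tinf (Suc (card U)) (sel xs U @ [y])"

definition LT :: "'b list \<Rightarrow> 'b \<Rightarrow> nat set \<Rightarrow> 'b" where
  "LT xs y U = dec k GB ell (Suc (card U)) (sel xs U @ [y])"

lemma T_append: "U \<subseteq> {0..<length xs} \<Longrightarrow> T (xs @ [y]) U = T xs U"
  by (simp add: subf_def sel_append)

lemma T_append_insert: "U \<subseteq> {0..<length xs} \<Longrightarrow> T (xs @ [y]) (insert (length xs) U) = DT xs y U"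
  and L_append_insert: "U \<subseteq> {0..<length xs} \<Longrightarrow> L (xs @ [y]) (insert (length xs) U) = LT xs y U"
proof -
  assume U: "U \<subseteq> {0..<length xs}"
  have "card (insert (length xs) U) = Suc (card U)"
    using U finite_subset[OF U] by (subst card_insert_disjoint) auto
  then show "T (xs @ [y]) (insert (length xs) U) = DT xs y U" "L (xs @ [y]) (insert (length xs) U) = LT xs y U"
    by (simp_all add: subf_def DT_def LT_def sel_append_insert[OF U])
qed

lemma DT_zero: "DT xs 0 U = 0" and LT_zero: "LT xs 0 U = 0"
  unfolding DT_def LT_def
  by (auto intro!: multilinear_zero[OF tinf_ml] dec_zero[of smB _ ell, OF ell_ml] simp: length_sel)

lemma e_append: "i < length xs \<Longrightarrow> e (xs @ [y]) i = e xs i"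
  by (simp add: nth_append)

lemma F2_DT:
  assumes xs: "list_all (homog GB) xs" and y: "homog GB y" and S: "S \<subseteq> {0..<length xs}"
  shows "A.F2 (e (xs @ [y])) (T (xs @ [y])) (insert (length xs) S) = A.d0 (e xs) (T xs) (DT xs y) S"
proof -
  let ?n = "length xs"
  have fS: "finite S" using S by (rule finite_subset) simp
  have h: "A.hom (e (xs @ [y])) (T (xs @ [y])) (insert ?n S)"
    by (rule A.hom_subset[OF hom_T]) (use xs y S in auto)
  have "A.F2 (e (xs @ [y])) (T (xs @ [y])) (insert ?n S) =
      A.d0 (e (xs @ [y])) (T (xs @ [y])) (\<lambda>U. T (xs @ [y]) (insert ?n U)) S"
    by (rule A.F2_insert[OF fS _ h]) (use S in auto)
  also have "\<dots> = A.d0 (e xs) (T xs) (\<lambda>U. T (xs @ [y]) (insert ?n U)) S"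
    by (rule A.d0_cong_base[OF fS]) (use S T_append e_append in auto)
  also have "\<dots> = A.d0 (e xs) (T xs) (DT xs y) S"
    by (rule A.d0_cong[OF fS]) (use S in \<open>auto intro!: T_append_insert\<close>)
  finally show ?thesis .
qed

lemma d0_empty [simp]: "A.d0 a b Y {} = 0"
  by (simp add: A.d0_def)

lemma DT_empty: "DT xs y {} = tau y" and LT_empty: "LT xs y {} = dB y"
  using tinf_1 dec_ell_1 by (simp_all add: DT_def LT_def sel_def)

text \<open>The recursion for the list \<open>xs @ [y]\<close>, with \<open>F2\<close>
  differentiated by \<open>F2_DT\<close>. The empty set supplies the constant term
  \<open>tau y\<close>; \<open>LT\<close> is excluded there because its value is
  \<open>dB y\<close>, while \<open>d0\<close> at \<open>{}\<close> is 0.\<close>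

lemma
  assumes xs: "list_all (homog GB) xs" and y: "homog GB y" and S: "S \<subseteq> {0..<length xs}"
  shows DT_eq: "DT xs y S = tau (if S = {} then y else 0) + h (A.d0 (e xs) (T xs) (DT xs y) S)"
    and LT_eq: "S \<noteq> {} \<Longrightarrow> LT xs y S = sig (A.d0 (e xs) (T xs) (DT xs y) S)"
proof -
  have fS: "finite S" using S by (rule finite_subset) simp
  have hom: "list_all (homog GB) (xs @ [y])" using xs y by simp
  have S': "insert (length xs) S \<subseteq> {0..<length (xs @ [y])}" using S by auto
  have c: "2 \<le> card (insert (length xs) S)" if "S \<noteq> {}"
  proof -
    have "length xs \<notin> S" using S by auto
    then have "card (insert (length xs) S) = Suc (card S)" using fS by simp
    moreover have "card S \<noteq> 0" using that fS by simp
    ultimately show ?thesis by linarith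
  qed
  show "DT xs y S = tau (if S = {} then y else 0) + h (A.d0 (e xs) (T xs) (DT xs y) S)"
  proof (cases "S = {}")
    case False
    then show ?thesis
      using T_eq[OF hom S' c] T_append_insert[OF S] F2_DT[OF xs y S] by (simp add: tau_simps)
  qed (simp add: DT_empty h_simps)
  show "LT xs y S = sig (A.d0 (e xs) (T xs) (DT xs y) S)" if "S \<noteq> {}"
    using L_eq[OF hom S' c[OF that]] L_append_insert[OF S] F2_DT[OF xs y S] by simp
qed

lemma DT_deg:
  assumes xs: "list_all (homog GB) xs" and y: "y \<in> GB r" and U: "U \<subseteq> {0..<length xs}"
  shows "DT xs y U \<in> GA (r + sum (e xs) U)"
proof (cases "y = 0")
  case True
  then show ?thesis by (simp add: DT_zero A.G_0)
next
  case False
  have d: "deg GB y = r" by (rule deg_eq[OF gsB y False])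
  have hom: "list_all (homog GB) (xs @ [y])" using xs y by (auto simp: homog_def)
  have fU: "finite U" using U by (rule finite_subset) simp
  have n: "length xs \<notin> U" using U by auto
  have "sum (e (xs @ [y])) (insert (length xs) U) = r + (k - 1) + sum (e xs) U"
  proof -
    have "e (xs @ [y]) i = e xs i" if "i \<in> U" for i using that U by (intro e_append) auto
    then have "sum (e (xs @ [y])) U = sum (e xs) U" by (intro sum.cong refl)
    then show ?thesis using fU n d by simp
  qed
  moreover have "T (xs @ [y]) (insert (length xs) U) \<in> GA (sum (e (xs @ [y])) (insert (length xs) U) - (k - 1))"
  proof -
    have "insert (length xs) U \<subseteq> {0..<length (xs @ [y])}" using U by auto
    then show ?thesis using hom_T[OF hom] unfolding A.hom_def by (elim conjE allE impE) auto
  qed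
  ultimately show ?thesis using T_append_insert[OF U, of y] by (simp add: algebra_simps)
qed

text \<open>With \<open>y\<close> stored at the position after \<open>xs\<close>, the wanted order
  is \<open>length xs # sorted_list_of_set U\<close>, whose only inversions are those of
  \<open>y\<close> with the elements of \<open>U\<close>. Here \<open>d\<close> is the shifted
  degree of \<open>y\<close>.\<close>

lemma
  assumes xs: "list_all (homog GB) xs" and y: "y \<in> GB (d - (k - 1))" and U: "U \<subseteq> {0..<length xs}"
  shows tinf_move_first: "tinf (Suc (card U)) (y # sel xs U) = signed (d * sum (e xs) U) (DT xs y U)"
    and dec_ell_move_first: "dec k GB ell (Suc (card U)) (y # sel xs U) = signed (d * sum (e xs) U) (LT xs y U)"
proof -
  let ?n = "length xs" and ?xs = "xs @ [y]" and ?ps = "length xs # sorted_list_of_set U"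
  have fU: "finite U" using U by (rule finite_subset) simp
  have n: "?n \<notin> U" using U by auto
  have hom: "list_all (homog GB) ?xs" using xs y by (auto simp: homog_def)
  have ps: "distinct ?ps" "set ?ps \<subseteq> {0..<length ?xs}" using fU n U by auto
  have len: "length ?ps = Suc (card U)" by simp
  have map: "map ((!) ?xs) ?ps = y # sel xs U"
    using U fU by (auto simp: sel_def nth_append)
  have set: "set ?ps = insert ?n U" using fU by simp
  have "tinf (Suc (card U)) (y # sel xs U) = signed (d * sum (e xs) U) (DT xs y U) \<and>
    dec k GB ell (Suc (card U)) (y # sel xs U) = signed (d * sum (e xs) U) (LT xs y U)"
  proof (cases "y = 0")
    case True
    then show ?thesis unfolding True DT_zero LT_zero signed_zero
      by (auto intro!: multilinear_zero[OF tinf_ml] dec_zero[of smB _ ell, OF ell_ml] simp: length_sel)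
  next
    case False
    have dy: "deg GB y = d - (k - 1)" by (rule deg_eq[OF gsB y False])
    have "koszul_exp (sdegs GB (k - 1) ?xs) ?ps = ksg ((!) (sdegs GB (k - 1) ?xs)) {?n} U"
      using ps(1) fU by (subst koszul_exp_Cons) (auto simp: koszul_exp_sorted)
    also have "\<dots> = (\<Sum>b\<in>U. d * e xs b)"
    proof -
      have "(if b < ?n then sdegs GB (k - 1) ?xs ! ?n * sdegs GB (k - 1) ?xs ! b else 0) = d * e xs b"
        if "b \<in> U" for b
      proof -
        have "b < ?n" using U that by auto
        then show ?thesis using dy by (simp add: nth_append)
      qed
      then show ?thesis unfolding ksg_def by simp
    qed
    finally have k: "koszul_exp (sdegs GB (k - 1) ?xs) ?ps = d * sum (e xs) U"
      by (simp only: sum_distrib_left)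
    show ?thesis
      using tinf_perm[OF hom ps] dec_ell_perm[OF hom ps]
      unfolding len map set k T_append_insert[OF U] L_append_insert[OF U] by simp
  qed
  then show "tinf (Suc (card U)) (y # sel xs U) = signed (d * sum (e xs) U) (DT xs y U)"
    "dec k GB ell (Suc (card U)) (y # sel xs U) = signed (d * sum (e xs) U) (LT xs y U)"
    by blast+
qed

subsection \<open>Multiplicativity\<close>

text \<open>Graded commutativity turns the right module identities into left ones; the odd map
  \<open>h\<close> passing \<open>tau y\<close> accounts for the sign.\<close>

lemma tau_left:
  assumes y: "y \<in> GB r" and b: "b \<in> GA t"
  shows "h (mA (tau y) b) = signed r (mA (tau y) (h b))" "sig (mA (tau y) b) = mB y (sig b)"
proof -
  have ty: "tau y \<in> GA r" by (rule degrees(3)[OF y])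
  have "mA (tau y) b = signed (t * r) (mA b (tau y))"
    by (rule graded_comm_algD(5)[OF algA b ty])
  moreover have "mA (h b) (tau y) = signed (r * (t - 1)) (mA (tau y) (h b))"
    by (rule graded_comm_algD(5)[OF algA ty degrees(1)[OF b]])
  ultimately have "h (mA (tau y) b) = signed (t * r + r * (t - 1)) (mA (tau y) (h b))"
    by (simp add: h_simps semifull_simps(2))
  also have "\<dots> = signed r (mA (tau y) (h b))" by (rule signed_cong) auto
  finally show "h (mA (tau y) b) = signed r (mA (tau y) (h b))" .
  have "mB (sig b) y = signed (r * t) (mB y (sig b))"
    by (rule graded_comm_algD(5)[OF algB y degrees(2)[OF b]])
  then have "sig (mA (tau y) b) = signed (t * r + r * t) (mB y (sig b))"
    unfolding \<open>mA (tau y) b = _\<close> by (simp add: sig_simps semifull_simps(4))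
  also have "\<dots> = signed 0 (mB y (sig b))" by (rule signed_cong) auto
  finally show "sig (mA (tau y) b) = mB y (sig b)" by simp
qed

text \<open>The perturbed elements \<open>tau y + h a\<close> and \<open>tau z + h b\<close> multiply like \<open>y\<close> and \<open>z\<close>: the mixed
  terms are absorbed by the module identities, and \<open>h a\<close>, \<open>h b\<close> by the remaining semifull identity.\<close>
lemma semifull_product:
  assumes y: "y \<in> GB p" and a: "a \<in> GA (p + 1)" and b: "b \<in> GA t"
  shows "h (mA a (tau z + h b) + signed p (mA (tau y + h a) b)) =
      mA (tau y + h a) (tau z + h b) - mA (tau y) (tau z)"
    and "sig (mA a (tau z + h b) + signed p (mA (tau y + h a) b)) =
      mB (sig a) z + signed p (mB y (sig b))"
proof -
  \<comment> \<open>The combination occurring in the semifull identities for \<open>a\<close>, which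
    has degree \<open>p + 1\<close>; its exponent \<open>p + 1 + 1\<close> has the parity of
    \<open>p\<close>.\<close>
  let ?c = "signed (p + 1 + 1) (mA (h a) b) + mA a (h b)"
  have "signed (p + 1 + 1) x = signed p x" for x :: 'a by (rule signed_cong) simp
  then have split: "mA a (tau z + h b) + signed p (mA (tau y + h a) b) =
      mA a (tau z) + signed p (mA (tau y) b) + ?c"
    by (simp add: A.m_add_left A.m_add_right signed_add add_ac)
  have H: "h (u + v + ?c) = h u + h v + h ?c" and Sg: "sig (u + v + ?c) = sig u + sig v + sig ?c" for u v
    by (simp_all only: is_additive_add[OF additive_maps(1), of "u + v" ?c] is_additive_add[OF additive_maps(1), of u v]
        is_additive_add[OF additive_maps(2), of "u + v" ?c] is_additive_add[OF additive_maps(2), of u v])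
  have "signed p (signed p x) = x" for x :: 'a by (simp add: signed_def)
  then have "h (mA a (tau z + h b) + signed p (mA (tau y + h a) b)) =
      mA (h a) (tau z) + mA (tau y) (h b) + mA (h a) (h b)"
    unfolding split H semifull_simps(1)[OF a] semifull_simps(2) h_simps(3) tau_left(1)[OF y b] by simp
  then show "h (mA a (tau z + h b) + signed p (mA (tau y + h a) b)) =
      mA (tau y + h a) (tau z + h b) - mA (tau y) (tau z)"
    by (simp add: A.m_add_left A.m_add_right)
  show "sig (mA a (tau z + h b) + signed p (mA (tau y + h a) b)) = mB (sig a) z + signed p (mB y (sig b))"
    unfolding split Sg semifull_simps(3)[OF a] semifull_simps(4) sig_simps(3) tau_left(2)[OF y b] by simp
qed

lemma sum_Pow_full:
  assumes "finite S" "\<And>U. U \<subseteq> S \<Longrightarrow> U \<noteq> S \<Longrightarrow> f U = 0"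
  shows "(\<Sum>U\<in>Pow S. f U) = f S"
  using sum.mono_neutral_right[of "Pow S" "{S}" f] assms by auto

lemma sum_Pow_empty:
  assumes "finite S" "\<And>U. U \<subseteq> S \<Longrightarrow> U \<noteq> {} \<Longrightarrow> f U = 0"
  shows "(\<Sum>U\<in>Pow S. f U) = f {}"
  using sum.mono_neutral_right[of "Pow S" "{{}}" f] assms by auto

lemma d0_DT_deg:
  assumes xs: "list_all (homog GB) xs" and y: "y \<in> GB r" and S: "S \<subseteq> {0..<length xs}"
  shows "A.d0 (e xs) (T xs) (DT xs y) S \<in> GA (r + sum (e xs) S + 1)"
  by (rule A.d0_deg[OF A.hom_subset[OF hom_T[OF xs] S]], rule DT_deg[OF xs y]) (use S in blast)

text \<open>Both factors of each term of \<open>d0_conv\<close> are written as \<open>tau\<close>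
  plus \<open>h\<close> of a derivative, and \<open>semifull_product\<close> is applied term by
  term. In \<open>C - h \<delta> C\<close> only \<open>tau y\<close> times \<open>tau z\<close>
  survives, which forces both parts of \<open>S\<close> to be empty. Under \<open>sig\<close> the
  factor \<open>z\<close> survives only for \<open>U = S\<close> and \<open>y\<close> only for
  \<open>U = {}\<close>, leaving two terms.\<close>

lemma
  assumes xs: "list_all (homog GB) xs" and y: "y \<in> GB r" and z: "z \<in> GB q" and S: "S \<subseteq> {0..<length xs}"
  defines "C \<equiv> A.conv (e xs) r (DT xs y) (DT xs z)" and "\<delta> \<equiv> \<lambda>Y. A.d0 (e xs) (T xs) Y"
  shows d0_conv_DT: "C S = tau (if S = {} then mB y z else 0) + h (\<delta> C S)"
    and sig_d0_conv_DT: "S \<noteq> {} \<Longrightarrow> sig (\<delta> C S) =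
      mB (sig (\<delta> (DT xs y) S)) z + signed (r * (1 + sum (e xs) S)) (mB y (sig (\<delta> (DT xs z) S)))"
proof -
  have fS: "finite S" using S by (rule finite_subset) simp
  let ?w = "\<lambda>U. ksg (e xs) U (S - U) + r * sum (e xs) (S - U)"
  let ?y = "\<lambda>U :: nat set. if U = {} then y else 0" and ?z = "\<lambda>U :: nat set. if U = {} then z else 0"
  let ?a = "\<delta> (DT xs y)" and ?b = "\<delta> (DT xs z)"
  let ?t = "\<lambda>U. mA (?a U) (tau (?z (S - U)) + h (?b (S - U))) +
      signed (r + sum (e xs) U) (mA (tau (?y U) + h (?a U)) (?b (S - U)))"
  have hy: "homog GB y" and hz: "homog GB z" using y z by (auto simp: homog_def)
  have Dy: "DT xs y U = tau (?y U) + h (?a U)" and Dz: "DT xs z (S - U) = tau (?z (S - U)) + h (?b (S - U))"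
    if "U \<in> Pow S" for U
    unfolding \<delta>_def by (rule DT_eq[OF xs hy] DT_eq[OF xs hz], use S that in blast)+
  \<comment> \<open>For nonempty \<open>U\<close> the element \<open>?y U\<close> is 0 and so lies
    in every degree; this allows \<open>semifull_product\<close> with
    \<open>p = r + sum (e xs) U\<close> in all terms.\<close>
  have deg: "?y U \<in> GB (r + sum (e xs) U)" "?a U \<in> GA (r + sum (e xs) U + 1)"
      "?b (S - U) \<in> GA (q + sum (e xs) (S - U) + 1)" if "U \<in> Pow S" for U
    unfolding \<delta>_def using y S that d0_DT_deg[OF xs y, of U] d0_DT_deg[OF xs z, of "S - U"] B.G_0
    by auto
  have "\<delta> C S = (\<Sum>U\<in>Pow S. signed (?w U)
      (mA (?a U) (DT xs z (S - U)) + signed (r + sum (e xs) U) (mA (DT xs y U) (?b (S - U)))))"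
    unfolding \<delta>_def C_def
    by (rule A.d0_conv[OF A.hom_subset[OF hom_T[OF xs] S]], rule DT_deg[OF xs y]) (use S in blast)
  also have "\<dots> = (\<Sum>U\<in>Pow S. signed (?w U) (?t U))"
    by (rule sum.cong[OF refl]) (simp only: Dy Dz)
  finally have d: "\<delta> C S = (\<Sum>U\<in>Pow S. signed (?w U) (?t U))" .
  have c: "C S = (\<Sum>U\<in>Pow S. signed (?w U) (mA (tau (?y U) + h (?a U)) (tau (?z (S - U)) + h (?b (S - U)))))"
    unfolding C_def A.conv_def by (rule sum.cong[OF refl]) (simp only: Dy Dz)
  have "C S - h (\<delta> C S) = (\<Sum>U\<in>Pow S. signed (?w U) (mA (tau (?y U)) (tau (?z (S - U)))))"
    unfolding c d h_simps(4) sum_subtractf[symmetric]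
  proof (rule sum.cong[OF refl])
    fix U assume U: "U \<in> Pow S"
    show "signed (?w U) (mA (tau (?y U) + h (?a U)) (tau (?z (S - U)) + h (?b (S - U)))) - h (signed (?w U) (?t U)) =
      signed (?w U) (mA (tau (?y U)) (tau (?z (S - U))))"
      unfolding h_simps(3) semifull_product(1)[OF deg[OF U]] signed_diff
      by (simp only: diff_diff_eq2 add_diff_cancel_left')
  qed
  also have "\<dots> = signed (?w {}) (mA (tau (?y {})) (tau (?z (S - {}))))"
    by (subst sum_Pow_empty[OF fS]) (simp_all add: tau_simps mA_0)
  also have "\<dots> = tau (if S = {} then mB y z else 0)"
    by (simp add: tau_simps mA_0 semifull_simps(5))
  finally show "C S = tau (if S = {} then mB y z else 0) + h (\<delta> C S)" by (simp add: algebra_simps)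
  assume ne: "S \<noteq> {}"
  have "sig (\<delta> C S) = (\<Sum>U\<in>Pow S. signed (?w U) (mB (sig (?a U)) (?z (S - U)))) +
     (\<Sum>U\<in>Pow S. signed (?w U) (signed (r + sum (e xs) U) (mB (?y U) (sig (?b (S - U))))))"
    unfolding d sig_simps(4) sum.distrib[symmetric]
  proof (rule sum.cong[OF refl])
    fix U assume U: "U \<in> Pow S"
    show "sig (signed (?w U) (?t U)) = signed (?w U) (mB (sig (?a U)) (?z (S - U))) +
        signed (?w U) (signed (r + sum (e xs) U) (mB (?y U) (sig (?b (S - U)))))"
      unfolding sig_simps(3) semifull_product(2)[OF deg[OF U]] by (rule signed_add)
  qed
  also have "(\<Sum>U\<in>Pow S. signed (?w U) (mB (sig (?a U)) (?z (S - U)))) = signed (?w S) (mB (sig (?a S)) (?z (S - S)))"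
    by (subst sum_Pow_full[OF fS]) (auto simp: mB_0)
  also have "(\<Sum>U\<in>Pow S. signed (?w U) (signed (r + sum (e xs) U) (mB (?y U) (sig (?b (S - U)))))) =
      signed (?w {}) (signed (r + sum (e xs) {}) (mB (?y {}) (sig (?b (S - {})))))"
    by (subst sum_Pow_empty[OF fS]) (simp_all add: mB_0)
  finally show "sig (\<delta> C S) = mB (sig (?a S)) z + signed (r * (1 + sum (e xs) S)) (mB y (sig (?b S)))"
    by (simp add: algebra_simps)
qed

lemma DT_mult:
  assumes xs: "list_all (homog GB) xs" and y: "y \<in> GB r" and z: "z \<in> GB q" and S: "S \<subseteq> {0..<length xs}"
  shows "DT xs (mB y z) S = A.conv (e xs) r (DT xs y) (DT xs z) S"
proof (rule A.fixed_point_unique[OF _ additive_maps(1) _ _ S, where e = "e xs" and T = "T xs" and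
      c = "\<lambda>S. tau (if S = {} then mB y z else 0)"])
  have "homog GB (mB y z)" using graded_comm_algD(4)[OF algB y z] by (auto simp: homog_def)
  then show "DT xs (mB y z) S = tau (if S = {} then mB y z else 0) + h (A.d0 (e xs) (T xs) (DT xs (mB y z)) S)"
    if "S \<subseteq> {0..<length xs}" for S using DT_eq[OF xs _ that] by simp
  show "A.conv (e xs) r (DT xs y) (DT xs z) S = tau (if S = {} then mB y z else 0) +
      h (A.d0 (e xs) (T xs) (A.conv (e xs) r (DT xs y) (DT xs z)) S)"
    if "S \<subseteq> {0..<length xs}" for S by (rule d0_conv_DT[OF xs y z that])
qed simp

lemma LT_der:
  assumes xs: "list_all (homog GB) xs" and y: "y \<in> GB r" and z: "z \<in> GB q" and S: "S \<subseteq> {0..<length xs}" "S \<noteq> {}"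
  shows "LT xs (mB y z) S = mB (LT xs y S) z + signed (r * (1 + sum (e xs) S)) (mB y (LT xs z S))"
proof -
  have hom: "homog GB (mB y z)" "homog GB y" "homog GB z"
    using graded_comm_algD(4)[OF algB y z] y z by (auto simp: homog_def)
  have "finite S" using S(1) by (rule finite_subset) simp
  then have "A.d0 (e xs) (T xs) (DT xs (mB y z)) S =
      A.d0 (e xs) (T xs) (A.conv (e xs) r (DT xs y) (DT xs z)) S"
    by (rule A.d0_cong) (use S in \<open>auto intro!: DT_mult[OF xs y z]\<close>)
  then show ?thesis
    using sig_d0_conv_DT[OF xs y z S] LT_eq[OF xs _ S] hom by simp
qed

subsection \<open>The \<open>L\<^sub>\<infinity>\<close> relations\<close>

text \<open>\<open>L\<close> at \<open>{}\<close> would be \<open>ell\<close> of arity 0, about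
  which nothing is known; as a direction of differentiation \<open>\<ell>\<close> must have no
  constant term.\<close>

definition Lz :: "'b list \<Rightarrow> nat set \<Rightarrow> 'b" where
  "Lz xs V = (if V = {} then 0 else L xs V)"

lemma Lz_deg:
  assumes "list_all (homog GB) xs" "U \<subseteq> {0..<length xs}"
  shows "Lz xs U \<in> GB (sum (e xs) U + 1 - (k - 1))"
proof (cases "U = {}")
  case False
  from L_deg[OF assms False] False show ?thesis unfolding Lz_def by (simp only: if_False)
qed (simp add: Lz_def B.G_0)

abbreviation Fx :: "'b list \<Rightarrow> nat set \<Rightarrow> 'a" where "Fx xs \<equiv> A.F (e xs) (T xs)"

text \<open>\<open>Ft\<close> and \<open>Dt\<close> are \<open>F(T)\<close> and the derivative of \<open>T\<close> in direction \<open>\<ell>\<close>, up to the sign of moving these odd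
  quantities past the parameters \<open>\<epsilon>\<^sub>S\<close>; without it they would not satisfy the same equation.\<close>
definition Ft :: "'b list \<Rightarrow> nat set \<Rightarrow> 'a" where
  "Ft xs S = signed (sum (e xs) S) (Fx xs S)"

definition Dt :: "'b list \<Rightarrow> nat set \<Rightarrow> 'a" where
  "Dt xs S = (\<Sum>V\<in>Pow S. signed (ksg (e xs) (S - V) V + sum (e xs) V) (DT xs (Lz xs V) (S - V)))"

lemma F_empty [simp]: "A.F a b {} = 0"
  by (simp add: A.F_def partition_on_empty_iff)

text \<open>For at least two points \<open>T = h F2\<close>, and the contraction identity at
  \<open>F2\<close> reads \<open>d h F2 + F2 = tau (sig F2) - h d F2\<close>; moreover
  \<open>dF = dF2\<close> since \<open>F - F2 = dT\<close>. On singletons \<open>F2 = 0\<close> and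
  the claims reduce to \<open>tau\<close> being a cochain map and \<open>d\<close> having square
  0.\<close>

lemma
  assumes xs: "list_all (homog GB) xs" and S: "S \<subseteq> {0..<length xs}" "S \<noteq> {}"
  shows Fx_eq: "Fx xs S = tau (L xs S) - h (dA (Fx xs S))"
    and dB_L: "dB (L xs S) = sig (dA (Fx xs S))"
proof -
  have fS: "finite S" using S(1) by (rule finite_subset) simp
  let ?F2 = "A.F2 (e xs) (T xs) S"
  have F: "Fx xs S = dA (T xs S) + ?F2" using A.F_eq[OF fS S(2)] mu_1 by simp
  have dF: "dA (Fx xs S) = dA ?F2" unfolding F by (simp add: is_additive_add[OF additive_maps(4)] d_squared)
  have "Fx xs S = tau (L xs S) - h (dA (Fx xs S)) \<and> dB (L xs S) = sig (dA (Fx xs S))"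
    using fS
  proof (cases S rule: card_cases)
    case (2 i)
    have "{P. partition_on {i} P \<and> 2 \<le> card P} = {}"
      using partition_card_le[of "{i}"] by fastforce
    then have "?F2 = 0" unfolding 2 A.F2_def by (simp only: sum.empty)
    then show ?thesis unfolding F dF[unfolded F] unfolding 2 T_singleton L_singleton
      by (simp add: contraction_simps d_squared is_additive_0[OF additive_maps(4)] h_simps sig_simps)
  next
    case 3
    have "dA (h ?F2) + ?F2 = tau (sig ?F2) - h (dA ?F2)"
      using contraction_simps(4)[of ?F2] by (simp add: algebra_simps)
    then show ?thesis
      using dF F T_eq[OF xs S(1) 3] L_eq[OF xs S(1) 3] contraction_simps(1) by simp
  qed (use S in simp)
  then show "Fx xs S = tau (L xs S) - h (dA (Fx xs S))" "dB (L xs S) = sig (dA (Fx xs S))" by blast+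
qed

text \<open>In \<open>F_linf\<close> the exponent \<open>sum e (S - V)\<close> is split as that of
  \<open>S\<close> and that of \<open>V\<close> modulo 2; the second part is what \<open>Ft\<close>
  absorbs, so the rest is a genuine \<open>d0\<close>.\<close>

lemma dA_Fx:
  assumes xs: "list_all (homog GB) xs" and S: "S \<subseteq> {0..<length xs}" "S \<noteq> {}"
  shows "dA (Fx xs S) = - signed (sum (e xs) S) (A.d0 (e xs) (T xs) (Ft xs) S)"
proof -
  have fS: "finite S" using S(1) by (rule finite_subset) simp
  have "signed (sum (e xs) S) (A.d0 (e xs) (T xs) (Ft xs) S) =
     (\<Sum>V\<in>Pow S. signed (ksg (e xs) (S - V) V + sum (e xs) (S - V)) (A.lop (e xs) (T xs) (S - V) (Fx xs V)))"
    unfolding A.d0_def signed_sum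
  proof (rule sum.cong[OF refl])
    fix V assume V: "V \<in> Pow S"
    have A: "is_additive (A.lop (e xs) (T xs) (S - V))" using fS by (simp add: A.lop_additive)
    have "sum (e xs) S = sum (e xs) V + sum (e xs) (S - V)"
      using V fS by (subst sum.subset_diff[of V S]) auto
    then show "signed (sum (e xs) S) (signed (ksg (e xs) (S - V) V) (A.lop (e xs) (T xs) (S - V) (Ft xs V))) =
      signed (ksg (e xs) (S - V) V + sum (e xs) (S - V)) (A.lop (e xs) (T xs) (S - V) (Fx xs V))"
      unfolding Ft_def is_additive_signed[OF A] signed_signed by (intro signed_cong) auto
  qed
  also have "\<dots> = (\<Sum>V\<in>{V. V \<subseteq> S \<and> V \<noteq> {}}.
      signed (ksg (e xs) (S - V) V + sum (e xs) (S - V)) (A.lop (e xs) (T xs) (S - V) (Fx xs V)))"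
    by (rule sum.mono_neutral_right)
      (use fS in \<open>auto simp: is_additive_0[OF A.lop_additive]\<close>)
  finally show ?thesis
    using A.F_linf[OF fS S(2) A.hom_subset[OF hom_T[OF xs] S(1)]] mu_1 by (simp add: eq_neg_iff_add_eq_0)
qed

lemma Ft_eq:
  assumes xs: "list_all (homog GB) xs" and S: "S \<subseteq> {0..<length xs}"
  shows "Ft xs S = signed (sum (e xs) S) (tau (Lz xs S)) + h (A.d0 (e xs) (T xs) (Ft xs) S)"
proof (cases "S = {}")
  case True
  then show ?thesis by (simp add: Ft_def Lz_def tau_simps h_simps)
next
  case False
  let ?d = "A.d0 (e xs) (T xs) (Ft xs) S"
  have "Fx xs S = tau (L xs S) + signed (sum (e xs) S) (h ?d)"
    using Fx_eq[OF xs S False] dA_Fx[OF xs S False]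
    by (simp add: is_additive_minus[OF additive_maps(1)] h_simps(3))
  then show ?thesis using False
    by (simp add: Ft_def Lz_def signed_add) (simp add: signed_def)
qed

text \<open>\<open>DT_eq\<close> holds for each direction \<open>Lz xs V\<close>, and
  \<open>d0_twist\<close> reassembles the derivatives. A constant term needs
  \<open>S - V = {}\<close>, so only \<open>V = S\<close> provides one.\<close>

lemma Dt_eq:
  assumes xs: "list_all (homog GB) xs" and S: "S \<subseteq> {0..<length xs}"
  shows "Dt xs S = signed (sum (e xs) S) (tau (Lz xs S)) + h (A.d0 (e xs) (T xs) (Dt xs) S)"
proof -
  have fS: "finite S" using S by (rule finite_subset) simp
  let ?w = "\<lambda>V. ksg (e xs) (S - V) V + sum (e xs) V"
  have D: "Dt xs = (\<lambda>S. \<Sum>V\<in>Pow S. signed (ksg (e xs) (S - V) V + sum (e xs) V) (DT xs (Lz xs V) (S - V)))"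
    by (rule ext) (rule Dt_def)
  have tw: "A.d0 (e xs) (T xs) (Dt xs) S =
      (\<Sum>V\<in>Pow S. signed (?w V) (A.d0 (e xs) (T xs) (DT xs (Lz xs V)) (S - V)))"
    unfolding D by (rule A.d0_twist[OF fS])
  have "Dt xs S = (\<Sum>V\<in>Pow S. signed (?w V) (tau (if S - V = {} then Lz xs V else 0))) +
      (\<Sum>V\<in>Pow S. signed (?w V) (h (A.d0 (e xs) (T xs) (DT xs (Lz xs V)) (S - V))))"
    unfolding Dt_def sum.distrib[symmetric] signed_add[symmetric]
  proof (rule sum.cong[OF refl])
    fix V assume V: "V \<in> Pow S"
    have "homog GB (Lz xs V)" using Lz_deg[OF xs, of V] S V unfolding homog_def by blast
    moreover have "S - V \<subseteq> {0..<length xs}" using S by blast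
    ultimately have "DT xs (Lz xs V) (S - V) = tau (if S - V = {} then Lz xs V else 0) +
        h (A.d0 (e xs) (T xs) (DT xs (Lz xs V)) (S - V))" by (rule DT_eq[OF xs])
    then show "signed (?w V) (DT xs (Lz xs V) (S - V)) = signed (?w V) (tau (if S - V = {} then Lz xs V else 0) +
        h (A.d0 (e xs) (T xs) (DT xs (Lz xs V)) (S - V)))"
      by (simp only:)
  qed
  also have "(\<Sum>V\<in>Pow S. signed (?w V) (tau (if S - V = {} then Lz xs V else 0))) =
      signed (?w S) (tau (if S - S = {} then Lz xs S else 0))"
    by (subst sum_Pow_full[OF fS]) (auto simp: tau_simps)
  finally show ?thesis unfolding tw h_simps(4) h_simps(3) by simp
qed

lemma Ft_Dt:
  assumes xs: "list_all (homog GB) xs" and S: "S \<subseteq> {0..<length xs}"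
  shows "Ft xs S = Dt xs S"
  by (rule A.fixed_point_unique[OF _ additive_maps(1) Ft_eq[OF xs] Dt_eq[OF xs] S]) simp_all

lemma koszul_unsh:
  assumes "S \<subseteq> {0..<length xs}"
  shows "koszul_exp (sdegs GB (k - 1) xs) (unsh (length xs) S) = ksg (e xs) S ({0..<length xs} - S)"
  unfolding koszul_exp_unsh[OF assms] by (rule ksg_cong) (use assms in auto)

lemma shifted_degree_sum:
  "sum (e xs) S = (\<Sum>i\<in>S. deg GB (xs ! i)) + int (card S) * (k - 1)"
  by (simp add: sum.distrib)

lemma sum_deg_list: "(\<Sum>i\<in>{0..<length xs}. deg GB (xs ! i)) = sum_list (map (deg GB) xs)"
  by (simp add: sum_list_sum_nth)

section \<open>Assembling the relations for argument lists\<close>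

context
  fixes xs and n :: nat
  assumes xs: "list_all (homog GB) xs" and n: "length xs = n" "n \<ge> 1"
begin

private abbreviation "N \<equiv> {0..<length xs}"

lemma full_nonempty: "N \<noteq> {}"
  using n by simp

lemma L_full: "L xs N = dec k GB ell n xs" and T_full: "T xs N = tinf n xs"
  using n sel_full[of xs] by (simp_all add: subf_def)

text \<open>Accounts for moving the inner bracket, of shifted degree
  \<open>sum (e xs) S + 1\<close>, from the first slot past the remaining arguments to the
  last.\<close>

lemma move_sign:
  assumes S: "S \<subseteq> N"
  shows "even (ksg (e xs) S (N - S) + (sum (e xs) S + 1) * sum (e xs) (N - S)) =
      even (ksg (e xs) (N - S) S + sum (e xs) (N - S))"
proof -
  have fS: "finite S" using S by (rule finite_subset) simp
  have k: "ksg (e xs) S (N - S) + ksg (e xs) (N - S) S = sum (e xs) S * sum (e xs) (N - S)"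
    by (rule ksg_swap) (use fS in auto)
  have "ksg (e xs) S (N - S) + (sum (e xs) S + 1) * sum (e xs) (N - S) =
     2 * ksg (e xs) S (N - S) + (ksg (e xs) (N - S) S + sum (e xs) (N - S))"
    using k by (simp add: algebra_simps)
  then show ?thesis by simp
qed

lemma twist_sign:
  assumes S: "S \<subseteq> N"
  shows "signed (sum (e xs) N) (signed (ksg (e xs) (N - S) S + sum (e xs) S) x) =
    signed (ksg (e xs) (N - S) S + sum (e xs) (N - S)) x"
proof -
  have "sum (e xs) N = sum (e xs) (N - S) + sum (e xs) S"
    by (rule sum.subset_diff) (use S in auto)
  then show ?thesis unfolding signed_signed by (intro signed_cong) auto
qed

lemma block_term:
  assumes S: "S \<subseteq> N" "S \<noteq> {}"
  shows "signed (koszul_exp (sdegs GB (k - 1) xs) (unsh n S))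
      (tinf (n - card S + 1) (dec k GB ell (card S) (sel xs S) # sel xs ({0..<n} - S))) =
      signed (ksg (e xs) (N - S) S + sum (e xs) (N - S)) (DT xs (Lz xs S) (N - S))" (is ?T)
    and "signed (koszul_exp (sdegs GB (k - 1) xs) (unsh n S))
      (dec k GB ell (n - card S + 1) (dec k GB ell (card S) (sel xs S) # sel xs ({0..<n} - S))) =
      signed (ksg (e xs) (N - S) S + sum (e xs) (N - S)) (LT xs (Lz xs S) (N - S))" (is ?L)
proof -
  have fS: "finite S" using S(1) by (rule finite_subset) simp
  have c: "n - card S + 1 = Suc (card (N - S))"
    using S(1) fS n by (simp add: card_Diff_subset)
  have l: "dec k GB ell (card S) (sel xs S) = Lz xs S" using S(2) by (simp add: Lz_def subf_def)
  have W: "N - S \<subseteq> {0..<length xs}" by auto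
  note mf = tinf_move_first[OF xs Lz_deg[OF xs S(1)] W] dec_ell_move_first[OF xs Lz_deg[OF xs S(1)] W]
  show ?T ?L
    unfolding n(1)[symmetric] koszul_unsh[OF S(1)] c[folded n(1)] l mf signed_signed
    by (rule signed_cong, rule move_sign[OF S(1)])+
qed

lemma Dt_twisted:
  "(\<Sum>S\<in>Pow N. signed (ksg (e xs) (N - S) S + sum (e xs) (N - S)) (DT xs (Lz xs S) (N - S))) = Fx xs N"
proof -
  have "(\<Sum>S\<in>Pow N. signed (ksg (e xs) (N - S) S + sum (e xs) (N - S)) (DT xs (Lz xs S) (N - S))) =
      signed (sum (e xs) N) (Dt xs N)"
    unfolding Dt_def signed_sum by (rule sum.cong[OF refl], rule twist_sign[symmetric]) simp
  also have "Dt xs N = Ft xs N" by (rule Ft_Dt[OF xs, symmetric]) simp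
  also have "signed (sum (e xs) N) (Ft xs N) = Fx xs N"
    unfolding Ft_def by (simp add: signed_def)
  finally show ?thesis .
qed

lemma tinf_morphism:
  "(\<Sum>i=1..n. \<Sum>S\<in>{S. S \<subseteq> {0..<n} \<and> card S = i}. signed (koszul_exp (sdegs GB (k - 1) xs) (unsh n S))
      (tinf (n - i + 1) (dec k GB ell i (sel xs S) # sel xs ({0..<n} - S)))) =
    (\<Sum>p=1..n. part_sum (k - 1) GB (dec k GA lam) tinf xs p)"
proof -
  let ?g = "\<lambda>S. signed (koszul_exp (sdegs GB (k - 1) xs) (unsh n S))
      (tinf (n - card S + 1) (dec k GB ell (card S) (sel xs S) # sel xs ({0..<n} - S)))"
  have "(\<Sum>i=1..n. \<Sum>S\<in>{S. S \<subseteq> {0..<n} \<and> card S = i}. signed (koszul_exp (sdegs GB (k - 1) xs) (unsh n S))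
      (tinf (n - i + 1) (dec k GB ell i (sel xs S) # sel xs ({0..<n} - S)))) =
    (\<Sum>i=1..n. \<Sum>S\<in>{S. S \<subseteq> {0..<n} \<and> card S = i}. ?g S)"
    by (intro sum.cong refl) auto
  also have "\<dots> = (\<Sum>S\<in>{S. S \<subseteq> {0..<n} \<and> S \<noteq> {}}. ?g S)" by (rule sum_by_card(1))
  also have "\<dots> = (\<Sum>S\<in>Pow N. signed (ksg (e xs) (N - S) S + sum (e xs) (N - S)) (DT xs (Lz xs S) (N - S)))"
  \<comment> \<open>The empty set may be added to the range because \<open>Lz\<close> is 0 there,
    and with it the derivative \<open>DT\<close>.\<close>
  proof (rule sum.mono_neutral_cong_left)
    fix S assume "S \<in> {S. S \<subseteq> {0..<n} \<and> S \<noteq> {}}"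
    then show "?g S = signed (ksg (e xs) (N - S) S + sum (e xs) (N - S)) (DT xs (Lz xs S) (N - S))"
      using n by (intro block_term(1)) auto
  qed (use n in \<open>auto simp: Lz_def DT_zero\<close>)
  also have "\<dots> = Fx xs N" by (rule Dt_twisted)
  also have "\<dots> = (\<Sum>p=1..n. part_sum (k - 1) GB (dec k GA lam) tinf xs p)"
    using A.part_sum_F(2)[OF n(1)] n(1) by simp
  finally show ?thesis .
qed

text \<open>By \<open>d0_twist\<close> the sum is \<open>sig\<close> of the derivative in direction
  \<open>Dt\<close>, which equals \<open>Ft\<close>; then \<open>\<delta> F(T) = - dF(T)\<close> and
  \<open>sig\<close> of \<open>dF(T)\<close> is \<open>dB\<close> of the transferred
  bracket.\<close>

lemma sig_d0_twisted:
  "(\<Sum>S\<in>Pow N. signed (ksg (e xs) (N - S) S + sum (e xs) (N - S))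
      (sig (A.d0 (e xs) (T xs) (DT xs (Lz xs S)) (N - S)))) = - dB (L xs N)"
proof -
  have "(\<Sum>S\<in>Pow N. signed (ksg (e xs) (N - S) S + sum (e xs) (N - S))
      (sig (A.d0 (e xs) (T xs) (DT xs (Lz xs S)) (N - S)))) =
    sig (signed (sum (e xs) N) (\<Sum>S\<in>Pow N. signed (ksg (e xs) (N - S) S + sum (e xs) S)
      (A.d0 (e xs) (T xs) (DT xs (Lz xs S)) (N - S))))"
    unfolding signed_sum sig_simps(4)
  proof (rule sum.cong[OF refl])
    fix S assume "S \<in> Pow N"
    then have S: "S \<subseteq> N" by simp
    show "signed (ksg (e xs) (N - S) S + sum (e xs) (N - S)) (sig (A.d0 (e xs) (T xs) (DT xs (Lz xs S)) (N - S))) =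
      sig (signed (sum (e xs) N) (signed (ksg (e xs) (N - S) S + sum (e xs) S)
        (A.d0 (e xs) (T xs) (DT xs (Lz xs S)) (N - S))))"
      unfolding twist_sign[OF S] sig_simps(3) ..
  qed
  also have "(\<Sum>S\<in>Pow N. signed (ksg (e xs) (N - S) S + sum (e xs) S)
      (A.d0 (e xs) (T xs) (DT xs (Lz xs S)) (N - S))) = A.d0 (e xs) (T xs) (Dt xs) N"
  proof -
    have D: "Dt xs = (\<lambda>S. \<Sum>V\<in>Pow S. signed (ksg (e xs) (S - V) V + sum (e xs) V) (DT xs (Lz xs V) (S - V)))"
      by (rule ext) (rule Dt_def)
    show ?thesis unfolding D by (rule A.d0_twist[symmetric]) simp
  qed
  also have "A.d0 (e xs) (T xs) (Dt xs) N = A.d0 (e xs) (T xs) (Ft xs) N"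
    by (rule A.d0_cong) (auto intro!: Ft_Dt[OF xs, symmetric])
  also have "signed (sum (e xs) N) (A.d0 (e xs) (T xs) (Ft xs) N) = - dA (Fx xs N)"
    using dA_Fx[OF xs subset_refl full_nonempty] by simp
  also have "sig (- dA (Fx xs N)) = - dB (L xs N)"
    using dB_L[OF xs subset_refl full_nonempty] is_additive_minus[OF additive_maps(2)] by simp
  finally show ?thesis .
qed

lemma ell_linf:
  "(\<Sum>i=1..n. \<Sum>S\<in>{S. S \<subseteq> {0..<n} \<and> card S = i}. signed (koszul_exp (sdegs GB (k - 1) xs) (unsh n S))
      (dec k GB ell (n - i + 1) (dec k GB ell i (sel xs S) # sel xs ({0..<n} - S)))) = 0"
proof -
  let ?g = "\<lambda>S. signed (koszul_exp (sdegs GB (k - 1) xs) (unsh n S))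
      (dec k GB ell (n - card S + 1) (dec k GB ell (card S) (sel xs S) # sel xs ({0..<n} - S)))"
  let ?w = "\<lambda>S. ksg (e xs) (N - S) S + sum (e xs) (N - S)"
  \<comment> \<open>If \<open>S = N\<close>, the outer bracket is \<open>dB\<close>, which is not of
    the form \<open>sig\<close> of a derivative: \<open>d0\<close> at \<open>{}\<close> is 0. The
    added summand covers this case and is what \<open>sig_d0_twisted\<close> finally
    cancels.\<close>
  let ?G = "\<lambda>S. (if S = N then dB (L xs N) else 0) +
      signed (?w S) (sig (A.d0 (e xs) (T xs) (DT xs (Lz xs S)) (N - S)))"
  have "(\<Sum>i=1..n. \<Sum>S\<in>{S. S \<subseteq> {0..<n} \<and> card S = i}. signed (koszul_exp (sdegs GB (k - 1) xs) (unsh n S))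
      (dec k GB ell (n - i + 1) (dec k GB ell i (sel xs S) # sel xs ({0..<n} - S)))) =
    (\<Sum>i=1..n. \<Sum>S\<in>{S. S \<subseteq> {0..<n} \<and> card S = i}. ?g S)"
    by (intro sum.cong refl) auto
  also have "\<dots> = (\<Sum>S\<in>{S. S \<subseteq> {0..<n} \<and> S \<noteq> {}}. ?g S)" by (rule sum_by_card(1))
  also have "\<dots> = (\<Sum>S\<in>Pow N. ?G S)"
  proof (rule sum.mono_neutral_cong_left)
    show "\<forall>S\<in>Pow N - {S. S \<subseteq> {0..<n} \<and> S \<noteq> {}}. ?G S = 0"
    proof
      fix S assume "S \<in> Pow N - {S. S \<subseteq> {0..<n} \<and> S \<noteq> {}}"
      then have "S = {}" using n by auto
      moreover have "A.d0 (e xs) (T xs) (DT xs 0) N = 0"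
        unfolding A.d0_def DT_zero by (intro sum.neutral) (simp add: is_additive_0[OF A.lop_additive])
      ultimately show "?G S = 0" using full_nonempty by (simp add: Lz_def sig_simps)
    qed
    fix S assume "S \<in> {S. S \<subseteq> {0..<n} \<and> S \<noteq> {}}"
    then have S: "S \<subseteq> N" "S \<noteq> {}" using n by auto
    have "homog GB (Lz xs S)" using Lz_deg[OF xs S(1)] unfolding homog_def by blast
    then have "LT xs (Lz xs S) (N - S) = (if S = N then dB (L xs N) else 0) +
        sig (A.d0 (e xs) (T xs) (DT xs (Lz xs S)) (N - S))"
      using LT_eq[OF xs, of "Lz xs S" "N - S"] S full_nonempty
      by (cases "S = N") (auto simp: LT_empty Lz_def sig_simps)
    moreover have "signed (?w S) (if S = N then dB (L xs N) else 0) = (if S = N then dB (L xs N) else 0)"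
      by simp
    ultimately show "?g S = ?G S"
      unfolding block_term(2)[OF S] by (simp only: signed_add)
  qed (use n in auto)
  also have "\<dots> = (\<Sum>S\<in>Pow N. if S = N then dB (L xs N) else 0) +
      (\<Sum>S\<in>Pow N. signed (?w S) (sig (A.d0 (e xs) (T xs) (DT xs (Lz xs S)) (N - S))))"
    by (rule sum.distrib)
  also have "\<dots> = dB (L xs N) + - dB (L xs N)"
    unfolding sig_d0_twisted by (simp add: sum.delta)
  finally show ?thesis by simp
qed

lemma ell_perm:
  assumes ps: "ps \<in> perms n"
  shows "ell n (map ((!) xs) ps) = signed (anti_exp (sdegs GB k xs) ps) (ell n xs)"
    and "tinf n (map ((!) xs) ps) = signed (koszul_exp (sdegs GB (k - 1) xs) ps) (tinf n xs)"
proof -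
  have len: "length ps = n" using ps by (rule perms_length)
  have ps': "distinct ps" "set ps \<subseteq> {0..<length xs}" "set ps = N" "ps \<noteq> []"
    using ps n len by (auto simp: perms_def)
  show "tinf n (map ((!) xs) ps) = signed (koszul_exp (sdegs GB (k - 1) xs) ps) (tinf n xs)"
    using tinf_perm[OF xs ps'(1,2)] unfolding len ps'(3) T_full .
  let ?w = "\<lambda>ys. \<Sum>i<n. int (n - 1 - i) * (deg GB (ys ! i) + k - 1)"
  have "signed (?w (map ((!) xs) ps)) (ell n (map ((!) xs) ps)) =
      signed (koszul_exp (sdegs GB (k - 1) xs) ps + ?w xs) (ell n xs)"
    using dec_ell_perm[OF xs ps'(1,2,4)] unfolding len ps'(3) L_full dec_def signed_signed .
  also have "\<dots> = signed (?w (map ((!) xs) ps)) (signed (anti_exp (sdegs GB k xs) ps) (ell n xs))"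
    unfolding signed_signed
  proof (rule signed_cong)
    show "even (koszul_exp (sdegs GB (k - 1) xs) ps + ?w xs) =
        even (?w (map ((!) xs) ps) + anti_exp (sdegs GB k xs) ps)"
      using dec_perm_sign[OF ps n(1), of GB k] unfolding even_add by argo
  qed
  finally show "ell n (map ((!) xs) ps) = signed (anti_exp (sdegs GB k xs) ps) (ell n xs)"
    by (rule signed_cancel)
qed

lemma ell_tinf_degree:
  "ell n xs \<in> GB (sum_list (map (deg GB) xs) + (k * (int n - 1) + 2 - int n))"
  "tinf n xs \<in> GA (sum_list (map (deg GB) xs) + (k - 1) * (int n - 1))"
proof -
  have s: "sum (e xs) N = sum_list (map (deg GB) xs) + int n * (k - 1)"
    unfolding shifted_degree_sum sum_deg_list using n by simp
  have "dec k GB ell n xs \<in> GB (sum (e xs) N + 1 - (k - 1))"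
    using L_deg[OF xs subset_refl full_nonempty] unfolding L_full .
  from B.G_signed[OF this, of "\<Sum>i<n. int (n - 1 - i) * (deg GB (xs ! i) + k - 1)"]
  have "ell n xs \<in> GB (sum (e xs) N + 1 - (k - 1))"
    unfolding dec_def signed_twice .
  then show "ell n xs \<in> GB (sum_list (map (deg GB) xs) + (k * (int n - 1) + 2 - int n))"
    unfolding s by (simp add: algebra_simps)
  have "xs \<noteq> []" using n by auto
  from tinf_deg[OF xs this]
  show "tinf n xs \<in> GA (sum_list (map (deg GB) xs) + (k - 1) * (int n - 1))"
    unfolding s using n by (simp add: algebra_simps)
qed

end

text \<open>Reduces arbitrary degree assignments to the values of \<open>deg\<close>: a list
  containing 0 is sent to 0, which has every degree, and otherwise degrees are unique.\<close>

lemma graded_multI: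
  assumes ml: "multilinear smB sm n f" and G: "graded_group G"
    and f: "\<And>xs. list_all (homog GB) xs \<Longrightarrow> length xs = n \<Longrightarrow> f xs \<in> G (sum_list (map (deg GB) xs) + d)"
  shows "graded_mult GB G n d f"
  unfolding graded_mult_def
proof (intro allI impI)
  fix xs :: "'b list" and ds :: "int list"
  assume a: "length xs = n \<and> length ds = n \<and> (\<forall>i<n. xs ! i \<in> GB (ds ! i))"
  show "f xs \<in> G (sum_list ds + d)"
  proof (cases "0 \<in> set xs")
    case True
    then have "f xs = 0" using multilinear_zero[OF ml] a by blast
    then show ?thesis by (simp add: graded_group.G_0[OF G])
  next
    case False
    have "map (deg GB) xs = ds"
    proof (rule nth_equalityI)
      fix i assume "i < length (map (deg GB) xs)"
      then have i: "i < n" "xs ! i \<in> set xs" using a by auto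
      then have "xs ! i \<noteq> 0" using False by metis
      then show "map (deg GB) xs ! i = ds ! i" using a i deg_eq[OF gsB] by auto
    qed (use a in simp)
    moreover have "list_all (homog GB) xs" using a by (auto simp: list_all_length homog_def)
    ultimately show ?thesis using f[of xs] a by simp
  qed
qed

text \<open>The last factor \<open>c\<close> is arbitrary; both sides are additive in it, so
  homogeneous \<open>c\<close> suffice and \<open>LT_der\<close> applies. The decalage exponent
  \<open>?w\<close> ignores the last slot, is therefore common to all terms and cancels. For
  \<open>m = 0\<close> the claim is the Leibniz rule of \<open>dB\<close>.\<close>

lemma ell_der:
  assumes as: "length as = m" "list_all (homog GB) as" and b: "homog GB b"
  shows "ell (Suc m) (as @ [mB b c]) = mB (ell (Suc m) (as @ [b])) c +
      signed (deg GB b * (k * (int (Suc m) - 1) + 2 - int (Suc m) + sum_list (map (deg GB) as)))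
        (mB b (ell (Suc m) (as @ [c])))"
proof -
  let ?x = "deg GB b * (k * (int (Suc m) - 1) + 2 - int (Suc m) + sum_list (map (deg GB) as))"
  let ?l = "\<lambda>y. ell (Suc m) (as @ [y])"
  have l_add: "is_additive ?l"
    by (rule multilinear_additive[OF ell_ml]) (use as in auto)
  have b': "b \<in> GB (deg GB b)" using b by (rule in_deg)
  show ?thesis using gsB
  proof (induction c rule: graded_space_induct)
    case (homogeneous q c)
    show ?case
    proof (cases m)
      case 0
      have "dB (mB b c) = mB (dB b) c + signed (deg GB b) (mB b (dB c))"
        using dgB b' unfolding dgca_def by blast
      then show ?thesis using 0 as ell_1 by simp
    next
      case (Suc m')
      let ?w = "\<Sum>i<m. int (m - i) * (deg GB (as ! i) + k - 1)"
      have LT: "LT as y {0..<m} = signed ?w (?l y)" for y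
        using as sel_full[of as] by (simp add: LT_def dec_snoc)
      have "sum (e as) {0..<m} = sum_list (map (deg GB) as) + int m * (k - 1)"
        unfolding shifted_degree_sum using sum_deg_list[of as] as(1) by simp
      then have x: "deg GB b * (1 + sum (e as) {0..<m}) = ?x" by (simp only:) (simp add: algebra_simps)
      have "signed ?w (?l (mB b c)) = mB (signed ?w (?l b)) c + signed ?x (mB b (signed ?w (?l c)))"
        using LT_der[OF as(2) b' homogeneous, of "{0..<m}"] as Suc unfolding LT x by simp
      also have "\<dots> = signed ?w (mB (?l b) c + signed ?x (mB b (?l c)))"
        unfolding is_additive_signed[OF mB_additive(1)] is_additive_signed[OF mB_additive(2)]
        by (simp add: signed_add add.commute)
      finally show ?thesis by (rule signed_cancel)
    qed
  next
    case (add c c')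
    then show ?case
      unfolding is_additive_add[OF mB_additive(2)] is_additive_add[OF l_add] signed_add
      by (simp only: add_ac)
  qed
qed

lemma tinf_mult:
  assumes xs: "length xs = n" "list_all (homog GB) xs" and y: "homog GB y"
  shows "tinf (n + 1) (xs @ [mB y z]) = (\<Sum>i=0..n. \<Sum>S\<in>{S. S \<subseteq> {0..<n} \<and> card S = i}.
      signed (koszul_exp (sdegs GB (k - 1) xs) (unsh n S) +
          deg GB y * (int (n - i) * (k - 1) + sum_list (map (deg GB) (sel xs ({0..<n} - S)))))
        (mA (tinf (i + 1) (sel xs S @ [y])) (tinf (n - i + 1) (sel xs ({0..<n} - S) @ [z]))))"
proof -
  let ?N = "{0..<n}"
  have y': "y \<in> GB (deg GB y)" using y by (rule in_deg)
  have DT_add: "is_additive (\<lambda>z. DT xs z U)" if "U \<subseteq> ?N" for U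
    unfolding DT_def by (rule multilinear_additive[OF tinf_ml]) (auto simp: length_sel)
  \<comment> \<open>\<open>DT_mult\<close> asks for homogeneous \<open>z\<close>; the general case
    follows by additivity of both sides in the last slot.\<close>
  have "DT xs (mB y z) ?N = A.conv (e xs) (deg GB y) (DT xs y) (DT xs z) ?N"
    using gsB
  proof (induction z rule: graded_space_induct)
    case (homogeneous q z)
    show ?case by (rule DT_mult[OF xs(2) y' homogeneous]) (use xs in simp)
  next
    case (add z z')
    have "A.conv (e xs) (deg GB y) (DT xs y) (DT xs (z + z')) ?N =
      A.conv (e xs) (deg GB y) (DT xs y) (DT xs z) ?N + A.conv (e xs) (deg GB y) (DT xs y) (DT xs z') ?N"
      unfolding A.conv_def sum.distrib[symmetric]
    proof (rule sum.cong[OF refl])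
      fix U assume "U \<in> Pow ?N"
      have "?N - U \<subseteq> ?N" by auto
      show "signed (ksg (e xs) U (?N - U) + deg GB y * sum (e xs) (?N - U)) (mA (DT xs y U) (DT xs (z + z') (?N - U))) =
        signed (ksg (e xs) U (?N - U) + deg GB y * sum (e xs) (?N - U)) (mA (DT xs y U) (DT xs z (?N - U))) +
        signed (ksg (e xs) U (?N - U) + deg GB y * sum (e xs) (?N - U)) (mA (DT xs y U) (DT xs z' (?N - U)))"
        unfolding is_additive_add[OF DT_add[OF \<open>?N - U \<subseteq> ?N\<close>]]
        by (simp only: A.m_add_right signed_add)
    qed
    then show ?case
      using add unfolding is_additive_add[OF mB_additive(2)]
        is_additive_add[OF DT_add[OF subset_refl]] by simp
  qed
  also have "\<dots> = (\<Sum>i=0..n. \<Sum>S\<in>{S. S \<subseteq> ?N \<and> card S = i}.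
      signed (ksg (e xs) S (?N - S) + deg GB y * sum (e xs) (?N - S)) (mA (DT xs y S) (DT xs z (?N - S))))"
    unfolding A.conv_def by (rule sum_by_card(2)[symmetric])
  also have "\<dots> = (\<Sum>i=0..n. \<Sum>S\<in>{S. S \<subseteq> ?N \<and> card S = i}.
      signed (koszul_exp (sdegs GB (k - 1) xs) (unsh n S) +
          deg GB y * (int (n - i) * (k - 1) + sum_list (map (deg GB) (sel xs (?N - S)))))
        (mA (tinf (i + 1) (sel xs S @ [y])) (tinf (n - i + 1) (sel xs (?N - S) @ [z]))))"
  proof (rule sum.cong[OF refl], rule sum.cong[OF refl])
    fix i S assume "S \<in> {S. S \<subseteq> ?N \<and> card S = i}"
    then have S: "S \<subseteq> ?N" "card S = i" by auto
    have "finite S" using S(1) by (rule finite_subset) simp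
    then have c: "card (?N - S) = n - i" using S by (simp add: card_Diff_subset)
    have "sum_list (map (deg GB) (sel xs (?N - S))) = (\<Sum>j\<in>?N - S. deg GB (xs ! j))"
      using sum_deg_list[of "sel xs (?N - S)"] sum_sel[of "?N - S" "deg GB" xs] by (simp add: length_sel)
    then have "sum (e xs) (?N - S) = int (n - i) * (k - 1) + sum_list (map (deg GB) (sel xs (?N - S)))"
      unfolding shifted_degree_sum c by simp
    moreover have "koszul_exp (sdegs GB (k - 1) xs) (unsh n S) = ksg (e xs) S (?N - S)"
      using koszul_unsh[of S xs] S xs by simp
    ultimately show "signed (ksg (e xs) S (?N - S) + deg GB y * sum (e xs) (?N - S)) (mA (DT xs y S) (DT xs z (?N - S))) =
      signed (koszul_exp (sdegs GB (k - 1) xs) (unsh n S) +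
          deg GB y * (int (n - i) * (k - 1) + sum_list (map (deg GB) (sel xs (?N - S)))))
        (mA (tinf (i + 1) (sel xs S @ [y])) (tinf (n - i + 1) (sel xs (?N - S) @ [z])))"
      unfolding DT_def c S(2) by simp
  qed
  finally show ?thesis
    using xs sel_full[of xs] by (simp add: DT_def)
qed

lemma ell_derived_poisson: "derived_poisson k smB GB mB ell"
  unfolding derived_poisson_def
proof (intro conjI allI impI)
  show "graded_comm_alg smB GB mB" by (rule algB)
next
  fix n :: nat assume n: "1 \<le> n"
  show "multilinear smB smB n (ell n)" by (rule ell_ml[OF n])
  show "graded_mult GB GB n (k * (int n - 1) + 2 - int n) (ell n)"
    by (rule graded_multI[OF ell_ml[OF n] B.graded_group_axioms]) (rule ell_tinf_degree(1)[OF _ _ n])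
next
  fix n :: nat and xs ps
  assume n: "1 \<le> n" and a: "length xs = n \<and> list_all (homog GB) xs \<and> ps \<in> perms n"
  then show "ell n (map ((!) xs) ps) = signed (anti_exp (sdegs GB k xs) ps) (ell n xs)"
    by (intro ell_perm(1)) auto
next
  show "linf1 GB (k - 1) (dec k GB ell)"
    unfolding linf1_def by (intro allI impI; elim conjE) (rule ell_linf)
next
  fix n :: nat and as b c
  assume n: "1 \<le> n" and a: "length as = n - 1 \<and> list_all (homog GB) as \<and> homog GB b"
  then obtain m where m: "n = Suc m" by (cases n) auto
  show "ell n (as @ [mB b c]) = mB (ell n (as @ [b])) c +
      signed (deg GB b * (k * (int n - 1) + 2 - int n + sum_list (map (deg GB) as))) (mB b (ell n (as @ [c])))"
    unfolding m by (rule ell_der) (use a m in auto)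
qed

lemma tinf_dp_morphism: "dp_morphism k smB GB mB ell smA GA mA lam tinf"
proof -
  have "graded_mult GB GA n ((k - 1) * (int n - 1)) (tinf n)" if n: "1 \<le> n" for n
    by (rule graded_multI[OF tinf_ml[OF n] A.graded_group_axioms]) (rule ell_tinf_degree(2)[OF _ _ n])
  then show ?thesis
    unfolding dp_morphism_def
    by (intro conjI allI impI; (elim conjE)?)
      (assumption | rule tinf_ml ell_perm(2) tinf_morphism tinf_mult | blast)+
qed

end

theorem mainTheorem5:
  fixes smA :: "'k::field \<Rightarrow> 'a::ab_group_add \<Rightarrow> 'a" and GA :: "int \<Rightarrow> 'a set"
    and mA :: "'a \<Rightarrow> 'a \<Rightarrow> 'a" and dA :: "'a \<Rightarrow> 'a"
    and smB :: "'k \<Rightarrow> 'b::ab_group_add \<Rightarrow> 'b" and GB :: "int \<Rightarrow> 'b set"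
    and mB :: "'b \<Rightarrow> 'b \<Rightarrow> 'b" and dB :: "'b \<Rightarrow> 'b"
    and sig :: "'a \<Rightarrow> 'b" and tau :: "'b \<Rightarrow> 'a" and h :: "'a \<Rightarrow> 'a"
    and k :: int
    and lam :: "nat \<Rightarrow> 'a list \<Rightarrow> 'a"
    and ell :: "nat \<Rightarrow> 'b list \<Rightarrow> 'b"
    and tinf :: "nat \<Rightarrow> 'b list \<Rightarrow> 'a"
  assumes "dgca smA GA mA dA"
    and "dgca smB GB mB dB"
    and "semifull_alg_contraction smA GA mA dA smB GB mB dB sig tau h"
    and "derived_poisson k smA GA mA lam"
    and "\<forall>a. lam 1 [a] = dA a"
    and "\<forall>x. ell 1 [x] = dB x"
    and "\<forall>n\<ge>2. multilinear smB smB n (ell n)"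
    and "\<forall>x. tinf 1 [x] = tau x"
    and "\<forall>n\<ge>2. multilinear smB smA n (tinf n)"
    and "\<forall>n\<ge>2. \<forall>xs. length xs = n \<and> list_all (homog GB) xs \<longrightarrow>
           tinf n xs = h (\<Sum>p=2..n. part_sum (k - 1) GB (dec k GA lam) tinf xs p)"
    and "\<forall>n\<ge>2. \<forall>xs. length xs = n \<and> list_all (homog GB) xs \<longrightarrow>
           dec k GB ell n xs = sig (\<Sum>p=2..n. part_sum (k - 1) GB (dec k GA lam) tinf xs p)"
  shows "derived_poisson k smB GB mB ell \<and> dp_morphism k smB GB mB ell smA GA mA lam tinf"
proof -
  interpret transfer smA GA mA dA smB GB mB dB sig tau h k lam ell tinf
    by unfold_locales (fact assms)+
  show ?thesis using ell_derived_poisson tinf_dp_morphism by (rule conjI)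
qed

end
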